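(* Let $G$ be a function with property $\mathcal{P}$ and let $\|\cdot\|_G$ be the Orlicz norm it induces. Let $A\in\mathbb{R}^{n\times d}$ with $d\leq n$. Let $D\in\mathbb{R}^{n\times n}$ be a diagonal matrix whose diagonal entries are i.i.d. random variables with cumulative distribution function $1-e^{-G(t)}$ ($t\ge 0$). Let $\Pi_1\in\mathbb{R}^{t_1\times n}$ be a random sparse embedding matrix and $\Pi_2\in\mathbb{R}^{t_2\times t_1}$ a random Gaussian matrix (both as defined in the context, drawn independently of each other and of $D$), where $t_1=\Omega(d^2)$ and $t_2=\Omega(d)$. Then with probability at least $0.9$, for all $x\in\mathbb{R}^d$, $$\Omega\!\left(\frac{1}{\alpha'_G d\log n}\right)\|Ax\|_G\leq \|\Pi_2\Pi_1D^{-1}Ax\|_2\leq O(\alpha''_G d^2\log n)\,\|Ax\|_G,$$ where $\alpha'_G,\alpha''_G\geq 1$ are constants depending only on $G$. Furthermore, $\Pi_2\Pi_1D^{-1}A$ can be computed in $\mathrm{nnz}(A)+\mathrm{poly}(d)$ time, where $\mathrm{nnz}(A)$ is the number of nonzero entries of $A$.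
   Context: A function $G:\mathbb{R}\to\mathbb{R}_+$ has property $\mathcal{P}$ if: (1) $G$ is a nonzero, monotone nondecreasing, convex function on $[0,\infty)$; (2) $G(0)=0$, $G(1)=1$, and $G(x)=G(-x)$ for all $x\in\mathbb{R}$; (3) there is $s>0$ such that $G(x)=sx+(1-s)$ for all $x>1$; (4) there is $\delta_G>0$ such that $G$ is twice differentiable on $(0,\delta_G)$, the right derivatives $G'_+(0)$ and $G''_+(0)$ exist (where $G''_+(x)=\lim_{h\to0^+}(G'(x+h)-G'_+(x))/h$), and either $G'_+(0)>0$ or $G''_+(0)>0$; (5) there is $C_G>0$ such that $G(y)/G(x)\leq C_G(y/x)^2$ for all $0<x<y$. The Orlicz norm induced by $G$ is $\|x\|_G=\inf\{\alpha>0 : \sum_{i=1}^n G(|x_i|/\alpha)\leq 1\}$ for $x\in\mathbb{R}^n$. A random sparse embedding matrix $\Pi_1\in\mathbb{R}^{t_1\times n}$ is $\Pi_1=\Phi Y$, where $Y\in\mathbb{R}^{n\times n}$ is diagonal with independent uniformly random $\pm1$ diagonal entries, and $\Phi\in\{0,1\}^{t_1\times n}$ has $\Phi_{h(i),i}=1$ for every $i\in[n]$ and all other entries $0$, where $h:[n]\to[t_1]$ is a random hash function with each $h(i)$ uniformly distributed in $[t_1]$. A random Gaussian matrix in $\mathbb{R}^{t_2\times t_1}$ has i.i.d. standard Gaussian entries scaled by $1/\sqrt{t_2}$. The $O(\cdot),\Omega(\cdot)$ notation hides absolute constants. *)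

theory Defs
  imports "HOL-Probability.Probability" "HOL-Computational_Algebra.Polynomial"
    "Jordan_Normal_Form.Matrix"
begin

section \<open>Orlicz norms\<close>

text \<open>
  In the fifth condition the divisor is nonzero: the fourth condition makes G strictly positive
  immediately to the right of 0, hence, by monotonicity, on all positive reals.
\<close>

definition property_P :: "(real \<Rightarrow> real) \<Rightarrow> bool" where
  "property_P G \<longleftrightarrow>
     (\<forall>x. 0 \<le> G x) \<and>
     ((\<exists>x\<ge>0. G x \<noteq> 0) \<and> mono_on {0..} G \<and> convex_on {0..} G) \<and>
     (G 0 = 0 \<and> G 1 = 1 \<and> (\<forall>x. G x = G (- x))) \<and>
     (\<exists>s>0. \<forall>x>1. G x = s * x + (1 - s)) \<and>
     (\<exists>\<delta>>0. (\<forall>x\<in>{0<..<\<delta>}. G differentiable (at x) \<and> deriv G differentiable (at x)) \<and>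
        (\<exists>G1 G2. (G has_real_derivative G1) (at_right 0) \<and>
           ((\<lambda>h. (deriv G h - G1) / h) \<longlongrightarrow> G2) (at_right 0) \<and>
           (G1 > 0 \<or> G2 > 0))) \<and>
     (\<exists>C>0. \<forall>x y. 0 < x \<and> x < y \<longrightarrow> G y / G x \<le> C * (y / x)\<^sup>2)"

definition orlicz_norm :: "(real \<Rightarrow> real) \<Rightarrow> real vec \<Rightarrow> real" where
  "orlicz_norm G x = Inf {\<alpha>. \<alpha> > 0 \<and> (\<Sum>i<dim_vec x. G (\<bar>x $ i\<bar> / \<alpha>)) \<le> 1}"

definition l2_norm :: "real vec \<Rightarrow> real" where
  "l2_norm x = L2_set (\<lambda>i. x $ i) {..<dim_vec x}"

section \<open>The random matrices\<close>

definition sparse_embedding :: "nat \<Rightarrow> nat \<Rightarrow> (nat \<Rightarrow> nat) \<Rightarrow> (nat \<Rightarrow> real) \<Rightarrow> real mat" where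
  "sparse_embedding n t1 h y =
     mat t1 n (\<lambda>(r, i). if h i = r then 1 else 0) * mat_diag n y"

definition gaussian_mat :: "nat \<Rightarrow> nat \<Rightarrow> (nat \<times> nat \<Rightarrow> real) \<Rightarrow> real mat" where
  "gaussian_mat t1 t2 g = mat t2 t1 (\<lambda>(r, k). g (r, k) / sqrt (real t2))"

text \<open>A sample consists of the diagonal of D, the diagonal of Y, the hash function and the
  unscaled Gaussian entries.\<close>

type_synonym sample =
  "(nat \<Rightarrow> real) \<times> (nat \<Rightarrow> real) \<times> (nat \<Rightarrow> nat) \<times> (nat \<times> nat \<Rightarrow> real)"

text \<open>The third factor of the product is the inverse of the diagonal matrix D, whose diagonal
  entries are nonzero (almost surely, for the distribution considered).\<close>

definition sketched :: "real mat \<Rightarrow> nat \<Rightarrow> nat \<Rightarrow> nat \<Rightarrow> sample \<Rightarrow> real mat" where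
  "sketched A n t1 t2 = (\<lambda>(\<delta>, y, h, g).
     gaussian_mat t1 t2 g * sparse_embedding n t1 h y * mat_diag n (\<lambda>i. 1 / \<delta> i) * A)"

text \<open>The joint law of all the (mutually independent) random choices, where the entries of the
  diagonal of D have law \<open>\<mu>\<close>.\<close>

definition sample_measure :: "real measure \<Rightarrow> nat \<Rightarrow> nat \<Rightarrow> nat \<Rightarrow> sample measure" where
  "sample_measure \<mu> n t1 t2 =
     (\<Pi>\<^sub>M i\<in>{..<n}. \<mu>) \<Otimes>\<^sub>M
     (\<Pi>\<^sub>M i\<in>{..<n}. uniform_count_measure {-1, 1}) \<Otimes>\<^sub>M
     (\<Pi>\<^sub>M i\<in>{..<n}. uniform_count_measure {..<t1}) \<Otimes>\<^sub>M
     (\<Pi>\<^sub>M e\<in>{..<t2} \<times> {..<t1}. density lborel (\<lambda>x. ennreal (std_normal_density x)))"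

section \<open>Running time\<close>

text \<open>
  Running time is the number of unit-cost steps of a structured program on a real random access
  machine. The machine has natural-number registers and real registers, and arrays of both kinds
  addressed through natural-number registers. On naturals only (truncated) addition and
  subtraction are primitive: with unit-cost multiplication, huge numbers could be built in few
  steps. Array names and register names occurring in a program are constants, so a program can only
  use finitely many of each. There is no conversion from reals to naturals.
\<close>

record ram_state =
  ireg :: "nat \<Rightarrow> nat"
  rreg :: "nat \<Rightarrow> real"
  iarr :: "nat \<Rightarrow> nat \<Rightarrow> nat"
  rarr :: "nat \<Rightarrow> nat \<Rightarrow> real"

datatype instr =
    IConst nat nat
  | IAdd nat nat nat
  | ISub nat nat nat
  | ILoad nat nat nat
  | IStore nat nat nat
  | RConst nat rat
  | RAdd nat nat nat
  | RSub nat nat nat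
  | RMul nat nat nat
  | RDiv nat nat nat
  | RLoad nat nat nat
  | RStore nat nat nat

fun instr_effect :: "instr \<Rightarrow> ram_state \<Rightarrow> ram_state" where
  "instr_effect (IConst i c) s = s\<lparr>ireg := (ireg s)(i := c)\<rparr>"
| "instr_effect (IAdd i j k) s = s\<lparr>ireg := (ireg s)(i := ireg s j + ireg s k)\<rparr>"
| "instr_effect (ISub i j k) s = s\<lparr>ireg := (ireg s)(i := ireg s j - ireg s k)\<rparr>"
| "instr_effect (ILoad i a j) s = s\<lparr>ireg := (ireg s)(i := iarr s a (ireg s j))\<rparr>"
| "instr_effect (IStore a j i) s =
     s\<lparr>iarr := (iarr s)(a := (iarr s a)(ireg s j := ireg s i))\<rparr>"
| "instr_effect (RConst i c) s = s\<lparr>rreg := (rreg s)(i := of_rat c)\<rparr>"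
| "instr_effect (RAdd i j k) s = s\<lparr>rreg := (rreg s)(i := rreg s j + rreg s k)\<rparr>"
| "instr_effect (RSub i j k) s = s\<lparr>rreg := (rreg s)(i := rreg s j - rreg s k)\<rparr>"
| "instr_effect (RMul i j k) s = s\<lparr>rreg := (rreg s)(i := rreg s j * rreg s k)\<rparr>"
| "instr_effect (RDiv i j k) s = s\<lparr>rreg := (rreg s)(i := rreg s j / rreg s k)\<rparr>"
| "instr_effect (RLoad i a j) s = s\<lparr>rreg := (rreg s)(i := rarr s a (ireg s j))\<rparr>"
| "instr_effect (RStore a j i) s =
     s\<lparr>rarr := (rarr s)(a := (rarr s a)(ireg s j := rreg s i))\<rparr>"

datatype test = ILess nat nat | RLess nat nat

fun holds :: "test \<Rightarrow> ram_state \<Rightarrow> bool" where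
  "holds (ILess i j) s \<longleftrightarrow> ireg s i < ireg s j"
| "holds (RLess i j) s \<longleftrightarrow> rreg s i < rreg s j"

datatype prog =
    Instr instr
  | Seq prog prog
  | Cond test prog prog
  | Loop test prog

text \<open>\<open>exec P s k s'\<close>: started in state \<open>s\<close>, the program \<open>P\<close> halts in state \<open>s'\<close> after exactly
  \<open>k\<close> steps, where every instruction and every evaluation of a test is one step.\<close>

inductive exec :: "prog \<Rightarrow> ram_state \<Rightarrow> nat \<Rightarrow> ram_state \<Rightarrow> bool" where
  Instr: "exec (Instr c) s 1 (instr_effect c s)"
| Seq: "exec P s k s' \<Longrightarrow> exec Q s' l s'' \<Longrightarrow> exec (Seq P Q) s (k + l) s''"
| CondTrue: "holds b s \<Longrightarrow> exec P s k s' \<Longrightarrow> exec (Cond b P Q) s (1 + k) s'"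
| CondFalse: "\<not> holds b s \<Longrightarrow> exec Q s k s' \<Longrightarrow> exec (Cond b P Q) s (1 + k) s'"
| LoopFalse: "\<not> holds b s \<Longrightarrow> exec (Loop b P) s 1 s"
| LoopTrue: "holds b s \<Longrightarrow> exec P s k s' \<Longrightarrow> exec (Loop b P) s' l s'' \<Longrightarrow>
    exec (Loop b P) s (1 + k + l) s''"

definition nonzeros :: "real mat \<Rightarrow> (nat \<times> nat) set" where
  "nonzeros A = {(i, j). i < dim_row A \<and> j < dim_col A \<and> A $$ (i, j) \<noteq> 0}"

definition nnz :: "real mat \<Rightarrow> nat" where
  "nnz A = card (nonzeros A)"

text \<open>
  The matrix A is given by the list of its nonzero entries (row index, column index, value) in
  arbitrary order, the diagonal matrices by their diagonals, the hashing matrix by its hash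
  function, and the Gaussian matrix by its entries in row-major order. The content of the rest of
  the memory is arbitrary.
\<close>

definition sketch_input ::
  "real mat \<Rightarrow> nat \<Rightarrow> nat \<Rightarrow> nat \<Rightarrow> nat \<Rightarrow> sample \<Rightarrow> ram_state \<Rightarrow> bool" where
  "sketch_input A n d t1 t2 = (\<lambda>(\<delta>, y, h, g) s.
     ireg s 0 = n \<and> ireg s 1 = d \<and> ireg s 2 = t1 \<and> ireg s 3 = t2 \<and> ireg s 4 = nnz A \<and>
     bij_betw (\<lambda>l. (iarr s 0 l, iarr s 1 l)) {..<nnz A} (nonzeros A) \<and>
     (\<forall>l<nnz A. rarr s 0 l = A $$ (iarr s 0 l, iarr s 1 l)) \<and>
     (\<forall>i<n. iarr s 2 i = h i \<and> rarr s 1 i = \<delta> i \<and> rarr s 2 i = y i) \<and>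
     (\<forall>r<t2. \<forall>k<t1. rarr s 3 (r * t1 + k) = gaussian_mat t1 t2 g $$ (r, k)))"

text \<open>The result is left, in row-major order, in the real array with name 4.\<close>

definition sketch_output :: "real mat \<Rightarrow> ram_state \<Rightarrow> bool" where
  "sketch_output B s \<longleftrightarrow>
     (\<forall>r<dim_row B. \<forall>j<dim_col B. rarr s 4 (r * dim_col B + j) = B $$ (r, j))"

end

theory Submission
  imports Defs "Jordan_Normal_Form.Determinant"
begin

text \<open>
  Let V be the column space of A. Its Orlicz norm has a basis of nearly maximal determinant, whose
  vectors have norm at most 1 and whose coordinates are bounded by 3 times the norm. If z is a basis
  vector, then the squares of \<open>z i / \<delta> i\<close> are controlled by the ratios \<open>G \<bar>z i\<bar> / G (\<delta> i)\<close>, and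
  since \<open>G (\<delta> i)\<close> is exponentially distributed, the sum of these ratios, truncated, has mean
  \<open>O(ln n)\<close>; summing over the basis gives the upper bound. For the lower bound, the maximum of
  \<open>\<bar>z i\<bar> / \<delta> i\<close> is smaller than \<open>\<parallel>z\<parallel> / (2 T)\<close> with probability at most \<open>exp (- T)\<close>, and with \<open>T\<close> of order
  \<open>d ln n\<close> this survives a union bound over a net of V. Conditionally on the diagonal, the sparse
  embedding preserves the Euclidean norm on the d-dimensional space obtained up to constants by a
  second moment computation, and the Gaussian matrix does so on the image by chi-square tails and a
  net of \<open>2 ^ O(d)\<close> points.
\<close>

section \<open>Seminorms on coordinate functions\<close>

text \<open>The two logarithms have different sources. The reciprocal of an exponential variable has
  infinite mean, diverging logarithmically at 0; as all n diagonal entries exceed 1/(100 n) with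
  high probability, truncating there leaves about log n dyadic scales of bounded mean. For the lower
  bound, the entries of the inverse diagonal are only known to be at most 100 n, so the net must be
  polynomially fine in 1/n and gets n to the O(d) points; this forces T of order d ln n. The upper
  bound needs no net: by the triangle inequality only the at most d basis vectors must be
  controlled, which is why coordinates have to be bounded by the norm. It comes out linear in d and
  is weakened to the square at the very end. Near maximality of the determinant, instead of
  maximality, avoids a compactness argument. Each stage works with an orthonormal basis of the space
  delivered by the previous one, so the bases depend on earlier samples and a rank-deficient A needs
  no separate treatment; Fubini glues the good events, with total probability 0.97 * 0.99^3 >
  0.9.\<close>

definition seminorm :: "((nat \<Rightarrow> real) \<Rightarrow> real) \<Rightarrow> bool" where
  "seminorm f \<longleftrightarrow> (\<forall>u v. f (\<lambda>i. u i + v i) \<le> f u + f v) \<and> (\<forall>c u. f (\<lambda>i. c * u i) = \<bar>c\<bar> * f u)"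

lemma seminorm_add: "seminorm f \<Longrightarrow> f (\<lambda>i. u i + v i) \<le> f u + f v"
  by (simp add: seminorm_def)

lemma seminorm_scale: "seminorm f \<Longrightarrow> f (\<lambda>i. c * u i) = \<bar>c\<bar> * f u"
  by (simp add: seminorm_def)

lemma seminorm_0: "seminorm f \<Longrightarrow> f (\<lambda>i. 0) = 0"
  using seminorm_scale[of f 0 "\<lambda>i. 0"] by simp

lemma seminorm_minus: "seminorm f \<Longrightarrow> f (\<lambda>i. u i - v i) = f (\<lambda>i. v i - u i)"
  using seminorm_scale[of f "-1" "\<lambda>i. u i - v i"] by simp

lemma seminorm_nonneg: "seminorm f \<Longrightarrow> 0 \<le> f u"
  using seminorm_add[of f u "\<lambda>i. -1 * u i"] seminorm_scale[of f "-1" u] seminorm_0[of f]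
  by simp

lemma seminorm_triangle: "seminorm f \<Longrightarrow> f u \<le> f v + f (\<lambda>i. u i - v i)"
  using seminorm_add[of f v "\<lambda>i. u i - v i"] by simp

lemma seminorm_triangle': "seminorm f \<Longrightarrow> f v - f (\<lambda>i. u i - v i) \<le> f u"
  using seminorm_triangle[of f v u] seminorm_minus[of f u v] by linarith

lemma seminorm_sum:
  assumes "seminorm f"
  shows "f (\<lambda>i. \<Sum>a\<in>S. c a * u a i) \<le> (\<Sum>a\<in>S. \<bar>c a\<bar> * f (u a))"
proof (induction S rule: infinite_finite_induct)
  case (insert x F)
  have "f (\<lambda>i. \<Sum>a\<in>insert x F. c a * u a i) \<le> f (\<lambda>i. c x * u x i) + f (\<lambda>i. \<Sum>a\<in>F. c a * u a i)"
    using insert seminorm_add[OF assms, of "\<lambda>i. c x * u x i" "\<lambda>i. \<Sum>a\<in>F. c a * u a i"] by simp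
  then show ?case using insert seminorm_scale[OF assms, of "c x" "u x"] by simp
qed (use seminorm_0[OF assms] in simp_all)

lemma seminorm_comp:
  assumes "seminorm f"
    and "\<And>u v. T (\<lambda>i. u i + v i) = (\<lambda>i. T u i + T v i)" and "\<And>c u. T (\<lambda>i. c * u i) = (\<lambda>i. c * T u i)"
  shows "seminorm (\<lambda>u. f (T u))"
  using assms unfolding seminorm_def by simp

lemma seminorm_linear_comb:
  assumes "seminorm f"
  shows "seminorm (\<lambda>u. f (\<lambda>i. \<Sum>a\<in>S. u a * q a i))"
  by (rule seminorm_comp[OF assms])
     (simp_all add: algebra_simps sum.distrib sum_distrib_left)

text \<open>The common shape of the three embedding statements: \<open>c\<close> runs over
  coordinates with respect to a basis of the subspace at hand.\<close>

abbreviation sandwiched :: "real \<Rightarrow> real \<Rightarrow> ('a \<Rightarrow> real) \<Rightarrow> ('a \<Rightarrow> real) \<Rightarrow> bool" where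
  "sandwiched l u N F \<equiv> \<forall>c. l * N c \<le> F c \<and> F c \<le> u * N c"

lemma abs_le_L2_set:
  assumes "finite S" "i \<in> S"
  shows "\<bar>f i\<bar> \<le> L2_set f S"
  using member_le_L2_set[OF assms, of "\<lambda>i. \<bar>f i\<bar>"] by (simp add: L2_set_def)

lemma seminorm_L2: "seminorm (\<lambda>u. L2_set u S)"
  unfolding seminorm_def
proof safe
  fix u v :: "nat \<Rightarrow> real" and c :: real
  show "L2_set (\<lambda>i. u i + v i) S \<le> L2_set u S + L2_set v S"
    by (rule L2_set_triangle_ineq)
  have "L2_set (\<lambda>i. c * u i) S = sqrt (c\<^sup>2 * (\<Sum>i\<in>S. (u i)\<^sup>2))"
    by (simp add: L2_set_def power_mult_distrib sum_distrib_left)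
  then show "L2_set (\<lambda>i. c * u i) S = \<bar>c\<bar> * L2_set u S"
    by (simp add: L2_set_def real_sqrt_mult)
qed

text \<open>Seminorms of finitely many coordinates are continuous, so an inequality between them may be
  tested on rational vectors; this gives the measurability of the event in the theorem.\<close>

lemma seminorm_le_of_rational:
  assumes f: "seminorm f" and g: "seminorm g"
    and local: "\<And>u v. (\<And>i. i < d \<Longrightarrow> u i = v i) \<Longrightarrow> f u = f v" "\<And>u v. (\<And>i. i < d \<Longrightarrow> u i = v i) \<Longrightarrow> g u = g v"
    and rat: "\<And>x. (\<And>i. x i \<in> \<rat>) \<Longrightarrow> f x \<le> g x"
  shows "f u \<le> g u"
proof (rule field_le_epsilon)
  fix e :: real assume e: "0 < e"
  define b where "b = (\<lambda>a i::nat. if i = a then 1 else 0 :: real)"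
  \<comment> \<open>An error of at most \<open>e / C\<close> in every coordinate changes
    \<open>f\<close> and \<open>g\<close> together by at most \<open>e\<close>; the summand 1 keeps
    \<open>C\<close> positive.\<close>
  define C where "C = (\<Sum>a<d. f (b a)) + (\<Sum>a<d. g (b a)) + 1"
  have C: "C > 0" unfolding C_def
    by (intro add_nonneg_pos add_nonneg_nonneg sum_nonneg seminorm_nonneg f g) auto
  have "\<exists>q\<in>\<rat>. \<bar>u i - q\<bar> \<le> e / C" for i
  proof -
    have "u i < u i + e / C" using e C by simp
    then obtain q where "q \<in> \<rat>" "u i < q" "q < u i + e / C" using Rats_dense_in_real by blast
    then show ?thesis by (intro bexI[of _ q]) auto
  qed
  then obtain x where x: "\<And>i. x i \<in> \<rat>" "\<And>i. \<bar>u i - x i\<bar> \<le> e / C" by metis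
  have *: "h (\<lambda>i. u i - x i) \<le> e / C * (\<Sum>a<d. h (b a))"
    if h: "seminorm h" and l: "\<And>u v. (\<And>i. i < d \<Longrightarrow> u i = v i) \<Longrightarrow> h u = h v" for h
  proof -
    have "h (\<lambda>i. u i - x i) = h (\<lambda>i. \<Sum>a<d. (u a - x a) * b a i)"
      by (rule l) (simp add: b_def if_distrib cong: if_cong)
    also have "\<dots> \<le> (\<Sum>a<d. \<bar>u a - x a\<bar> * h (b a))" by (rule seminorm_sum[OF h])
    also have "\<dots> \<le> (\<Sum>a<d. e / C * h (b a))"
      by (intro sum_mono mult_right_mono x seminorm_nonneg h)
    finally show ?thesis by (simp add: sum_distrib_left)
  qed
  have "f u \<le> f x + f (\<lambda>i. u i - x i)" by (rule seminorm_triangle[OF f])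
  also have "\<dots> \<le> g x + f (\<lambda>i. u i - x i)" using rat[OF x(1)] by simp
  also have "\<dots> \<le> g u + g (\<lambda>i. u i - x i) + f (\<lambda>i. u i - x i)"
    using seminorm_triangle'[OF g, of x u] by simp
  also have "\<dots> \<le> g u + e / C * (\<Sum>a<d. g (b a)) + e / C * (\<Sum>a<d. f (b a))"
    using *[OF f local(1)] *[OF g local(2)] by (simp add: add_mono)
  also have "\<dots> = g u + e / C * (C - 1)"
    by (simp add: C_def distrib_left)
  also have "\<dots> \<le> g u + e / C * C"
    using e C by (intro add_left_mono mult_left_mono) auto
  finally show "f u \<le> g u + e" using C by simp
qed

section \<open>Orthonormal and well-conditioned bases\<close>

abbreviation lincomb :: "nat \<Rightarrow> (nat \<Rightarrow> real) \<Rightarrow> (nat \<Rightarrow> nat \<Rightarrow> real) \<Rightarrow> nat \<Rightarrow> real" where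
  "lincomb r c q i \<equiv> (\<Sum>a<r. c a * q a i)"

definition orthonormal_family :: "nat \<Rightarrow> nat \<Rightarrow> (nat \<Rightarrow> nat \<Rightarrow> real) \<Rightarrow> bool" where
  "orthonormal_family m r q \<longleftrightarrow>
     (\<forall>a<r. \<forall>b<r. (\<Sum>i<m. q a i * q b i) = (if a = b then 1 else 0))"

text \<open>Gram-Schmidt. A vector whose residual vanishes is dropped, so dependent families are
  allowed and \<open>r\<close> may fall below \<open>d\<close>.\<close>

lemma orthonormal_span_exists:
  fixes b :: "nat \<Rightarrow> nat \<Rightarrow> real"
  shows "\<exists>r q. r \<le> d \<and> orthonormal_family m r q \<and>
           (\<forall>j<d. \<exists>c. \<forall>i<m. b j i = (\<Sum>a<r. c a * q a i))"
proof (induction d)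
  case 0
  then show ?case by (intro exI[of _ 0]) (simp add: orthonormal_family_def)
next
  case (Suc d)
  then obtain r q where r: "r \<le> d" and q: "orthonormal_family m r q"
    and s: "\<And>j. j < d \<Longrightarrow> \<exists>c. \<forall>i<m. b j i = (\<Sum>a<r. c a * q a i)" by blast
  define p where "p = (\<lambda>a. \<Sum>i<m. b d i * q a i)"
  define z where "z = (\<lambda>i. b d i - (\<Sum>a<r. p a * q a i))"
  define N where "N = L2_set z {..<m}"
  have N2: "N\<^sup>2 = (\<Sum>i<m. z i * z i)"
    by (simp add: N_def L2_set_def sum_nonneg power2_eq_square[symmetric])
  have orth: "(\<Sum>i<m. z i * q a i) = 0" if a: "a < r" for a
  proof -
    have "(\<Sum>i<m. z i * q a i) = p a - (\<Sum>i<m. \<Sum>e<r. p e * (q e i * q a i))"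
      by (simp add: z_def p_def left_diff_distrib sum_subtractf sum_distrib_right mult.assoc)
    also have "(\<Sum>i<m. \<Sum>e<r. p e * (q e i * q a i)) = (\<Sum>e<r. p e * (\<Sum>i<m. q e i * q a i))"
      by (subst sum.swap) (simp add: sum_distrib_left)
    also have "\<dots> = (\<Sum>e<r. p e * (if e = a then 1 else 0))"
      using q a unfolding orthonormal_family_def by (intro sum.cong) auto
    also have "\<dots> = p a" using a by (simp add: if_distrib cong: if_cong)
    finally show ?thesis by simp
  qed
  show ?case
  proof (cases "N = 0")
    case True
    then have z0: "z i = 0" if "i < m" for i
      using that by (simp add: N_def L2_set_eq_0_iff)
    have "\<exists>c. \<forall>i<m. b j i = (\<Sum>a<r. c a * q a i)" if "j < Suc d" for j
    proof (cases "j = d")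
      case True
      then show ?thesis using z0 by (intro exI[of _ p]) (auto simp: z_def)
    next
      case False
      then show ?thesis using s that by simp
    qed
    then show ?thesis using r q by (intro exI[of _ r] exI[of _ q]) auto
  next
    case False
    define q' where "q' = q(r := (\<lambda>i. z i / N))"
    have old: "q' a = q a" if "a < r" for a using that by (simp add: q'_def)
    have new: "q' r = (\<lambda>i. z i / N)" by (simp add: q'_def)
    have "orthonormal_family m (Suc r) q'"
      unfolding orthonormal_family_def
    proof (intro allI impI)
      fix a e assume ae: "a < Suc r" "e < Suc r"
      consider "a < r" "e < r" | "a = r" "e < r" | "a < r" "e = r" | "a = r" "e = r"
        using ae by linarith
      then show "(\<Sum>i<m. q' a i * q' e i) = (if a = e then 1 else 0)"
      proof cases
        case 1
        then show ?thesis using q by (simp add: old orthonormal_family_def)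
      next
        case 2
        then have "(\<Sum>i<m. q' a i * q' e i) = (\<Sum>i<m. z i * q e i) / N"
          by (simp add: old new sum_divide_distrib)
        then show ?thesis using 2 orth by simp
      next
        case 3
        then have "(\<Sum>i<m. q' a i * q' e i) = (\<Sum>i<m. z i * q a i) / N"
          by (simp add: old new sum_divide_distrib mult.commute)
        then show ?thesis using 3 orth by simp
      next
        case 4
        then have "(\<Sum>i<m. q' a i * q' e i) = (\<Sum>i<m. z i * z i) / N\<^sup>2"
          by (simp add: new sum_divide_distrib power2_eq_square)
        then show ?thesis using 4 False N2[symmetric] by simp
      qed
    qed
    moreover have "\<exists>c. \<forall>i<m. b j i = (\<Sum>a<Suc r. c a * q' a i)" if j: "j < Suc d" for j
    proof (cases "j = d")
      case True
      show ?thesis using True False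
        by (intro exI[of _ "p(r := N)"]) (auto simp: z_def old new)
    next
      case jd: False
      then obtain c where "\<forall>i<m. b j i = (\<Sum>a<r. c a * q a i)" using s j by force
      then show ?thesis by (intro exI[of _ "c(r := 0)"]) (auto simp: old)
    qed
    ultimately show ?thesis using r by (intro exI[of _ "Suc r"] exI[of _ q']) auto
  qed
qed

lemma orthonormal_span_lincomb:
  fixes b :: "nat \<Rightarrow> nat \<Rightarrow> real"
  assumes "\<forall>j<d. \<exists>c. \<forall>i<m. b j i = lincomb r c q i"
  shows "\<exists>c. \<forall>i<m. (lincomb d x b i) = lincomb r c q i"
proof -
  have "\<forall>j\<in>{..<d}. \<exists>c. \<forall>i<m. b j i = lincomb r c q i" using assms by simp
  from bchoice[OF this] obtain C
    where C: "\<And>j i. j < d \<Longrightarrow> i < m \<Longrightarrow> b j i = (\<Sum>a<r. C j a * q a i)"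
    by blast
  have "lincomb d x b i = (\<Sum>a<r. (lincomb d x C a) * q a i)" if "i < m" for i
  proof -
    have "lincomb d x b i = (\<Sum>j<d. \<Sum>a<r. x j * C j a * q a i)"
      by (intro sum.cong refl, subst C) (auto simp: that sum_distrib_left mult.assoc)
    also have "\<dots> = (\<Sum>a<r. \<Sum>j<d. x j * C j a * q a i)"
      by (rule sum.swap)
    also have "\<dots> = (\<Sum>a<r. (lincomb d x C a) * q a i)"
      by (simp only: sum_distrib_right)
    finally show ?thesis .
  qed
  then show ?thesis by (intro exI[of _ "\<lambda>a. \<Sum>j<d. x j * C j a"]) simp
qed

text \<open>Pythagoras; it lets every later stage compare its norm with \<open>L2_set c\<close>
  instead of the norm of the vector.\<close>

lemma orthonormal_L2_lincomb:
  assumes q: "orthonormal_family m r q"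
  shows "L2_set (lincomb r c q) {..<m} = L2_set c {..<r}"
proof -
  have "(\<Sum>i<m. (lincomb r c q i)\<^sup>2) = (\<Sum>i<m. \<Sum>a<r. \<Sum>e<r. (c a * q a i) * (c e * q e i))"
    by (simp add: power2_eq_square sum_product)
  also have "\<dots> = (\<Sum>a<r. \<Sum>i<m. \<Sum>e<r. (c a * q a i) * (c e * q e i))"
    by (rule sum.swap)
  also have "\<dots> = (\<Sum>a<r. \<Sum>e<r. \<Sum>i<m. (c a * q a i) * (c e * q e i))"
    by (intro sum.cong refl sum.swap)
  also have "\<dots> = (\<Sum>a<r. \<Sum>e<r. c a * c e * (\<Sum>i<m. q a i * q e i))"
    by (simp add: sum_distrib_left mult_ac)
  also have "\<dots> = (\<Sum>a<r. \<Sum>e<r. c a * c e * (if a = e then 1 else 0))"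
    using q unfolding orthonormal_family_def by (intro sum.cong) auto
  also have "\<dots> = (\<Sum>a<r. (c a)\<^sup>2)"
    by (intro sum.cong refl) (simp add: if_distrib[of "(*) _"] power2_eq_square cong: if_cong)
  finally show ?thesis by (simp add: L2_set_def)
qed

text \<open>A basis of nearly maximal determinant inside B: replacing a basis vector by another
  point of B cannot double the determinant, which by Cramer's rule bounds the coordinates.\<close>

lemma near_auerbach_basis:
  fixes B :: "(nat \<Rightarrow> real) set"
  assumes bdd: "\<And>c a. c \<in> B \<Longrightarrow> a < r \<Longrightarrow> \<bar>c a\<bar> \<le> R"
    and abs: "\<And>a. a < r \<Longrightarrow> \<exists>t>0. (\<lambda>i. if i = a then t else 0) \<in> B"
  shows "\<exists>X. (\<forall>j<r. X j \<in> B) \<and>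
           (\<forall>c\<in>B. \<exists>y. (\<forall>j<r. \<bar>y j\<bar> \<le> 2) \<and> (\<forall>i<r. c i = lincomb r y X i))"
proof -
  define M where "M = (\<lambda>X :: nat \<Rightarrow> nat \<Rightarrow> real. mat r r (\<lambda>(i, j). X j i))"
  have Mc: "M X \<in> carrier_mat r r" for X by (simp add: M_def)
  define D where "D = {\<bar>det (M X)\<bar> | X. \<forall>j<r. X j \<in> B}"
  \<comment> \<open>Leibniz expansion: boundedness of B makes the supremum of the determinants
    finite.\<close>
  have bound: "\<bar>det (M X)\<bar> \<le> (\<Sum>p\<in>{p. p permutes {0..<r}}. R ^ r)" if X: "\<forall>j<r. X j \<in> B" for X
  proof -
    have "\<bar>det (M X)\<bar> \<le> (\<Sum>p\<in>{p. p permutes {0..<r}}. \<bar>signof p * (\<Prod>i = 0..<r. M X $$ (i, p i))\<bar>)"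
      unfolding det_def'[OF Mc] by (rule sum_abs)
    also have "\<dots> \<le> (\<Sum>p\<in>{p. p permutes {0..<r}}. R ^ r)"
    proof (rule sum_mono)
      fix p assume p: "p \<in> {p. p permutes {0..<r}}"
      have "\<bar>signof p * (\<Prod>i = 0..<r. M X $$ (i, p i))\<bar> = (\<Prod>i = 0..<r. \<bar>M X $$ (i, p i)\<bar>)"
        by (simp add: abs_mult abs_prod sign_def)
      also have "\<dots> \<le> (\<Prod>i = 0..<r. R)"
      proof (rule prod_mono)
        fix i assume i: "i \<in> {0..<r}"
        then have "p i < r" using p permutes_in_image[of p "{0..<r}" i] by auto
        then show "0 \<le> \<bar>M X $$ (i, p i)\<bar> \<and> \<bar>M X $$ (i, p i)\<bar> \<le> R"
          using X i bdd by (simp add: M_def)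
      qed
      finally show "\<bar>signof p * (\<Prod>i = 0..<r. M X $$ (i, p i))\<bar> \<le> R ^ r" by simp
    qed
    finally show ?thesis .
  qed
  then have bddD: "bdd_above D" unfolding D_def by (intro bdd_aboveI) auto
  obtain t where t: "\<And>a. a < r \<Longrightarrow> t a > 0 \<and> (\<lambda>i. if i = a then t a else 0) \<in> B"
    using abs by metis
  \<comment> \<open>Multiples of the unit vectors give a diagonal matrix, so the supremum is
    positive and the determinant chosen below is nonzero.\<close>
  define X0 where "X0 = (\<lambda>a i::nat. if i = a then t a else 0 :: real)"
  have X0: "\<forall>j<r. X0 j \<in> B" using t by (simp add: X0_def)
  have "det (M X0) = prod_list (diag_mat (M X0))"
    by (rule det_upper_triangular[OF _ Mc]) (auto simp: upper_triangular_def M_def X0_def)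
  also have "\<dots> > 0"
    by (auto simp: prod_list_diag_prod M_def X0_def t intro!: prod_pos)
  finally have pos0: "\<bar>det (M X0)\<bar> > 0" by simp
  have Sup_pos: "Sup D > 0"
    using pos0 by (rule less_le_trans) (rule cSup_upper[OF _ bddD], use X0 D_def in auto)
  have "D \<noteq> {}" using X0 by (auto simp: D_def)
  \<comment> \<open>More than half of the supremum can always be reached, attained or not; the price
    is the bound 2 on the coordinates where a true maximum would give 1.\<close>
  then obtain X where X: "\<forall>j<r. X j \<in> B" and big: "Sup D / 2 < \<bar>det (M X)\<bar>"
    using less_cSupD[of D "Sup D / 2"] Sup_pos by (auto simp: D_def)
  have nz: "det (M X) \<noteq> 0" using big Sup_pos by auto
  have "\<exists>y. (\<forall>j<r. \<bar>y j\<bar> \<le> 2) \<and> (\<forall>i<r. c i = lincomb r y X i)" if c: "c \<in> B" for c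
  proof -
    have "vec r c \<in> carrier_vec r" by simp
    define Y where "Y = (1 / det (M X)) \<cdot>\<^sub>m adj_mat (M X)"
    have Y: "Y \<in> carrier_mat r r" "M X * Y = 1\<^sub>m r"
      using adj_mat[OF Mc[of X]] nz mult_smult_distrib[OF Mc[of X] adj_mat(1)[OF Mc[of X]]]
      by (auto simp: Y_def)
    define yv where "yv = Y *\<^sub>v vec r c"
    have yv: "yv \<in> carrier_vec r" using Y by (simp add: yv_def)
    have My: "M X *\<^sub>v yv = vec r c"
      unfolding yv_def by (subst assoc_mult_mat_vec[symmetric, OF Mc Y(1)]) (auto simp: Y(2))
    have "\<bar>yv $ k\<bar> \<le> 2" if k: "k < r" for k
    proof -
      have eq: "replace_col (M X) (vec r c) k = M (X(k := c))"
        by (rule eq_matI) (auto simp: replace_col_def M_def)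
      have "\<bar>det (M (X(k := c)))\<bar> \<le> Sup D"
        by (rule cSup_upper[OF _ bddD]) (use X c in \<open>auto simp: D_def\<close>)
      then have "\<bar>yv $ k\<bar> * \<bar>det (M X)\<bar> \<le> Sup D"
        using cramer_lemma_mat[OF Mc[of X] yv k] by (simp add: My eq abs_mult)
      also have "\<dots> \<le> 2 * \<bar>det (M X)\<bar>" using big by simp
      finally show ?thesis using nz by simp
    qed
    moreover have "c i = (\<Sum>j<r. yv $ j * X j i)" if i: "i < r" for i
    proof -
      have "c i = (M X *\<^sub>v yv) $ i" using i by (simp add: My)
      also have "\<dots> = (\<Sum>j<r. yv $ j * X j i)"
        using i yv by (simp add: M_def scalar_prod_def mult.commute lessThan_atLeast0)
      finally show ?thesis .
    qed
    ultimately show ?thesis by (intro exI[of _ "\<lambda>j. yv $ j"]) auto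
  qed
  then show ?thesis using X by blast
qed

section \<open>Orlicz norms\<close>

text \<open>The form in which \<open>property_P\<close> enters the estimates: \<open>pos\<close>
  comes from the derivatives at 0, \<open>gt1\<close> from the linear tail with positive slope,
  \<open>growth\<close> from the quadratic bound, extended to x = y. \<open>C_ge_1\<close> lets C
  absorb additive constants and serve as \<alpha>''.\<close>

locale orlicz_function =
  fixes G :: "real \<Rightarrow> real" and C :: real
  assumes nonneg: "0 \<le> G x"
    and zero: "G 0 = 0" and one: "G 1 = 1"
    and mono: "0 \<le> x \<Longrightarrow> x \<le> y \<Longrightarrow> G x \<le> G y"
    and convex: "convex_on {0..} G"
    and pos: "0 < x \<Longrightarrow> 0 < G x"
    and gt1: "1 < x \<Longrightarrow> 1 < G x"
    and C_ge_1: "1 \<le> C"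
    and growth: "0 < x \<Longrightarrow> x \<le> y \<Longrightarrow> G y \<le> C * (y / x)\<^sup>2 * G x"

lemma property_P_orlicz_function:
  assumes "property_P G"
  shows "\<exists>C. orlicz_function G C"
proof -
  have nonneg: "0 \<le> G x" for x using assms by (simp add: property_P_def)
  have m: "mono_on {0..} G" and convex: "convex_on {0..} G" and zero: "G 0 = 0" and one: "G 1 = 1"
    using assms by (simp_all add: property_P_def)
  have mono: "G x \<le> G y" if "0 \<le> x" "x \<le> y" for x y
    using that by (intro mono_onD[OF m]) auto
  obtain s where s: "s > 0" "\<And>x. x > 1 \<Longrightarrow> G x = s * x + (1 - s)"
    using assms by (auto simp: property_P_def)
  obtain G1 G2 where G1: "(G has_real_derivative G1) (at_right 0)"
    and G2: "((\<lambda>h. (deriv G h - G1) / h) \<longlongrightarrow> G2) (at_right 0)" and G12: "G1 > 0 \<or> G2 > 0"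
    using assms by (auto simp: property_P_def)
  obtain C where C: "C > 0" "\<And>x y. 0 < x \<Longrightarrow> x < y \<Longrightarrow> G y / G x \<le> C * (y / x)\<^sup>2"
    using assms by (auto simp: property_P_def)
  \<comment> \<open>If G vanished at some x > 0, monotonicity would make it 0 on [0, x], and both
    one-sided derivatives at 0 would vanish.\<close>
  have pos: "0 < G x" if x: "0 < x" for x
  proof (rule ccontr)
    assume "\<not> 0 < G x"
    then have Gx: "G x = 0" using nonneg[of x] by linarith
    have z: "G t = 0" if "0 \<le> t" "t \<le> x" for t
      using mono[OF that] nonneg[of t] Gx by linarith
    have ev: "\<forall>\<^sub>F t in at_right 0. t \<in> {0<..<x}"
      using x by (auto simp: eventually_at_right_field)
    have "((\<lambda>t. (G t - G 0) / (t - 0)) \<longlongrightarrow> G1) (at_right 0)"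
      using G1 by (simp add: has_field_derivative_iff)
    moreover have "((\<lambda>t. (G t - G 0) / (t - 0)) \<longlongrightarrow> 0) (at_right 0)"
      by (rule tendsto_eventually, rule eventually_mono[OF ev]) (simp add: z)
    ultimately have G10: "G1 = 0"
      using tendsto_unique by (metis trivial_limit_at_right_real)
    have "deriv G t = 0" if "t \<in> {0<..<x}" for t
    proof -
      have "(G has_real_derivative 0) (at t)"
        by (rule has_field_derivative_transform_within_open[of "\<lambda>_. 0" _ _ "{0<..<x}"])
           (use that z in auto)
      then show ?thesis by (rule DERIV_imp_deriv)
    qed
    then have "((\<lambda>h. (deriv G h - G1) / h) \<longlongrightarrow> 0) (at_right 0)"
      by (intro tendsto_eventually eventually_mono[OF ev]) (simp add: G10)
    then have "G2 = 0" using G2 tendsto_unique by (metis trivial_limit_at_right_real)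
    with G12 G10 show False by simp
  qed
  \<comment> \<open>The maximum with 1 covers the case x = y and provides
    \<open>C_ge_1\<close>.\<close>
  have "G y \<le> max C 1 * (y / x)\<^sup>2 * G x" if xy: "0 < x" "x \<le> y" for x y
  proof (cases "x = y")
    case True
    then show ?thesis using xy pos[of x] by (simp add: mult_le_cancel_right1)
  next
    case False
    then have "G y \<le> C * (y / x)\<^sup>2 * G x"
      using C(2)[of x y] xy pos[of x] by (simp add: pos_divide_le_eq)
    also have "\<dots> \<le> max C 1 * (y / x)\<^sup>2 * G x"
      using nonneg by (intro mult_right_mono) auto
    finally show ?thesis .
  qed
  moreover have "1 < G x" if "1 < x" for x
  proof -
    have "G x = 1 + s * (x - 1)" using s(2)[OF that] by (simp add: algebra_simps)
    then show ?thesis using s(1) that by simp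
  qed
  ultimately have "orlicz_function G (max C 1)"
    by unfold_locales (use nonneg mono convex zero one pos in auto)
  then show ?thesis by blast
qed

section \<open>The Orlicz norm as a seminorm, and its comparison with a weighted Euclidean
  norm\<close>

definition orlicz :: "(real \<Rightarrow> real) \<Rightarrow> nat \<Rightarrow> (nat \<Rightarrow> real) \<Rightarrow> real" where
  "orlicz G n z = Inf {\<alpha>. \<alpha> > 0 \<and> (\<Sum>i<n. G (\<bar>z i\<bar> / \<alpha>)) \<le> 1}"

lemma orlicz_norm_eq: "orlicz_norm G x = orlicz G (dim_vec x) (\<lambda>i. x $ i)"
  by (simp add: orlicz_norm_def orlicz_def)

context orlicz_function
begin

lemma scale_le: "0 \<le> t \<Longrightarrow> t \<le> 1 \<Longrightarrow> 0 \<le> x \<Longrightarrow> G (t * x) \<le> t * G x"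
  using convex_onD[OF convex, of t 0 x] by (simp add: zero)

lemma scale_ge: "1 \<le> t \<Longrightarrow> 0 \<le> x \<Longrightarrow> t * G x \<le> G (t * x)"
  using scale_le[of "1 / t" "t * x"] by (simp add: field_simps)

lemma le_id: "0 \<le> x \<Longrightarrow> x \<le> 1 \<Longrightarrow> G x \<le> x"
  using scale_le[of x 1] by (simp add: one)

definition feasible :: "nat \<Rightarrow> (nat \<Rightarrow> real) \<Rightarrow> real \<Rightarrow> bool" where
  "feasible n z \<alpha> \<longleftrightarrow> \<alpha> > 0 \<and> (\<Sum>i<n. G (\<bar>z i\<bar> / \<alpha>)) \<le> 1"

lemma orlicz_Inf: "orlicz G n z = Inf {\<alpha>. feasible n z \<alpha>}"
  by (simp add: orlicz_def feasible_def)

lemma feasible_mono: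
  assumes "feasible n z \<alpha>" "\<alpha> \<le> \<beta>"
  shows "feasible n z \<beta>"
proof -
  have "(\<Sum>i<n. G (\<bar>z i\<bar> / \<beta>)) \<le> (\<Sum>i<n. G (\<bar>z i\<bar> / \<alpha>))"
    using assms by (intro sum_mono mono divide_left_mono) (auto simp: feasible_def)
  then show ?thesis using assms by (simp add: feasible_def)
qed

text \<open>A coordinate exceeding \<alpha> would alone contribute more than 1 to the sum, by
  \<open>gt1\<close>.\<close>

lemma feasible_abs:
  assumes "feasible n z \<alpha>" "i < n"
  shows "\<bar>z i\<bar> \<le> \<alpha>"
proof (rule ccontr)
  assume "\<not> \<bar>z i\<bar> \<le> \<alpha>"
  then have "1 < \<bar>z i\<bar> / \<alpha>" using assms by (simp add: feasible_def)
  then have "1 < G (\<bar>z i\<bar> / \<alpha>)" by (rule gt1)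
  also have "\<dots> \<le> (\<Sum>i<n. G (\<bar>z i\<bar> / \<alpha>))"
    using assms nonneg by (intro member_le_sum) auto
  finally show False using assms by (simp add: feasible_def)
qed

lemma feasible_large:
  assumes "0 < \<alpha>" "(\<Sum>i<n. \<bar>z i\<bar>) \<le> \<alpha>"
  shows "feasible n z \<alpha>"
proof -
  have "\<bar>z i\<bar> / \<alpha> \<le> 1" if "i < n" for i
    using assms member_le_sum[of i "{..<n}" "\<lambda>i. \<bar>z i\<bar>"] that by simp
  then have "(\<Sum>i<n. G (\<bar>z i\<bar> / \<alpha>)) \<le> (\<Sum>i<n. \<bar>z i\<bar> / \<alpha>)"
    using assms by (intro sum_mono le_id) auto
  also have "\<dots> \<le> 1" using assms by (simp add: sum_divide_distrib[symmetric])
  finally show ?thesis using assms by (simp add: feasible_def)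
qed

lemma feasible_nonempty: "{\<alpha>. feasible n z \<alpha>} \<noteq> {}"
proof -
  have "feasible n z ((\<Sum>i<n. \<bar>z i\<bar>) + 1)"
    by (rule feasible_large) (auto simp: sum_nonneg add_nonneg_pos)
  then show ?thesis by auto
qed

lemma feasible_bdd_below: "bdd_below {\<alpha>. feasible n z \<alpha>}"
  by (rule bdd_belowI[of _ 0]) (simp add: feasible_def)

lemma orlicz_le: "feasible n z \<alpha> \<Longrightarrow> orlicz G n z \<le> \<alpha>"
  unfolding orlicz_Inf by (rule cInf_lower[OF _ feasible_bdd_below]) simp

text \<open>Attainment of the infimum is never shown; feasibility is available strictly above the
  norm only, hence the slack \<open>e / 2\<close> and the factor 3/2 further on.\<close>

lemma feasible_gt: "orlicz G n z < \<beta> \<Longrightarrow> feasible n z \<beta>"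
  unfolding orlicz_Inf
  using cInf_lessD[OF feasible_nonempty] feasible_mono by (metis less_imp_le mem_Collect_eq)

lemma orlicz_geI: "(\<And>\<alpha>. feasible n z \<alpha> \<Longrightarrow> b \<le> \<alpha>) \<Longrightarrow> b \<le> orlicz G n z"
  unfolding orlicz_Inf by (rule cInf_greatest[OF feasible_nonempty]) simp

lemma orlicz_nonneg: "0 \<le> orlicz G n z"
  by (rule orlicz_geI) (simp add: feasible_def)

lemma abs_le_orlicz: "i < n \<Longrightarrow> \<bar>z i\<bar> \<le> orlicz G n z"
  by (rule orlicz_geI) (rule feasible_abs)

lemma orlicz_cong: "(\<And>i. i < n \<Longrightarrow> u i = v i) \<Longrightarrow> orlicz G n u = orlicz G n v"
  by (simp add: orlicz_def)

lemma orlicz_zero: "(\<And>i. i < n \<Longrightarrow> z i = 0) \<Longrightarrow> orlicz G n z = 0"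
proof (rule antisym[OF field_le_epsilon orlicz_nonneg])
  fix e :: real assume "0 < e" "\<And>i. i < n \<Longrightarrow> z i = 0"
  then show "orlicz G n z \<le> 0 + e" by (intro orlicz_le feasible_large) auto
qed

text \<open>The quotient of u + v by \<alpha> + \<beta> is the convex combination of u / \<alpha>
  and v / \<beta> with weights proportional to \<alpha> and \<beta>; convexity of G then averages
  the two sums.\<close>

lemma feasible_add:
  assumes "feasible n u \<alpha>" "feasible n v \<beta>"
  shows "feasible n (\<lambda>i. u i + v i) (\<alpha> + \<beta>)"
proof -
  have ab: "\<alpha> > 0" "\<beta> > 0" using assms by (auto simp: feasible_def)
  define t where "t = \<beta> / (\<alpha> + \<beta>)"
  have t: "0 \<le> t" "t \<le> 1" "1 - t = \<alpha> / (\<alpha> + \<beta>)" using ab by (auto simp: t_def field_simps)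
  have "G (\<bar>u i + v i\<bar> / (\<alpha> + \<beta>)) \<le> (1 - t) * G (\<bar>u i\<bar> / \<alpha>) + t * G (\<bar>v i\<bar> / \<beta>)" for i
  proof -
    have "\<bar>u i + v i\<bar> / (\<alpha> + \<beta>) \<le> (\<bar>u i\<bar> + \<bar>v i\<bar>) / (\<alpha> + \<beta>)"
      using ab by (intro divide_right_mono) auto
    also have "\<dots> = (1 - t) * (\<bar>u i\<bar> / \<alpha>) + t * (\<bar>v i\<bar> / \<beta>)"
      using ab by (simp add: t(3) add_divide_distrib) (simp add: t_def)
    finally have "G (\<bar>u i + v i\<bar> / (\<alpha> + \<beta>)) \<le> G ((1 - t) * (\<bar>u i\<bar> / \<alpha>) + t * (\<bar>v i\<bar> / \<beta>))"
      using ab by (intro mono) auto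
    also have "\<dots> \<le> (1 - t) * G (\<bar>u i\<bar> / \<alpha>) + t * G (\<bar>v i\<bar> / \<beta>)"
      using convex_onD[OF convex t(1,2), of "\<bar>u i\<bar> / \<alpha>" "\<bar>v i\<bar> / \<beta>"] ab by simp
    finally show ?thesis .
  qed
  then have "(\<Sum>i<n. G (\<bar>u i + v i\<bar> / (\<alpha> + \<beta>)))
      \<le> (1 - t) * (\<Sum>i<n. G (\<bar>u i\<bar> / \<alpha>)) + t * (\<Sum>i<n. G (\<bar>v i\<bar> / \<beta>))"
    by (simp add: sum_distrib_left sum.distrib[symmetric] sum_mono)
  also have "\<dots> \<le> (1 - t) * 1 + t * 1"
    using assms t by (intro add_mono mult_left_mono) (auto simp: feasible_def)
  finally show ?thesis using ab by (simp add: feasible_def)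
qed

lemma orlicz_scale_le:
  assumes c: "c \<noteq> 0"
  shows "orlicz G n (\<lambda>i. c * z i) \<le> \<bar>c\<bar> * orlicz G n z"
proof -
  have "orlicz G n (\<lambda>i. c * z i) / \<bar>c\<bar> \<le> orlicz G n z"
  proof (rule orlicz_geI)
    fix \<alpha> assume a: "feasible n z \<alpha>"
    have "feasible n (\<lambda>i. c * z i) (\<bar>c\<bar> * \<alpha>)"
      using a c by (simp add: feasible_def abs_mult)
    then show "orlicz G n (\<lambda>i. c * z i) / \<bar>c\<bar> \<le> \<alpha>"
      using orlicz_le c by (simp add: pos_divide_le_eq mult.commute)
  qed
  then show ?thesis using c by (simp add: pos_divide_le_eq mult.commute)
qed

lemma seminorm_orlicz: "seminorm (orlicz G n)"
  unfolding seminorm_def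
proof safe
  fix u v :: "nat \<Rightarrow> real" and c :: real
  show "orlicz G n (\<lambda>i. u i + v i) \<le> orlicz G n u + orlicz G n v"
  proof (rule field_le_epsilon)
    fix e :: real assume e: "0 < e"
    have "feasible n u (orlicz G n u + e / 2)" "feasible n v (orlicz G n v + e / 2)"
      using e by (auto intro!: feasible_gt)
    from orlicz_le[OF feasible_add[OF this]]
    show "orlicz G n (\<lambda>i. u i + v i) \<le> orlicz G n u + orlicz G n v + e" by simp
  qed
  show "orlicz G n (\<lambda>i. c * u i) = \<bar>c\<bar> * orlicz G n u"
  proof (cases "c = 0")
    case True
    then show ?thesis by (simp add: orlicz_zero)
  next
    case False
    have "orlicz G n u \<le> \<bar>1 / c\<bar> * orlicz G n (\<lambda>i. c * u i)"
      using orlicz_scale_le[of "1 / c" n "\<lambda>i. c * u i"] False by simp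
    then have "\<bar>c\<bar> * orlicz G n u \<le> orlicz G n (\<lambda>i. c * u i)"
      using False by (simp add: field_simps)
    then show ?thesis using orlicz_scale_le[OF False, of n u] by linarith
  qed
qed

text \<open>Write R for the ratio of the G values. If |z| exceeds \<delta>, convexity makes G grow
  at least linearly, so |z| / \<delta> is at most R; otherwise the at most quadratic growth bounds
  the square by C R. The right side adds both cases.\<close>

lemma square_ratio_le:
  assumes \<delta>: "0 < \<delta>"
  shows "(z / \<delta>)\<^sup>2 \<le> C * (G \<bar>z\<bar> / G \<delta>) + (G \<bar>z\<bar> / G \<delta>)\<^sup>2"
proof -
  have R: "0 \<le> G \<bar>z\<bar> / G \<delta>" using nonneg by simp
  have G\<delta>: "0 < G \<delta>" using pos[OF \<delta>] .
  consider "\<delta> < \<bar>z\<bar>" | "z = 0" | "0 < \<bar>z\<bar>" "\<bar>z\<bar> \<le> \<delta>" by force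
  then show ?thesis
  proof cases
    case 1
    have "\<bar>z\<bar> / \<delta> * G \<delta> \<le> G (\<bar>z\<bar> / \<delta> * \<delta>)"
      using 1 \<delta> by (intro scale_ge) auto
    then have "\<bar>z\<bar> / \<delta> \<le> G \<bar>z\<bar> / G \<delta>" using \<delta> G\<delta> by (simp add: pos_le_divide_eq)
    then have "(\<bar>z\<bar> / \<delta>)\<^sup>2 \<le> (G \<bar>z\<bar> / G \<delta>)\<^sup>2" using \<delta> by (intro power_mono) auto
    moreover have "0 \<le> C * (G \<bar>z\<bar> / G \<delta>)" using R C_ge_1 by (intro mult_nonneg_nonneg) auto
    ultimately show ?thesis by (simp add: power_divide)
  next
    case 2
    then show ?thesis by (simp add: zero)
  next
    case 3
    have "G \<delta> \<le> C * (\<delta> / \<bar>z\<bar>)\<^sup>2 * G \<bar>z\<bar>" using 3 by (intro growth) auto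
    then have "(z / \<delta>)\<^sup>2 \<le> C * (G \<bar>z\<bar> / G \<delta>)"
      using 3 G\<delta> \<delta> by (simp add: field_simps)
    then show ?thesis by (simp add: add_increasing2)
  qed
qed

text \<open>With W the sum of the ratios, the sum of their squares is at most W^2, so the squared
  norm is at most C W + W^2, hence at most (W + C)^2. The result is linear in W, whose truncated
  mean can be bounded.\<close>

lemma L2_ratio_le:
  fixes n :: nat
  assumes \<delta>: "\<And>i. i < n \<Longrightarrow> 0 < \<delta> i"
  shows "L2_set (\<lambda>i. z i / \<delta> i) {..<n} \<le> (\<Sum>i<n. G \<bar>z i\<bar> / G (\<delta> i)) + C"
proof -
  define W where "W = (\<Sum>i<n. G \<bar>z i\<bar> / G (\<delta> i))"
  have Wi: "0 \<le> G \<bar>z i\<bar> / G (\<delta> i)" for i using nonneg by simp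
  have W: "0 \<le> W" unfolding W_def using Wi by (rule sum_nonneg)
  have "(\<Sum>i<n. (z i / \<delta> i)\<^sup>2) \<le> (\<Sum>i<n. C * (G \<bar>z i\<bar> / G (\<delta> i)) + (G \<bar>z i\<bar> / G (\<delta> i)) * W)"
  proof (rule sum_mono)
    fix i assume i: "i \<in> {..<n}"
    have "G \<bar>z i\<bar> / G (\<delta> i) \<le> W"
      unfolding W_def using i Wi by (intro member_le_sum) auto
    then have "(G \<bar>z i\<bar> / G (\<delta> i))\<^sup>2 \<le> (G \<bar>z i\<bar> / G (\<delta> i)) * W"
      using Wi unfolding power2_eq_square by (intro mult_left_mono)
    then show "(z i / \<delta> i)\<^sup>2 \<le> C * (G \<bar>z i\<bar> / G (\<delta> i)) + (G \<bar>z i\<bar> / G (\<delta> i)) * W"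
      using square_ratio_le[of "\<delta> i" "z i"] \<delta> i by simp
  qed
  also have "\<dots> = C * W + W * W"
    by (simp only: sum.distrib sum_distrib_left[symmetric] sum_distrib_right[symmetric] W_def[symmetric])
  also have "\<dots> \<le> (W + C)\<^sup>2"
    using W C_ge_1 by (simp add: power2_eq_square algebra_simps)
  finally show ?thesis
    using W C_ge_1 unfolding L2_set_def W_def[symmetric] by (intro real_le_lsqrt) auto
qed

text \<open>\<open>near_auerbach_basis\<close> for the unit ball written in orthonormal coordinates,
  which are bounded by n there. The basis is bounded through sums of G, the form needed for means;
  this implies norm at most 1.\<close>

lemma orlicz_auerbach_basis:
  assumes q: "orthonormal_family n r q"
  shows "\<exists>U. (\<forall>j<r. (\<Sum>i<n. G \<bar>U j i\<bar>) \<le> 1) \<and>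
    (\<forall>c. \<exists>y. (\<forall>j<r. \<bar>y j\<bar> \<le> 3 * orlicz G n (lincomb r c q)) \<and>
         (\<forall>i<n. (lincomb r c q i) = lincomb r y U i))"
proof -
  define T where "T = (\<lambda>(c :: nat \<Rightarrow> real) i. \<Sum>a<r. c a * q a i)"
  define B where "B = {c. (\<Sum>i<n. G \<bar>T c i\<bar>) \<le> 1}"
  have BF: "c \<in> B \<longleftrightarrow> feasible n (T c) 1" for c by (simp add: B_def feasible_def)
  have bdd: "\<bar>c a\<bar> \<le> real n" if c: "c \<in> B" and a: "a < r" for c a
  proof -
    have "\<bar>c a\<bar> \<le> L2_set c {..<r}"
      using a by (intro abs_le_L2_set) auto
    also have "\<dots> = L2_set (T c) {..<n}"
      unfolding T_def by (rule orthonormal_L2_lincomb[OF q, symmetric])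
    also have "\<dots> \<le> (\<Sum>i<n. \<bar>T c i\<bar>)" by (rule L2_set_le_sum_abs)
    also have "\<dots> \<le> (\<Sum>i<n. 1)"
      using c feasible_abs by (intro sum_mono) (auto simp: BF)
    finally show ?thesis by simp
  qed
  have abs: "\<exists>t>0. (\<lambda>i. if i = a then t else 0) \<in> B" if a: "a < r" for a
  proof -
    \<comment> \<open>Dividing by the sum of absolute values makes the basis vector feasible at 1;
      the added 1 avoids division by 0.\<close>
    define S where "S = (\<Sum>i<n. \<bar>q a i\<bar>) + 1"
    have S: "S > 0" by (simp add: S_def sum_nonneg add_nonneg_pos)
    have "T (\<lambda>i. if i = a then 1 / S else 0) = (\<lambda>i. 1 / S * q a i)"
      using a by (simp add: T_def fun_eq_iff if_distrib[of "\<lambda>x. x * _"] cong: if_cong)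
    moreover have "feasible n (\<lambda>i. 1 / S * q a i) 1"
      using S by (intro feasible_large)
        (auto simp: abs_mult sum_divide_distrib[symmetric] pos_divide_le_eq, simp add: S_def)
    ultimately show ?thesis using S by (intro exI[of _ "1 / S"]) (auto simp: BF)
  qed
  obtain X where X: "\<And>j. j < r \<Longrightarrow> X j \<in> B"
    and Y: "\<And>c. c \<in> B \<Longrightarrow> \<exists>y. (\<forall>j<r. \<bar>y j\<bar> \<le> 2) \<and> (\<forall>i<r. c i = lincomb r y X i)"
  proof -
    have "\<exists>X. (\<forall>j<r. X j \<in> B) \<and>
        (\<forall>c\<in>B. \<exists>y. (\<forall>j<r. \<bar>y j\<bar> \<le> 2) \<and> (\<forall>i<r. c i = lincomb r y X i))"
      by (rule near_auerbach_basis[where R = "real n"]) (use bdd abs in auto)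
    then show ?thesis using that by blast
  qed
  have coords: "\<exists>y. (\<forall>j<r. \<bar>y j\<bar> \<le> 2 * \<alpha>) \<and> (\<forall>i<n. T c i = (\<Sum>j<r. y j * T (X j) i))"
    if \<alpha>: "feasible n (T c) \<alpha>" for c \<alpha>
  proof -
    have \<alpha>0: "\<alpha> > 0" using \<alpha> by (simp add: feasible_def)
    have "T (\<lambda>a. c a / \<alpha>) = (\<lambda>i. T c i / \<alpha>)" by (simp add: T_def sum_divide_distrib)
    then have "(\<lambda>a. c a / \<alpha>) \<in> B" using \<alpha> by (simp add: BF feasible_def)
    from Y[OF this] obtain y where y: "\<forall>j<r. \<bar>y j\<bar> \<le> 2"
      and e: "\<And>a. a < r \<Longrightarrow> c a / \<alpha> = lincomb r y X a" by blast
    have e': "c a = (\<Sum>j<r. \<alpha> * y j * X j a)" if "a < r" for a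
      using e[OF that] \<alpha>0 by (simp add: field_simps sum_distrib_left)
    have "T c i = (\<Sum>j<r. \<alpha> * y j * T (X j) i)" for i
    proof -
      have "T c i = (\<Sum>a<r. \<Sum>j<r. \<alpha> * y j * X j a * q a i)"
        unfolding T_def by (intro sum.cong refl) (simp add: e' sum_distrib_right)
      also have "\<dots> = (\<Sum>j<r. \<Sum>a<r. \<alpha> * y j * X j a * q a i)" by (rule sum.swap)
      finally show ?thesis by (simp add: T_def sum_distrib_left mult.assoc)
    qed
    then show ?thesis using y \<alpha>0 by (intro exI[of _ "\<lambda>j. \<alpha> * y j"]) (auto simp: abs_mult)
  qed
  have "\<exists>y. (\<forall>j<r. \<bar>y j\<bar> \<le> 3 * orlicz G n (T c)) \<and> (\<forall>i<n. T c i = (\<Sum>j<r. y j * T (X j) i))" for c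
  proof (cases "orlicz G n (T c) = 0")
    case True
    then have "T c i = 0" if "i < n" for i using abs_le_orlicz[OF that, of "T c"] by simp
    then show ?thesis using True by (intro exI[of _ "\<lambda>_. 0"]) auto
  next
    case False
    then have p: "0 < orlicz G n (T c)" using orlicz_nonneg[of n "T c"] by linarith
    \<comment> \<open>The slack 3/2, times the bound 2 on the coordinates, gives the 3 of the
      statement.\<close>
    have "feasible n (T c) (3 / 2 * orlicz G n (T c))" using p by (intro feasible_gt) simp
    from coords[OF this] show ?thesis by simp
  qed
  then show ?thesis
    using X by (intro exI[of _ "\<lambda>j. T (X j)"]) (auto simp: T_def B_def)
qed

end

section \<open>Gaussian embeddings\<close>

lemma sum_abs_powers_le: "(\<Sum>j\<in>{- int m..int m}. (1 / 2 :: real) ^ nat \<bar>j\<bar>) \<le> 3"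
proof -
  have "(\<Sum>j\<in>{- int m..int m}. (1 / 2 :: real) ^ nat \<bar>j\<bar>) = 3 - 2 * (1 / 2) ^ m"
  proof (induction m)
    case (Suc m)
    have "{- int (Suc m)..int (Suc m)} = insert (- int (Suc m)) (insert (int (Suc m)) {- int m..int m})"
      by auto
    then show ?case using Suc by (simp add: nat_add_distrib)
  qed simp
  then show ?thesis by simp
qed

text \<open>Lattice points to be scaled by the mesh 1 / (64 sqrt r). A Euclidean unit vector has
  absolute sum at most sqrt r, which is 64 r mesh units. Bounding the absolute sum permits counting
  by a product weight, without volumes; the box makes the set visibly finite.\<close>

definition integer_net :: "nat \<Rightarrow> (nat \<Rightarrow> int) set" where
  "integer_net r = {k \<in> PiE {..<r} (\<lambda>_. {- int (64 * r)..int (64 * r)}). (\<Sum>a<r. nat \<bar>k a\<bar>) \<le> 64 * r}"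

lemma finite_integer_net: "finite (integer_net r)"
  unfolding integer_net_def by (rule finite_subset[of _ "PiE {..<r} (\<lambda>_. {- int (64 * r)..int (64 * r)})"])
    (auto intro: finite_PiE)

text \<open>Every point of the net has weight at least 1 for the product weight
  \<open>2 ^ (64 * r) * (\<Prod>a<r. (1 / 2) ^ \<bar>k a\<bar>)\<close>, whose total mass is at most
  \<open>2 ^ (64 * r) * 3 ^ r\<close>.\<close>

lemma card_integer_net: "real (card (integer_net r)) \<le> 2 ^ (66 * r)"
proof -
  let ?w = "\<lambda>k. \<Prod>a<r. (1 / 2 :: real) ^ nat \<bar>k a\<bar>" and ?I = "{- int (64 * r)..int (64 * r)}"
  let ?P = "PiE {..<r} (\<lambda>_. ?I)"
  have "real (card (integer_net r)) = (\<Sum>k\<in>integer_net r. 1)" by simp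
  also have "\<dots> \<le> (\<Sum>k\<in>integer_net r. 2 ^ (64 * r) * ?w k)"
  proof (rule sum_mono)
    fix k assume "k \<in> integer_net r"
    then have "(\<Sum>a<r. nat \<bar>k a\<bar>) \<le> 64 * r" by (simp add: integer_net_def)
    then have "(1 / 2 :: real) ^ (64 * r) \<le> (1 / 2) ^ (\<Sum>a<r. nat \<bar>k a\<bar>)"
      by (intro power_decreasing) auto
    then have "(2 :: real) ^ (64 * r) * (1 / 2) ^ (64 * r) \<le> 2 ^ (64 * r) * (1 / 2) ^ (\<Sum>a<r. nat \<bar>k a\<bar>)"
      by (intro mult_left_mono) auto
    moreover have "(2 :: real) ^ (64 * r) * (1 / 2) ^ (64 * r) = 1"
      by (subst power_mult_distrib[symmetric]) simp
    ultimately show "(1::real) \<le> 2 ^ (64 * r) * ?w k"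
      by (simp only: power_sum)
  qed
  also have "\<dots> \<le> (\<Sum>k\<in>?P. 2 ^ (64 * r) * ?w k)"
  proof (rule sum_mono2)
    show "finite ?P" by (intro finite_PiE) auto
    show "integer_net r \<subseteq> ?P" unfolding integer_net_def by blast
    show "0 \<le> 2 ^ (64 * r) * ?w k" for k :: "nat \<Rightarrow> int"
      by (simp add: prod_nonneg)
  qed
  also have "\<dots> = 2 ^ (64 * r) * (\<Sum>k\<in>?P. ?w k)"
    by (simp add: sum_distrib_left)
  finally have card: "real (card (integer_net r)) \<le> 2 ^ (64 * r) * (\<Sum>k\<in>?P. ?w k)" .
  have "(\<Sum>k\<in>?P. ?w k)
      = (\<Prod>a<r. \<Sum>j\<in>?I. (1 / 2 :: real) ^ nat \<bar>j\<bar>)"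
    using prod_sum_PiE[of "{..<r}" "\<lambda>_. ?I"
        "\<lambda>_ j. (1 / 2 :: real) ^ nat \<bar>j\<bar>"] by simp
  \<comment> \<open>The factor 3 is rounded up to 4 to stay with powers of 2: 64 r + 2 r = 66
    r.\<close>
  also have "\<dots> \<le> (\<Prod>a<r. 4)"
    by (intro prod_mono) (use sum_abs_powers_le[of "64 * r"] in \<open>auto intro!: sum_nonneg\<close>)
  also have "\<dots> = 2 ^ (2 * r)" by (simp add: power_mult)
  finally have "2 ^ (64 * r) * (\<Sum>k\<in>?P. ?w k) \<le> 2 ^ (64 * r) * 2 ^ (2 * r)"
    by (intro mult_left_mono) auto
  also have "(2 :: real) ^ (64 * r) * 2 ^ (2 * r) = 2 ^ (66 * r)"
    by (simp add: power_add[symmetric])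
  finally show ?thesis using card by linarith
qed

lemma L2_le_sqrt_card:
  fixes c :: "nat \<Rightarrow> real"
  assumes "\<And>a. a < r \<Longrightarrow> \<bar>c a\<bar> \<le> \<eta>" "0 \<le> \<eta>"
  shows "L2_set c {..<r} \<le> sqrt (real r) * \<eta>"
proof -
  have "(c a)\<^sup>2 \<le> \<eta>\<^sup>2" if "a < r" for a
    by (rule abs_le_square_iff[THEN iffD1]) (use assms(1)[OF that] in linarith)
  then have "(\<Sum>a<r. (c a)\<^sup>2) \<le> (\<Sum>a<r. \<eta>\<^sup>2)"
    by (intro sum_mono) blast
  then have "L2_set c {..<r} \<le> sqrt (\<Sum>a<r. \<eta>\<^sup>2)"
    unfolding L2_set_def by (rule real_sqrt_le_mono)
  also have "(\<Sum>a<r. \<eta>\<^sup>2) = real r * \<eta>\<^sup>2"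
    by simp
  also have "sqrt (real r * \<eta>\<^sup>2) = sqrt (real r) * \<eta>"
    unfolding real_sqrt_mult by (simp only: real_sqrt_abs abs_of_nonneg[OF assms(2)])
  finally show ?thesis .
qed

text \<open>Every coordinate is rounded towards 0, so neither the Euclidean norm nor the absolute
  sum grows; Cauchy-Schwarz then places the point in the net.\<close>

lemma integer_net_approx:
  assumes c: "L2_set c {..<r} \<le> 1" and r: "0 < r"
  defines "\<eta> \<equiv> 1 / (64 * sqrt (real r))"
  shows "\<exists>k\<in>integer_net r. (\<forall>a<r. \<bar>\<eta> * of_int (k a)\<bar> \<le> \<bar>c a\<bar>)
            \<and> (\<forall>a<r. \<bar>c a - \<eta> * of_int (k a)\<bar> \<le> \<eta>)"
proof -
  have \<eta>: "0 < \<eta>" using r by (simp add: \<eta>_def)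
  define k where "k = (\<lambda>a\<in>{..<r}. if 0 \<le> c a then \<lfloor>\<bar>c a\<bar> / \<eta>\<rfloor> else - \<lfloor>\<bar>c a\<bar> / \<eta>\<rfloor>)"
  have fl: "0 \<le> \<lfloor>\<bar>c a\<bar> / \<eta>\<rfloor>" "real_of_int \<lfloor>\<bar>c a\<bar> / \<eta>\<rfloor> * \<eta> \<le> \<bar>c a\<bar>"
    "\<bar>c a\<bar> \<le> real_of_int \<lfloor>\<bar>c a\<bar> / \<eta>\<rfloor> * \<eta> + \<eta>" for a
  proof -
    show "0 \<le> \<lfloor>\<bar>c a\<bar> / \<eta>\<rfloor>" using \<eta> by simp
    have "real_of_int \<lfloor>\<bar>c a\<bar> / \<eta>\<rfloor> \<le> \<bar>c a\<bar> / \<eta>" by (rule of_int_floor_le)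
    then show "real_of_int \<lfloor>\<bar>c a\<bar> / \<eta>\<rfloor> * \<eta> \<le> \<bar>c a\<bar>"
      unfolding pos_le_divide_eq[OF \<eta>] .
    have "\<bar>c a\<bar> / \<eta> \<le> real_of_int \<lfloor>\<bar>c a\<bar> / \<eta>\<rfloor> + 1" by linarith
    then show "\<bar>c a\<bar> \<le> real_of_int \<lfloor>\<bar>c a\<bar> / \<eta>\<rfloor> * \<eta> + \<eta>"
      using \<eta> by (simp add: pos_divide_le_eq algebra_simps)
  qed
  have absk: "\<bar>k a\<bar> = \<lfloor>\<bar>c a\<bar> / \<eta>\<rfloor>" if "a < r" for a using that fl(1)[of a] by (simp add: k_def)
  have 1: "\<bar>\<eta> * of_int (k a)\<bar> \<le> \<bar>c a\<bar>" if "a < r" for a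
  proof -
    have "\<bar>\<eta> * of_int (k a)\<bar> = \<eta> * of_int \<bar>k a\<bar>" using \<eta> by (simp add: abs_mult)
    then show ?thesis using fl(2)[of a] absk[OF that] by (simp add: mult.commute)
  qed
  have 2: "\<bar>c a - \<eta> * of_int (k a)\<bar> \<le> \<eta>" if "a < r" for a
    using that fl[of a] \<eta> by (auto simp: k_def abs_if algebra_simps)
  have "(\<Sum>a<r. \<bar>c a\<bar>) \<le> sqrt (real r)"
  proof -
    have "(\<Sum>a<r. \<bar>c a\<bar> * \<bar>1\<bar>) \<le> L2_set c {..<r} * L2_set (\<lambda>_. 1) {..<r}"
      by (rule L2_set_mult_ineq)
    also have "\<dots> \<le> 1 * sqrt (real r)"
      using c by (intro mult_mono) (auto simp: L2_set_def)
    finally show ?thesis by simp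
  qed
  moreover have "(\<Sum>a<r. real (nat \<bar>k a\<bar>)) \<le> (\<Sum>a<r. \<bar>c a\<bar> / \<eta>)"
    using absk fl(1) by (intro sum_mono) (simp add: of_nat_nat)
  moreover have "(\<Sum>a<r. \<bar>c a\<bar> / \<eta>) = (\<Sum>a<r. \<bar>c a\<bar>) / \<eta>"
    by (rule sum_divide_distrib[symmetric])
  moreover have "(\<Sum>a<r. \<bar>c a\<bar>) / \<eta> \<le> sqrt (real r) / \<eta>" if "(\<Sum>a<r. \<bar>c a\<bar>) \<le> sqrt (real r)"
    using that \<eta> by (intro divide_right_mono) auto
  ultimately have "real (\<Sum>a<r. nat \<bar>k a\<bar>) \<le> sqrt (real r) / \<eta>"
    by simp
  also have "\<dots> = real (64 * r)" using r by (simp add: \<eta>_def)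
  finally have s: "(\<Sum>a<r. nat \<bar>k a\<bar>) \<le> 64 * r" by linarith
  have "k a \<in> {- int (64 * r)..int (64 * r)}" if "a < r" for a
  proof -
    have "nat \<bar>k a\<bar> \<le> (\<Sum>a<r. nat \<bar>k a\<bar>)" using that by (intro member_le_sum) auto
    then show ?thesis using s by auto
  qed
  then have "k \<in> integer_net r" using s by (auto simp: integer_net_def k_def)
  then show ?thesis using 1 2 by (intro bexI[of _ k]) auto
qed

text \<open>Self-improvement: with S the supremum of \<open>f\<close> on the unit ball, rounding to
  the net leaves a residual of norm at most 1/64, whence S <= 4 + S / 64 and S <= 5. The lower bound
  then follows from the net points by subtracting the residual.\<close>

lemma embedding_from_integer_net:
  assumes f: "seminorm f" and local: "\<And>u v. (\<And>a. a < r \<Longrightarrow> u a = v a) \<Longrightarrow> f u = f v"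
    and net: "\<And>k. k \<in> integer_net r \<Longrightarrow> 1 / 4 * L2_set (\<lambda>a. of_int (k a)) {..<r} \<le> f (\<lambda>a. of_int (k a))
        \<and> f (\<lambda>a. of_int (k a)) \<le> 4 * L2_set (\<lambda>a. of_int (k a)) {..<r}"
  shows "1 / 8 * L2_set c {..<r} \<le> f c \<and> f c \<le> 5 * L2_set c {..<r}"
proof (cases "r = 0")
  case True
  then have "f c = f (\<lambda>_. 0)" by (intro local) simp
  then show ?thesis using True seminorm_0[OF f] by simp
next
  case False
  then have r: "0 < r" by simp
  define N where "N = (\<lambda>c :: nat \<Rightarrow> real. L2_set c {..<r})"
  have N: "seminorm N" unfolding N_def by (rule seminorm_L2)
  define \<eta> where "\<eta> = 1 / (64 * sqrt (real r))"
  have \<eta>: "0 < \<eta>" "sqrt (real r) * \<eta> = 1 / 64" using r by (simp_all add: \<eta>_def)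
  define D where "D = {f c | c. N c \<le> 1}"
  define S where "S = Sup D"
  define e where "e = (\<lambda>a i::nat. if i = a then 1 else 0 :: real)"
  \<comment> \<open>Finiteness of the supremum has to be known before it can be compared with
    itself.\<close>
  have "f c \<le> (\<Sum>a<r. f (e a))" if "N c \<le> 1" for c
  proof -
    have "f c = f (lincomb r c e)"
      by (rule local) (simp add: e_def if_distrib cong: if_cong)
    also have "\<dots> \<le> (\<Sum>a<r. \<bar>c a\<bar> * f (e a))" by (rule seminorm_sum[OF f])
    also have "\<dots> \<le> (\<Sum>a<r. 1 * f (e a))"
    proof (intro sum_mono mult_right_mono seminorm_nonneg[OF f])
      fix a assume "a \<in> {..<r}"
      then have "\<bar>c a\<bar> \<le> N c" unfolding N_def by (intro abs_le_L2_set) auto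
      then show "\<bar>c a\<bar> \<le> 1" using that by simp
    qed
    finally show ?thesis by simp
  qed
  then have bdd: "bdd_above D" unfolding D_def by (intro bdd_aboveI) auto
  have S: "f c \<le> S" if "N c \<le> 1" for c
    unfolding S_def by (rule cSup_upper[OF _ bdd]) (use that D_def in auto)
  have approx: "\<exists>w. N w \<le> N c \<and> N (\<lambda>a. c a - w a) \<le> 1 / 64 \<and> 1 / 4 * N w \<le> f w \<and> f w \<le> 4 * N w
       \<and> f (\<lambda>a. c a - w a) \<le> S / 64" if c: "N c \<le> 1" for c
  proof -
    obtain k where k: "k \<in> integer_net r" and k1: "\<forall>a<r. \<bar>\<eta> * of_int (k a)\<bar> \<le> \<bar>c a\<bar>"
      and k2: "\<forall>a<r. \<bar>c a - \<eta> * of_int (k a)\<bar> \<le> \<eta>"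
      using integer_net_approx[OF c[unfolded N_def] r] unfolding \<eta>_def by blast
    define w where "w = (\<lambda>a. \<eta> * of_int (k a))"
    have "N w \<le> N c"
      unfolding N_def L2_set_def w_def
      by (intro real_sqrt_le_mono sum_mono abs_le_square_iff[THEN iffD1] k1[rule_format]) auto
    moreover have res: "N (\<lambda>a. c a - w a) \<le> 1 / 64"
      unfolding N_def w_def \<eta>(2)[symmetric] by (rule L2_le_sqrt_card) (use k2 \<eta> in auto)
    moreover have "1 / 4 * N w \<le> f w \<and> f w \<le> 4 * N w"
      using net[OF k] \<eta>(1) unfolding w_def seminorm_scale[OF f] seminorm_scale[OF N]
      by (simp add: N_def)
    moreover have "f (\<lambda>a. c a - w a) \<le> S / 64"
    proof -
      have "N (\<lambda>a. 64 * (c a - w a)) \<le> 1"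
        by (subst seminorm_scale[OF N]) (use res in simp)
      from S[OF this] show ?thesis by (subst (asm) seminorm_scale[OF f]) simp
    qed
    ultimately show ?thesis by (intro exI[of _ w]) simp
  qed
  have "S \<le> 4 + S / 64"
    unfolding S_def
  proof (rule cSup_least)
    have "N (\<lambda>_. 0) \<le> 1" using seminorm_0[OF N] by simp
    then show "D \<noteq> {}" unfolding D_def by blast
    fix x assume "x \<in> D"
    then obtain c where c: "N c \<le> 1" and x: "x = f c" by (auto simp: D_def)
    from approx[OF c] obtain w where w: "N w \<le> N c" "f w \<le> 4 * N w" "f (\<lambda>a. c a - w a) \<le> S / 64"
      by blast
    have "f c \<le> f w + f (\<lambda>a. c a - w a)" by (rule seminorm_triangle[OF f])
    then show "x \<le> 4 + Sup D / 64" using w c x unfolding S_def[symmetric] by linarith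
  qed
  then have S5: "S \<le> 5" by linarith
  \<comment> \<open>On the unit sphere \<open>f c\<close> is at least 1/4 * 63/64 - 5/64 = 43/256,
    which exceeds 1/8.\<close>
  have unit: "1 / 8 \<le> f c \<and> f c \<le> 5" if c: "N c = 1" for c
  proof -
    obtain w where w: "N (\<lambda>a. c a - w a) \<le> 1 / 64" "1 / 4 * N w \<le> f w" "f (\<lambda>a. c a - w a) \<le> S / 64"
      using approx[of c] c by auto
    have "f w - f (\<lambda>a. c a - w a) \<le> f c" by (rule seminorm_triangle'[OF f])
    moreover have "N c - N (\<lambda>a. w a - c a) \<le> N w" by (rule seminorm_triangle'[OF N])
    moreover have "N (\<lambda>a. w a - c a) = N (\<lambda>a. c a - w a)" by (rule seminorm_minus[OF N])
    ultimately show ?thesis using w S[of c] S5 c by linarith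
  qed
  show ?thesis
  proof (cases "N c = 0")
    case True
    then have "c a = 0" if "a < r" for a using that by (simp add: N_def L2_set_eq_0_iff)
    then have "f c = f (\<lambda>_. 0)" by (intro local) auto
    then show ?thesis using True seminorm_0[OF f] by (simp add: N_def)
  next
    case False
    then have p: "0 < N c" using seminorm_nonneg[OF N, of c] by linarith
    have "N (\<lambda>a. 1 / N c * c a) = 1"
      using p by (subst seminorm_scale[OF N]) simp
    from unit[OF this] have "1 / 8 \<le> f c / N c \<and> f c / N c \<le> 5"
      using p seminorm_scale[OF f, of "1 / N c" c] by simp
    then have "1 / 8 * N c \<le> f c \<and> f c \<le> 5 * N c" using p by (simp add: field_simps)
    then show ?thesis by (simp add: N_def)
  qed
qed

section \<open>Chi-square tails for one vector, and the union bound over the net\<close>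

lemma prob_PiM_indep_coordinates:
  assumes "\<And>i. i \<in> I \<Longrightarrow> prob_space (M i)"
  shows "prob_space.indep_vars (PiM I M) M (\<lambda>i \<omega>. \<omega> i) I"
proof (cases "I = {}")
  case True
  interpret prob_space "PiM I M" by (rule prob_space_PiM) (rule assms)
  show ?thesis unfolding indep_vars_def indep_sets_def using True by auto
next
  case False
  interpret prob_space "PiM I M" by (rule prob_space_PiM) (rule assms)
  have "distr (PiM I M) (PiM I M) (\<lambda>\<omega>. \<lambda>i\<in>I. \<omega> i) = distr (PiM I M) (PiM I M) (\<lambda>\<omega>. \<omega>)"
    by (intro distr_cong refl) (auto simp: space_PiM)
  also have "\<dots> = PiM I M" by (rule distr_id)
  also have "\<dots> = (\<Pi>\<^sub>M i\<in>I. distr (PiM I M) (M i) (\<lambda>\<omega>. \<omega> i))"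
    by (intro PiM_cong refl distr_PiM_component[symmetric] assms)
  finally show ?thesis
    using False by (subst indep_vars_iff_distr_eq_PiM') auto
qed

text \<open>The integrand times the standard density is \<sigma> times the centred normal density of
  variance \<sigma>^2 = 1 / (1 - 2 l). Negative \<open>l\<close> is included and serves the lower
  tail.\<close>

lemma nn_integral_exp_square_normal:
  fixes l :: real
  assumes l: "l < 1 / 2"
  shows "(\<integral>\<^sup>+x. ennreal (exp (l * x\<^sup>2)) \<partial>density lborel (\<lambda>x. ennreal (std_normal_density x)))
     = ennreal (1 / sqrt (1 - 2 * l))"
proof -
  define \<sigma> where "\<sigma> = 1 / sqrt (1 - 2 * l)"
  have \<sigma>: "0 < \<sigma>" "\<sigma>\<^sup>2 = 1 / (1 - 2 * l)" using l by (auto simp: \<sigma>_def power_divide)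
  have eq: "std_normal_density x * exp (l * x\<^sup>2) = \<sigma> * normal_density 0 \<sigma> x" for x
  proof -
    have "\<sigma> * normal_density 0 \<sigma> x = 1 / sqrt (2 * pi) * exp (- x\<^sup>2 / (2 * \<sigma>\<^sup>2))"
      using \<sigma>(1) by (simp add: normal_density_def real_sqrt_mult)
    also have "- x\<^sup>2 / (2 * \<sigma>\<^sup>2) = - x\<^sup>2 / 2 + l * x\<^sup>2"
      unfolding \<sigma>(2) by (simp add: field_simps)
    finally show ?thesis by (simp add: std_normal_density_def mult_exp_exp)
  qed
  have "(\<integral>\<^sup>+x. ennreal (exp (l * x\<^sup>2)) \<partial>density lborel (\<lambda>x. ennreal (std_normal_density x)))
      = (\<integral>\<^sup>+x. ennreal (std_normal_density x) * ennreal (exp (l * x\<^sup>2)) \<partial>lborel)"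
    by (subst nn_integral_density) auto
  also have "\<dots> = (\<integral>\<^sup>+x. ennreal \<sigma> * ennreal (normal_density 0 \<sigma> x) \<partial>lborel)"
    using \<sigma> by (intro nn_integral_cong) (simp add: ennreal_mult[symmetric] eq)
  also have "\<dots> = ennreal \<sigma> * (\<integral>\<^sup>+x. ennreal (normal_density 0 \<sigma> x) \<partial>lborel)"
    by (rule nn_integral_cmult) simp
  also have "(\<integral>\<^sup>+x. ennreal (normal_density 0 \<sigma> x) \<partial>lborel) = 1"
    using \<sigma> by (subst nn_integral_eq_integral) auto
  finally show ?thesis by (simp add: \<sigma>_def)
qed

abbreviation std_normal_measure :: "real measure" where
  "std_normal_measure \<equiv> density lborel (\<lambda>x. ennreal (std_normal_density x))"

lemma prob_space_std_normal: "prob_space std_normal_measure"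
  using prob_space_normal_density[of 1 0] by simp

text \<open>A coordinate of the unscaled Gaussian matrix times a vector; the factor 1 / sqrt t2
  stays outside until \<open>sketch_entry_lincomb\<close>, hence the sqrt t2 in the bounds.\<close>

definition row_sum :: "nat \<Rightarrow> (nat \<Rightarrow> real) \<Rightarrow> (nat \<times> nat \<Rightarrow> real) \<Rightarrow> nat \<Rightarrow> real" where
  "row_sum t1 v g \<rho> = (\<Sum>\<kappa><t1. g (\<rho>, \<kappa>) * v \<kappa>)"

context
  fixes t1 t2 :: nat and M :: "(nat \<times> nat \<Rightarrow> real) measure"
  defines "M \<equiv> \<Pi>\<^sub>M e\<in>{..<t2} \<times> {..<t1}. std_normal_measure"
begin

lemma prob_space_gaussian: "prob_space M"
  unfolding M_def by (rule prob_space_PiM) (rule prob_space_std_normal)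

interpretation prob_space M by (rule prob_space_gaussian)

lemma measurable_row_sum [measurable]: "\<rho> < t2 \<Longrightarrow> (\<lambda>g. row_sum t1 v g \<rho>) \<in> borel_measurable M"
  unfolding row_sum_def M_def by measurable

lemma indep_coordinates: "indep_vars (\<lambda>_. borel) (\<lambda>e g. g e) ({..<t2} \<times> {..<t1})"
proof -
  have "indep_vars (\<lambda>_. std_normal_measure) (\<lambda>e g. g e) ({..<t2} \<times> {..<t1})"
    unfolding M_def by (rule prob_PiM_indep_coordinates) (rule prob_space_std_normal)
  then show ?thesis using indep_vars_compose2[of "\<lambda>_. std_normal_measure" "\<lambda>e g. g e" _ "\<lambda>_ x. x" "\<lambda>_. borel"] by simp
qed

lemma distributed_row_sum:
  assumes v: "(\<Sum>\<kappa><t1. (v \<kappa>)\<^sup>2) = 1" and \<rho>: "\<rho> < t2"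
  shows "distributed M lborel (\<lambda>g. row_sum t1 v g \<rho>) std_normal_density"
proof -
  \<comment> \<open>Zero coefficients are removed because the rule for sums of independent normals
    requires positive standard deviations.\<close>
  define J where "J = {\<kappa>. \<kappa> < t1 \<and> v \<kappa> \<noteq> 0}"
  have J: "finite J" "J \<noteq> {}"
  proof -
    show "finite J" by (simp add: J_def)
    show "J \<noteq> {}"
    proof
      assume "J = {}"
      then have "(\<Sum>\<kappa><t1. (v \<kappa>)\<^sup>2) = 0" by (intro sum.neutral) (auto simp: J_def)
      then show False using v by simp
    qed
  qed
  have "indep_vars (\<lambda>\<kappa>. PiM {(\<rho>, \<kappa>)} (\<lambda>_. borel)) (\<lambda>\<kappa> g. restrict (\<lambda>e. g e) {(\<rho>, \<kappa>)}) J"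
    by (rule indep_vars_restrict[OF indep_coordinates]) (use \<rho> in \<open>auto simp: J_def disjoint_family_on_def\<close>)
  then have "indep_vars (\<lambda>_. borel) (\<lambda>\<kappa> g. 0 + v \<kappa> * restrict (\<lambda>e. g e) {(\<rho>, \<kappa>)} (\<rho>, \<kappa>)) J"
    by (rule indep_vars_compose2) measurable
  then have ind: "indep_vars (\<lambda>_. borel) (\<lambda>\<kappa> g. 0 + v \<kappa> * g (\<rho>, \<kappa>)) J" by simp
  have single: "distributed M lborel (\<lambda>g. g (\<rho>, \<kappa>)) (normal_density 0 1)" if "\<kappa> \<in> J" for \<kappa>
  proof -
    have "distr M std_normal_measure (\<lambda>g. g (\<rho>, \<kappa>)) = std_normal_measure"
      unfolding M_def using that \<rho> J_def
      by (intro distr_PiM_component prob_space_std_normal) auto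
    moreover have "distr M std_normal_measure (\<lambda>g. g (\<rho>, \<kappa>)) = distr M lborel (\<lambda>g. g (\<rho>, \<kappa>))"
      by (rule distr_cong) auto
    moreover have "(\<lambda>g. g (\<rho>, \<kappa>)) \<in> borel_measurable M"
      unfolding M_def using that \<rho> by (auto simp: J_def)
    ultimately show ?thesis by (simp add: distributed_def)
  qed
  have "distributed M lborel (\<lambda>g. 0 + v \<kappa> * g (\<rho>, \<kappa>)) (normal_density 0 \<bar>v \<kappa>\<bar>)" if "\<kappa> \<in> J" for \<kappa>
    using normal_density_affine[OF single[OF that], of "v \<kappa>" 0] that by (simp add: J_def)
  from sum_indep_normal[OF J ind _ this]
  have "distributed M lborel (\<lambda>g. \<Sum>\<kappa>\<in>J. 0 + v \<kappa> * g (\<rho>, \<kappa>)) (normal_density (\<Sum>\<kappa>\<in>J. 0) (sqrt (\<Sum>\<kappa>\<in>J. \<bar>v \<kappa>\<bar>\<^sup>2)))"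
    by (simp add: J_def)
  moreover have "(\<Sum>\<kappa>\<in>J. \<bar>v \<kappa>\<bar>\<^sup>2) = 1"
    unfolding v[symmetric] by (simp add: J_def) (intro sum.mono_neutral_left, auto)
  moreover have "(\<Sum>\<kappa>\<in>J. 0 + v \<kappa> * g (\<rho>, \<kappa>)) = row_sum t1 v g \<rho>" for g
    unfolding row_sum_def by (simp add: J_def mult.commute) (intro sum.mono_neutral_left, auto)
  ultimately show ?thesis by simp
qed

text \<open>Different rows read disjoint blocks of Gaussian entries.\<close>

lemma indep_row_sum_functions:
  assumes f: "f \<in> borel_measurable borel"
  shows "indep_vars (\<lambda>_. borel) (\<lambda>\<rho> g. (f (row_sum t1 v g \<rho>) :: ennreal)) {..<t2}"
proof -
  define K where "K = (\<lambda>\<rho> :: nat. {\<rho>} \<times> {..<t1})"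
  have "indep_vars (\<lambda>\<rho>. PiM (K \<rho>) (\<lambda>_. borel)) (\<lambda>\<rho> g. restrict (\<lambda>e. g e) (K \<rho>)) {..<t2}"
    by (rule indep_vars_restrict[OF indep_coordinates]) (auto simp: K_def disjoint_family_on_def)
  then have "indep_vars (\<lambda>_. borel) (\<lambda>\<rho> g. f (row_sum t1 v (restrict (\<lambda>e. g e) (K \<rho>)) \<rho>)) {..<t2}"
  proof (rule indep_vars_compose2)
    fix \<rho>
    have "(\<lambda>g. row_sum t1 v g \<rho>) \<in> borel_measurable (PiM (K \<rho>) (\<lambda>_. borel))"
      unfolding row_sum_def K_def by measurable
    then show "(\<lambda>g. f (row_sum t1 v g \<rho>)) \<in> PiM (K \<rho>) (\<lambda>_. borel) \<rightarrow>\<^sub>M borel"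
      using f by (rule measurable_compose)
  qed
  then show ?thesis by (simp add: row_sum_def K_def)
qed

lemma nn_integral_exp_chi_square:
  assumes v: "(\<Sum>\<kappa><t1. (v \<kappa>)\<^sup>2) = 1" and l: "l < 1 / 2"
  shows "(\<integral>\<^sup>+g. ennreal (exp (l * (\<Sum>\<rho><t2. (row_sum t1 v g \<rho>)\<^sup>2))) \<partial>M) = ennreal ((1 / sqrt (1 - 2 * l)) ^ t2)"
proof -
  have "(\<integral>\<^sup>+g. ennreal (exp (l * (\<Sum>\<rho><t2. (row_sum t1 v g \<rho>)\<^sup>2))) \<partial>M)
      = (\<integral>\<^sup>+g. (\<Prod>\<rho><t2. ennreal (exp (l * (row_sum t1 v g \<rho>)\<^sup>2))) \<partial>M)"
    by (simp add: sum_distrib_left exp_sum prod_ennreal)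
  also have "\<dots> = (\<Prod>\<rho><t2. \<integral>\<^sup>+g. ennreal (exp (l * (row_sum t1 v g \<rho>)\<^sup>2)) \<partial>M)"
    by (rule indep_vars_nn_integral) (auto intro!: indep_row_sum_functions)
  also have "\<dots> = (\<Prod>\<rho><t2. ennreal (1 / sqrt (1 - 2 * l)))"
  proof (rule prod.cong[OF refl])
    fix \<rho> assume "\<rho> \<in> {..<t2}"
    then have d: "distr M lborel (\<lambda>g. row_sum t1 v g \<rho>) = std_normal_measure"
      and m: "(\<lambda>g. row_sum t1 v g \<rho>) \<in> M \<rightarrow>\<^sub>M lborel"
      using distributed_row_sum[OF v, of \<rho>] by (auto simp: distributed_def)
    have "(\<integral>\<^sup>+g. ennreal (exp (l * (row_sum t1 v g \<rho>)\<^sup>2)) \<partial>M)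
        = (\<integral>\<^sup>+x. ennreal (exp (l * x\<^sup>2)) \<partial>distr M lborel (\<lambda>g. row_sum t1 v g \<rho>))"
      by (subst nn_integral_distr[OF m]) auto
    then show "(\<integral>\<^sup>+g. ennreal (exp (l * (row_sum t1 v g \<rho>)\<^sup>2)) \<partial>M) = ennreal (1 / sqrt (1 - 2 * l))"
      unfolding d by (simp add: nn_integral_exp_square_normal[OF l])
  qed
  also have "\<dots> = ennreal ((1 / sqrt (1 - 2 * l)) ^ t2)"
    using l by (simp add: ennreal_power)
  finally show ?thesis .
qed

text \<open>Markov's inequality for the exponential of \<open>l\<close> times the sum; the sign of
  \<open>l\<close> selects the tail.\<close>

lemma chi_square_chernoff:
  assumes v: "(\<Sum>\<kappa><t1. (v \<kappa>)\<^sup>2) = 1" and l: "l < 1 / 2"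
  shows "measure M {g \<in> space M. a \<le> l * (\<Sum>\<rho><t2. (row_sum t1 v g \<rho>)\<^sup>2)}
     \<le> exp (- a) * (1 / sqrt (1 - 2 * l)) ^ t2"
proof -
  let ?S = "\<lambda>g. \<Sum>\<rho><t2. (row_sum t1 v g \<rho>)\<^sup>2"
  have [measurable]: "?S \<in> borel_measurable M" by measurable
  have "emeasure M {g \<in> space M. a \<le> l * ?S g}
      = emeasure M ({g \<in> space M. 1 \<le> ennreal (exp (- a)) * ennreal (exp (l * ?S g))})"
    by (simp add: ennreal_mult[symmetric] exp_add[symmetric] del: ennreal_1)
  also have "\<dots> \<le> ennreal (exp (- a)) * (\<integral>\<^sup>+g. ennreal (exp (l * ?S g)) * indicator (space M) g \<partial>M)"
    by (rule nn_integral_Markov_inequality) auto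
  also have "(\<integral>\<^sup>+g. ennreal (exp (l * ?S g)) * indicator (space M) g \<partial>M) = (\<integral>\<^sup>+g. ennreal (exp (l * ?S g)) \<partial>M)"
    by (intro nn_integral_cong) (simp add: indicator_def)
  also have "\<dots> = ennreal ((1 / sqrt (1 - 2 * l)) ^ t2)"
    by (rule nn_integral_exp_chi_square[OF v l])
  finally show ?thesis
    using l by (simp add: emeasure_eq_measure ennreal_mult[symmetric])
qed

lemma chi_square_tails:
  assumes v: "(\<Sum>\<kappa><t1. (v \<kappa>)\<^sup>2) = 1"
  shows "measure M {g \<in> space M. \<not> (1 / 4 * sqrt (real t2) \<le> L2_set (row_sum t1 v g) {..<t2}
     \<and> L2_set (row_sum t1 v g) {..<t2} \<le> 4 * sqrt (real t2))} \<le> 2 * (1 / 2) ^ t2"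
proof -
  let ?Bad = "{g \<in> space M. \<not> (1 / 4 * sqrt (real t2) \<le> L2_set (row_sum t1 v g) {..<t2}
     \<and> L2_set (row_sum t1 v g) {..<t2} \<le> 4 * sqrt (real t2))}"
  let ?S = "\<lambda>g. \<Sum>\<rho><t2. (row_sum t1 v g \<rho>)\<^sup>2"
  have [measurable]: "?S \<in> borel_measurable M" by measurable
  \<comment> \<open>The upper tail takes l = 1/4 at the threshold 16 t2, a factor exp (-4) sqrt 2
    per row; the lower tail takes l = -4 at t2 / 16, a factor exp (1/4) / 3 per row. Both factors
    are below 1/2.\<close>
  define U where "U = {g \<in> space M. 1 / 4 * (16 * real t2) \<le> 1 / 4 * ?S g}"
  define L where "L = {g \<in> space M. - 4 * (1 / 16 * real t2) \<le> - 4 * ?S g}"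
  have UL: "U \<in> sets M" "L \<in> sets M" by (auto simp: U_def L_def)
  have L2: "L2_set (row_sum t1 v g) {..<t2} = sqrt (?S g)" for g by (simp add: L2_set_def)
  have sub: "?Bad \<subseteq> U \<union> L"
  proof
    fix g assume g: "g \<in> ?Bad"
    have e: "1 / 4 * sqrt (real t2) = sqrt (1 / 16 * real t2)" "4 * sqrt (real t2) = sqrt (16 * real t2)"
      by (simp_all add: real_sqrt_mult real_sqrt_divide)
    have "1 / 16 * real t2 > ?S g \<or> ?S g > 16 * real t2"
      using g unfolding L2 e by (auto simp: not_le)
    then show "g \<in> U \<union> L" using g by (auto simp: U_def L_def)
  qed
  have e1: "exp (-4 :: real) * sqrt 2 \<le> 1 / 2" "exp (1 / 4 :: real) * (1 / 3) \<le> 1 / 2"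
  proof -
    have "(1 + 4 :: real) \<le> exp 4" by (rule exp_ge_add_one_self)
    then have "exp (-4 :: real) \<le> 1 / 5" by (simp add: exp_minus field_simps)
    then have "exp (-4 :: real) * sqrt 2 \<le> 1 / 5 * 2"
      by (intro mult_mono) (auto simp: real_le_lsqrt)
    then show "exp (-4 :: real) * sqrt 2 \<le> 1 / 2" by simp
    have "exp (1 / 4 :: real) \<le> 1 + 1 / 4 + (1 / 4)\<^sup>2"
      by (rule exp_bound) auto
    then show "exp (1 / 4 :: real) * (1 / 3) \<le> 1 / 2" by (simp add: power2_eq_square)
  qed
  have "measure M U \<le> exp (- (1 / 4 * (16 * real t2))) * (1 / sqrt (1 - 2 * (1 / 4))) ^ t2"
    unfolding U_def by (rule chi_square_chernoff[OF v]) simp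
  also have "\<dots> = (exp (-4) * sqrt 2) ^ t2"
    by (simp add: power_mult_distrib exp_of_nat_mult[symmetric] real_sqrt_divide mult.commute)
  also have "\<dots> \<le> (1 / 2) ^ t2" using e1 by (intro power_mono) auto
  finally have U: "measure M U \<le> (1 / 2) ^ t2" .
  have "measure M L \<le> exp (- (- 4 * (1 / 16 * real t2))) * (1 / sqrt (1 - 2 * (- 4))) ^ t2"
    unfolding L_def by (rule chi_square_chernoff[OF v]) simp
  also have "sqrt (1 - 2 * (- 4)) = (3 :: real)" by (rule real_sqrt_unique) auto
  also have "exp (- (- 4 * (1 / 16 * real t2))) * (1 / 3) ^ t2 = (exp (1 / 4) * (1 / 3)) ^ t2"
    by (simp add: power_mult_distrib power_divide exp_of_nat_mult[symmetric] mult.commute)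
  also have "\<dots> \<le> (1 / 2) ^ t2" using e1 by (intro power_mono) auto
  finally have L: "measure M L \<le> (1 / 2) ^ t2" .
  have "measure M ?Bad \<le> measure M (U \<union> L)"
    using sub UL by (intro finite_measure_mono) auto
  also have "\<dots> \<le> measure M U + measure M L"
    using UL by (rule measure_Un_le)
  finally show ?thesis using U L by linarith
qed

end

text \<open>The net lives in the \<open>r\<close> coordinates with respect to \<open>q\<close>, not
  in dimension \<open>t1\<close>; therefore \<open>t2\<close> need only be linear in
  \<open>d\<close>.\<close>

lemma gaussian_embedding_event:
  fixes t1 t2 r d :: nat and q :: "nat \<Rightarrow> nat \<Rightarrow> real"
  defines "M \<equiv> \<Pi>\<^sub>M e\<in>{..<t2} \<times> {..<t1}. std_normal_measure"
  assumes q: "orthonormal_family t1 r q" and r: "r \<le> d" and d: "1 \<le> d" and t2: "100 * d \<le> t2"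
  shows "\<exists>E\<in>sets M. measure M E \<ge> 99 / 100 \<and> (\<forall>g\<in>E. sandwiched (1 / 8 * sqrt (real t2)) (5 * sqrt (real t2)) (\<lambda>c. L2_set c {..<r})
      (\<lambda>c. L2_set (row_sum t1 (lincomb r c q) g) {..<t2}))"
proof -
  interpret prob_space M unfolding M_def by (rule prob_space_gaussian)
  define T where "T = (\<lambda>(c :: nat \<Rightarrow> real) \<kappa>. \<Sum>a<r. c a * q a \<kappa>)"
  define N where "N = (\<lambda>c :: nat \<Rightarrow> real. L2_set c {..<r})"
  define F where "F = (\<lambda>g c. L2_set (row_sum t1 (T c) g) {..<t2})"
  define s where "s = sqrt (real t2)"
  have s: "0 < s" using d t2 by (simp add: s_def)
  define K where "K = (\<lambda>(k :: nat \<Rightarrow> int) a. real_of_int (k a))"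
  define Bad where "Bad = (\<lambda>k. {g \<in> space M. \<not> (1 / 4 * s * N (K k) \<le> F g (K k) \<and> F g (K k) \<le> 4 * s * N (K k))})"
  have semF: "seminorm (F g)" for g
    unfolding F_def
    by (rule seminorm_comp[OF seminorm_L2])
       (auto simp: row_sum_def T_def fun_eq_iff algebra_simps sum.distrib sum_distrib_left)
  have NT: "N c = L2_set (T c) {..<t1}" for c
    unfolding N_def T_def by (rule orthonormal_L2_lincomb[OF q, symmetric])
  have measF [measurable]: "(\<lambda>g. F g c) \<in> borel_measurable M" for c
    unfolding F_def L2_set_def M_def by measurable
  have Bad_sets: "Bad k \<in> sets M" for k unfolding Bad_def by measurable
  \<comment> \<open>The zero vector cannot be normalized, but both sides vanish for it and its bad
    event is empty.\<close>
  have Bad_prob: "measure M (Bad k) \<le> 2 * (1 / 2) ^ t2" for k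
  proof (cases "N (K k) = 0")
    case True
    then have "T (K k) \<kappa> = 0" if "\<kappa> < t1" for \<kappa>
      using that by (simp add: NT L2_set_eq_0_iff)
    then have "F g (K k) = 0" for g by (simp add: F_def row_sum_def L2_set_def)
    then show ?thesis using True by (simp add: Bad_def)
  next
    case False
    moreover have "0 \<le> N (K k)" by (simp add: N_def)
    ultimately have p: "0 < N (K k)" by linarith
    define v where "v = (\<lambda>\<kappa>. T (K k) \<kappa> / N (K k))"
    have "(\<Sum>\<kappa><t1. (T (K k) \<kappa>)\<^sup>2) = (N (K k))\<^sup>2"
      by (simp add: NT L2_set_def sum_nonneg)
    then have v: "(\<Sum>\<kappa><t1. (v \<kappa>)\<^sup>2) = 1"
      using p by (simp add: v_def power_divide sum_divide_distrib[symmetric])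
    have "row_sum t1 v g = (\<lambda>\<rho>. 1 / N (K k) * row_sum t1 (T (K k)) g \<rho>)" for g
      by (simp add: row_sum_def v_def fun_eq_iff sum_distrib_left sum_divide_distrib)
    then have "L2_set (row_sum t1 v g) {..<t2} = F g (K k) / N (K k)" for g
      using seminorm_scale[OF seminorm_L2, of "1 / N (K k)" "row_sum t1 (T (K k)) g" "{..<t2}"] p
      by (simp add: F_def)
    moreover have "1 / 4 * s * N (K k) \<le> x \<longleftrightarrow> 1 / 4 * s \<le> x / N (K k)"
        "x \<le> 4 * s * N (K k) \<longleftrightarrow> x / N (K k) \<le> 4 * s" for x
      using p by (simp_all add: pos_le_divide_eq pos_divide_le_eq)
    ultimately have "Bad k = {g \<in> space M. \<not> (1 / 4 * sqrt (real t2) \<le> L2_set (row_sum t1 v g) {..<t2}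
       \<and> L2_set (row_sum t1 v g) {..<t2} \<le> 4 * sqrt (real t2))}"
      unfolding Bad_def s_def by simp
    then show ?thesis using chi_square_tails[OF v, of t2] by (simp add: M_def)
  qed
  define E where "E = space M - (\<Union>k\<in>integer_net r. Bad k)"
  have E: "E \<in> sets M" unfolding E_def using finite_integer_net[of r] Bad_sets by auto
  have "measure M (\<Union>k\<in>integer_net r. Bad k) \<le> (\<Sum>k\<in>integer_net r. measure M (Bad k))"
    by (rule finite_measure_subadditive_finite) (use Bad_sets finite_integer_net in auto)
  also have "\<dots> \<le> (\<Sum>k\<in>integer_net r. 2 * (1 / 2) ^ t2)" by (rule sum_mono) (rule Bad_prob)
  also have "\<dots> = real (card (integer_net r)) * (2 * (1 / 2) ^ t2)" by simp
  \<comment> \<open>The constant 100 in the bound on \<open>t2\<close> has to beat the exponent 66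
    of the net; the rest, 2 times 2 to the power -34 d, is below 1/100.\<close>
  also have "\<dots> \<le> 2 ^ (66 * d) * (2 * (1 / 2) ^ (100 * d))"
  proof (intro mult_mono)
    have "real (card (integer_net r)) \<le> 2 ^ (66 * r)" by (rule card_integer_net)
    also have "\<dots> \<le> 2 ^ (66 * d)" using r by (intro power_increasing) auto
    finally show "real (card (integer_net r)) \<le> 2 ^ (66 * d)" .
    show "(1 / 2 :: real) ^ t2 \<le> (1 / 2) ^ (100 * d)" using t2 by (intro power_decreasing) auto
  qed auto
  also have "\<dots> = 2 * (1 / 2) ^ (34 * d)"
  proof -
    have e1: "(1 / 2 :: real) ^ (100 * d) = (1 / 2) ^ (66 * d) * (1 / 2) ^ (34 * d)"
      by (simp add: power_add[symmetric])
    have e2: "(2 :: real) ^ (66 * d) * (1 / 2) ^ (66 * d) = 1"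
      by (simp add: power_mult_distrib[symmetric])
    have "(2 :: real) ^ (66 * d) * (2 * (1 / 2) ^ (100 * d)) = 2 * ((2 ^ (66 * d) * (1 / 2) ^ (66 * d)) * (1 / 2) ^ (34 * d))"
      unfolding e1 by (simp only: mult_ac)
    then show ?thesis by (simp only: e2 mult_1)
  qed
  also have "\<dots> \<le> 2 * (1 / 2) ^ 34" using d by (intro mult_left_mono power_decreasing) auto
  also have "\<dots> \<le> (1 / 100 :: real)" by (simp add: power_one_over)
  finally have "measure M E \<ge> 99 / 100"
    unfolding E_def using Bad_sets finite_integer_net[of r] by (subst prob_compl) auto
  moreover have "1 / 8 * s * N c \<le> F g c \<and> F g c \<le> 5 * s * N c" if g: "g \<in> E" for g c
  proof -
    have "1 / 8 * L2_set c {..<r} \<le> 1 / s * F g c \<and> 1 / s * F g c \<le> 5 * L2_set c {..<r}"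
    proof (rule embedding_from_integer_net[where f = "\<lambda>c. 1 / s * F g c"])
      show "seminorm (\<lambda>c. 1 / s * F g c)"
        using semF[of g] s unfolding seminorm_def
        by (simp add: add_divide_distrib[symmetric] divide_right_mono)
      show "1 / s * F g u = 1 / s * F g v" if "\<And>a. a < r \<Longrightarrow> u a = v a" for u v
        using that by (simp add: F_def T_def)
      fix k assume k: "k \<in> integer_net r"
      then have "1 / 4 * s * N (K k) \<le> F g (K k) \<and> F g (K k) \<le> 4 * s * N (K k)"
        using g by (auto simp: E_def Bad_def)
      then show "1 / 4 * L2_set (\<lambda>a. real_of_int (k a)) {..<r} \<le> 1 / s * F g (\<lambda>a. real_of_int (k a))
        \<and> 1 / s * F g (\<lambda>a. real_of_int (k a)) \<le> 4 * L2_set (\<lambda>a. real_of_int (k a)) {..<r}"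
        using s by (simp add: N_def K_def field_simps)
    qed
    then show ?thesis using s by (simp add: N_def field_simps)
  qed
  ultimately show ?thesis using E unfolding F_def N_def T_def s_def by blast
qed

section \<open>Sparse embeddings\<close>

lemma sets_PiM_uniform_count_measure:
  assumes "finite I" "finite A"
  shows "sets (\<Pi>\<^sub>M i\<in>I. uniform_count_measure A) = Pow (PiE I (\<lambda>_. A))"
proof -
  have "sets (\<Pi>\<^sub>M i\<in>I. uniform_count_measure A) = sets (\<Pi>\<^sub>M i\<in>I. count_space A)"
    by (intro sets_PiM_cong refl sets_uniform_count_measure_count_space)
  also have "(\<Pi>\<^sub>M i\<in>I. count_space A) = count_space (PiE I (\<lambda>_. A))"
    using assms by (intro count_space_PiM_finite) (auto intro: countable_finite)
  finally show ?thesis by simp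
qed

lemma integrable_PiM_uniform_count_measure:
  fixes f :: "_ \<Rightarrow> real"
  assumes "finite I" "finite A" "A \<noteq> {}"
  shows "integrable (\<Pi>\<^sub>M i\<in>I. uniform_count_measure A) f"
proof -
  let ?M = "\<Pi>\<^sub>M i\<in>I. uniform_count_measure A"
  interpret prob_space ?M
    using assms by (intro prob_space_PiM prob_space_uniform_count_measure)
  have sp: "space ?M = PiE I (\<lambda>_. A)" by (simp add: space_PiM space_uniform_count_measure)
  have fin: "finite (space ?M)" unfolding sp using assms by (intro finite_PiE) auto
  show ?thesis
  proof (rule integrable_const_bound[where B = "\<Sum>x\<in>space ?M. \<bar>f x\<bar>"])
    show "AE x in ?M. norm (f x) \<le> (\<Sum>x\<in>space ?M. \<bar>f x\<bar>)"
      using fin by (intro AE_I2) (auto intro!: member_le_sum)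
    show "f \<in> borel_measurable ?M"
      by (rule measurableI) (auto simp: sets_PiM_uniform_count_measure[OF assms(1,2)] sp)
  qed
qed

section \<open>Second moments of random signs and hash collisions\<close>

context
  fixes n :: nat
begin

abbreviation "signs \<equiv> \<Pi>\<^sub>M i\<in>{..<n}. uniform_count_measure {- 1, 1 :: real}"

lemma rademacher_moment:
  "(\<integral>y. (\<Prod>m<n. y m ^ f m) \<partial>signs) = (\<Prod>m<n. if even (f m) then 1 else 0)"
proof -
  interpret product_sigma_finite "\<lambda>_::nat. uniform_count_measure {- 1, 1 :: real}"
    by (intro product_sigma_finite.intro prob_space_imp_sigma_finite prob_space_uniform_count_measure) auto
  have "integral\<^sup>L (uniform_count_measure {- 1, 1 :: real}) (\<lambda>x. x ^ k) = (if even k then 1 else 0)" for k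
    by (subst integral_uniform_count_measure) auto
  moreover have "integrable (uniform_count_measure {- 1, 1 :: real}) (\<lambda>x. x ^ k)" for k
    unfolding uniform_count_measure_def by (rule integrable_point_measure_finite) auto
  ultimately show ?thesis
    by (subst product_integral_prod) auto
qed

text \<open>As i and j differ and k and l differ, all multiplicities are even exactly when the two
  pairs agree as sets.\<close>

lemma rademacher_four_moment:
  assumes "i < n" "j < n" "k < n" "l < n" "i \<noteq> j" "k \<noteq> l"
  shows "(\<integral>y. y i * y j * (y k * y l) \<partial>signs) = (if (k, l) = (i, j) \<or> (k, l) = (j, i) then 1 else 0)"
proof -
  define f where "f = (\<lambda>m. (if m = i then 1 else 0) + (if m = j then 1 else 0)
     + ((if m = k then 1 else 0) + (if m = l then 1 else 0)) :: nat)"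
  have one: "(\<Prod>m<n. y m ^ (if m = i then 1 else 0)) = y i" if "i < n" for y :: "nat \<Rightarrow> real" and i
  proof -
    have "(\<Prod>m<n. y m ^ (if m = i then 1 else 0)) = (\<Prod>m<n. if m = i then y i else 1)"
      by (intro prod.cong) auto
    then show ?thesis using that by simp
  qed
  have "y i * y j * (y k * y l) = (\<Prod>m<n. y m ^ f m)" for y :: "nat \<Rightarrow> real"
    by (simp only: f_def power_add prod.distrib one assms)
  then have "(\<integral>y. y i * y j * (y k * y l) \<partial>signs) = (\<Prod>m<n. if even (f m) then 1 else 0)"
    by (simp add: rademacher_moment)
  also have "\<dots> = (if (k, l) = (i, j) \<or> (k, l) = (j, i) then 1 else 0)"
  proof (cases "(k, l) = (i, j) \<or> (k, l) = (j, i)")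
    case True
    then have "even (f m)" for m using assms by (auto simp: f_def)
    then show ?thesis using True by simp
  next
    case False
    then have "odd (f i) \<or> odd (f j)" using assms by (auto simp: f_def)
    then have "\<exists>m\<in>{..<n}. (if even (f m) then 1 else 0 :: real) = 0" using assms by auto
    then show ?thesis using False by (subst prod_zero) auto
  qed
  finally show ?thesis .
qed

definition off_diagonal :: "(nat \<times> nat) set" where
  "off_diagonal = {(i, j). i < n \<and> j < n \<and> i \<noteq> j}"

lemma finite_off_diagonal: "finite off_diagonal"
  unfolding off_diagonal_def by (rule finite_subset[of _ "{..<n} \<times> {..<n}"]) auto

text \<open>The off-diagonal part of an inner product of two hashed vectors. General coefficients
  allow both \<open>z i * z j\<close> and the mixed products \<open>q a i * q b j\<close>.\<close>

definition chaos :: "(nat \<times> nat \<Rightarrow> real) \<Rightarrow> (nat \<Rightarrow> real) \<Rightarrow> (nat \<Rightarrow> nat) \<Rightarrow> real" where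
  "chaos c y h = (\<Sum>(i, j)\<in>off_diagonal. of_bool (h i = h j) * (y i * y j) * c (i, j))"

text \<open>The coordinate \<kappa> of the sparse embedding applied to \<open>z\<close>.\<close>

definition hash_sum :: "(nat \<Rightarrow> real) \<Rightarrow> (nat \<Rightarrow> nat) \<Rightarrow> (nat \<Rightarrow> real) \<Rightarrow> nat \<Rightarrow> real" where
  "hash_sum y h z \<kappa> = (\<Sum>i<n. if h i = \<kappa> then y i * z i else 0)"

context
  fixes t1 :: nat
  assumes t1: "0 < t1"
begin

abbreviation "hashes \<equiv> \<Pi>\<^sub>M i\<in>{..<n}. uniform_count_measure {..<t1}"

lemma integrable_signs: "integrable signs (f :: _ \<Rightarrow> real)"
  by (rule integrable_PiM_uniform_count_measure) auto

lemma integrable_hashes: "integrable hashes (f :: _ \<Rightarrow> real)"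
  by (rule integrable_PiM_uniform_count_measure) (use t1 in auto)

text \<open>Split by the common hash value: there are \<open>t1\<close> values, each with
  probability 1 / t1^2.\<close>

lemma collision_probability:
  assumes ij: "(i, j) \<in> off_diagonal"
  shows "(\<integral>h. of_bool (h i = h j) \<partial>hashes) = 1 / real t1"
proof -
  interpret product_sigma_finite "\<lambda>_::nat. uniform_count_measure {..<t1}"
    by (intro product_sigma_finite.intro prob_space_imp_sigma_finite prob_space_uniform_count_measure)
       (use t1 in auto)
  have int: "integrable (uniform_count_measure {..<t1}) (f :: _ \<Rightarrow> real)" for f
    unfolding uniform_count_measure_def by (rule integrable_point_measure_finite) auto
  \<comment> \<open>Padding with the constant 1 turns the event on two coordinates into a product
    over all coordinates, which the product measure integrates factor by factor.\<close>
  define f where "f = (\<lambda>(k :: nat) (m :: nat) (x :: nat). if m = i \<or> m = j then of_bool (x = k) else 1 :: real)"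
  have f: "(\<Prod>m<n. f k m (h m)) = of_bool (h i = k) * of_bool (h j = k)" for k and h :: "nat \<Rightarrow> nat"
  proof -
    have "(\<Prod>m<n. f k m (h m)) = (\<Prod>m\<in>{i, j}. f k m (h m))"
      using ij by (intro prod.mono_neutral_right) (auto simp: f_def off_diagonal_def)
    then show ?thesis using ij by (simp add: f_def off_diagonal_def)
  qed
  have single: "(\<integral>h. of_bool (h i = k) * of_bool (h j = k) \<partial>hashes) = 1 / (real t1)\<^sup>2" if k: "k < t1" for k
  proof -
    have "(\<integral>h. of_bool (h i = k) * of_bool (h j = k) \<partial>hashes) = (\<integral>h. (\<Prod>m<n. f k m (h m)) \<partial>hashes)"
      by (simp only: f)
    also have "\<dots> = (\<Prod>m<n. integral\<^sup>L (uniform_count_measure {..<t1}) (f k m))"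
      by (rule product_integral_prod) (auto intro: int)
    also have "\<dots> = (\<Prod>m\<in>{i, j}. integral\<^sup>L (uniform_count_measure {..<t1}) (f k m))"
      using ij t1 by (intro prod.mono_neutral_right)
        (auto simp: f_def off_diagonal_def integral_uniform_count_measure
          space_uniform_count_measure measure_uniform_count_measure)
    also have "\<dots> = (1 / real t1) * (1 / real t1)"
      using ij k by (simp add: f_def off_diagonal_def integral_uniform_count_measure of_bool_def)
    finally show ?thesis by (simp add: power2_eq_square)
  qed
  have "(\<integral>h. of_bool (h i = h j) \<partial>hashes) = (\<integral>h. (\<Sum>k<t1. of_bool (h i = k) * of_bool (h j = k)) \<partial>hashes :: real)"
  proof (rule Bochner_Integration.integral_cong[OF refl])
    fix h assume "h \<in> space hashes"
    then have "h i < t1" using ij by (auto simp: space_PiM space_uniform_count_measure off_diagonal_def)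
    have "(\<Sum>k<t1. of_bool (h i = k) * of_bool (h j = k)) = (\<Sum>k<t1. if k = h i then of_bool (h i = h j) else 0 :: real)"
      by (intro sum.cong) auto
    then show "of_bool (h i = h j) = (\<Sum>k<t1. of_bool (h i = k) * of_bool (h j = k) :: real)"
      using \<open>h i < t1\<close> by simp
  qed
  also have "\<dots> = (\<Sum>k<t1. 1 / (real t1)\<^sup>2)"
    by (subst Bochner_Integration.integral_sum) (auto simp: integrable_hashes single)
  finally show ?thesis using t1 by (simp add: power2_eq_square)
qed

text \<open>Averaging over the signs leaves only the pairs \<open>p' = p\<close> and \<open>p' = prod.swap p\<close> in the
  double sum for the square.\<close>

lemma chaos_second_moment:
  "(\<integral>y. (\<integral>h. (chaos c y h)\<^sup>2 \<partial>hashes) \<partial>signs) \<le> 2 / real t1 * (\<Sum>p\<in>off_diagonal. (c p)\<^sup>2)"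
proof -
  let ?b = "\<lambda>p. 1 / real t1 * (3 / 2 * (c p)\<^sup>2 + 1 / 2 * (c (prod.swap p))\<^sup>2)"
  define \<beta> where "\<beta> = (\<lambda>p (h :: nat \<Rightarrow> nat). of_bool (h (fst p) = h (snd p)) :: real)"
  define Y where "Y = (\<lambda>p (y :: nat \<Rightarrow> real). y (fst p) * y (snd p))"
  define m where "m = (\<lambda>p p'. \<integral>h. \<beta> p h * \<beta> p' h \<partial>hashes)"
  let ?e = "\<lambda>p p'. m p p' * ((\<integral>y. Y p y * Y p' y \<partial>signs) * (c p * c p'))"
  have sq: "(chaos c y h)\<^sup>2 = (\<Sum>p\<in>off_diagonal. \<Sum>p'\<in>off_diagonal. (\<beta> p h * \<beta> p' h) * (Y p y * Y p' y * (c p * c p')))" for y h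
    unfolding chaos_def power2_eq_square sum_product
    by (intro sum.cong refl) (auto simp: \<beta>_def Y_def split: prod.splits)
  have inner: "(\<integral>h. (chaos c y h)\<^sup>2 \<partial>hashes)
      = (\<Sum>p\<in>off_diagonal. \<Sum>p'\<in>off_diagonal. m p p' * (Y p y * Y p' y * (c p * c p')))" for y
    unfolding sq m_def
    by (simp add: Bochner_Integration.integral_sum integrable_hashes)
  have outer: "(\<integral>y. (\<integral>h. (chaos c y h)\<^sup>2 \<partial>hashes) \<partial>signs)
      = (\<Sum>p\<in>off_diagonal. \<Sum>p'\<in>off_diagonal. ?e p p')"
    unfolding inner
    by (simp add: Bochner_Integration.integral_sum integrable_signs)
  have row: "(\<Sum>p'\<in>off_diagonal. ?e p p')
      \<le> ?b p" if p: "p \<in> off_diagonal" for p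
  proof -
    obtain i j where ij: "p = (i, j)" by (cases p)
    have ne: "(i, j) \<noteq> (j, i)" "(i, j) \<in> off_diagonal" "(j, i) \<in> off_diagonal"
      using p by (auto simp: ij off_diagonal_def)
    \<comment> \<open>Both surviving pairs describe the same collision, so the product of the
      indicators is a single indicator.\<close>
    have m: "m p p' = 1 / real t1" if "p' = (i, j) \<or> p' = (j, i)" for p'
    proof -
      have "m p p' = (\<integral>h. of_bool (h i = h j) \<partial>hashes)"
        unfolding m_def by (rule Bochner_Integration.integral_cong[OF refl]) (use that in \<open>auto simp: \<beta>_def ij\<close>)
      then show ?thesis using collision_probability ne by simp
    qed
    have "(\<Sum>p'\<in>off_diagonal. ?e p p')
        = (\<Sum>p'\<in>off_diagonal. if p' = (i, j) \<or> p' = (j, i) then 1 / real t1 * (c p * c p') else 0)"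
    proof (rule sum.cong[OF refl])
      fix p' assume "p' \<in> off_diagonal"
      then have "(\<integral>y. Y p y * Y p' y \<partial>signs) = (if p' = (i, j) \<or> p' = (j, i) then 1 else 0)"
        using rademacher_four_moment[of i j "fst p'" "snd p'"] p
        by (cases p') (auto simp: Y_def ij off_diagonal_def)
      then show "?e p p'
          = (if p' = (i, j) \<or> p' = (j, i) then 1 / real t1 * (c p * c p') else 0)"
        using m[of p'] by simp
    qed
    also have "\<dots> = (\<Sum>p'\<in>{(i, j), (j, i)}. 1 / real t1 * (c p * c p'))"
      using ne finite_off_diagonal by (intro sum.mono_neutral_cong_right) auto
    also have "\<dots> = 1 / real t1 * (c p * c p + c p * c (prod.swap p))"
      using ne by (simp add: ij distrib_left add_divide_distrib)
    \<comment> \<open>The mixed product is at most half the sum of the squares; swapping permutes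
      the pairs, so the weights 3/2 and 1/2 add up to the 2 of the statement.\<close>
    also have "\<dots> \<le> ?b p"
    proof (rule mult_left_mono)
      have "0 \<le> (c p - c (prod.swap p))\<^sup>2" by simp
      then show "c p * c p + c p * c (prod.swap p) \<le> 3 / 2 * (c p)\<^sup>2 + 1 / 2 * (c (prod.swap p))\<^sup>2"
        by (simp add: power2_eq_square algebra_simps)
    qed simp
    finally show ?thesis .
  qed
  have swap: "(\<Sum>p\<in>off_diagonal. (c (prod.swap p))\<^sup>2) = (\<Sum>p\<in>off_diagonal. (c p)\<^sup>2)"
    by (rule sum.reindex_bij_witness[of _ prod.swap prod.swap]) (auto simp: off_diagonal_def)
  have "(\<integral>y. (\<integral>h. (chaos c y h)\<^sup>2 \<partial>hashes) \<partial>signs)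
      \<le> (\<Sum>p\<in>off_diagonal. ?b p)"
    unfolding outer by (rule sum_mono) (rule row)
  also have "\<dots> = 1 / real t1 * (3 / 2 * (\<Sum>p\<in>off_diagonal. (c p)\<^sup>2) + 1 / 2 * (\<Sum>p\<in>off_diagonal. (c (prod.swap p))\<^sup>2))"
    by (simp only: sum_distrib_left[symmetric] sum.distrib)
  also have "\<dots> = 2 / real t1 * (\<Sum>p\<in>off_diagonal. (c p)\<^sup>2)" by (simp add: swap)
  finally show ?thesis .
qed

text \<open>Expanding the squares and summing over \<kappa> keeps just the pairs with equal hash; on
  the diagonal the signs square to 1.\<close>

lemma hash_sum_norm:
  assumes y: "\<And>i. i < n \<Longrightarrow> y i \<in> {- 1, 1}" and h: "\<And>i. i < n \<Longrightarrow> h i < t1"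
  shows "(\<Sum>\<kappa><t1. (hash_sum y h z \<kappa>)\<^sup>2) = (\<Sum>i<n. (z i)\<^sup>2) + chaos (\<lambda>(i, j). z i * z j) y h"
proof -
  let ?t = "\<lambda>i j. of_bool (h i = h j) * (y i * y j) * (z i * z j)"
  let ?u = "\<lambda>\<kappa> i j. (if h i = \<kappa> then y i * z i else 0) * (if h j = \<kappa> then y j * z j else 0)"
  have "(\<Sum>\<kappa><t1. (hash_sum y h z \<kappa>)\<^sup>2)
      = (\<Sum>\<kappa><t1. \<Sum>i<n. \<Sum>j<n. ?u \<kappa> i j)"
    by (simp only: hash_sum_def power2_eq_square sum_product)
  also have "\<dots> = (\<Sum>i<n. \<Sum>j<n. \<Sum>\<kappa><t1. ?u \<kappa> i j)"
    by (subst sum.swap, rule sum.cong[OF refl], rule sum.swap)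
  also have "\<dots> = (\<Sum>i<n. \<Sum>j<n. ?t i j)"
  proof (intro sum.cong refl)
    fix i j assume "i \<in> {..<n}"
    then have "h i < t1" using h by simp
    have "(\<Sum>\<kappa><t1. ?u \<kappa> i j)
        = (\<Sum>\<kappa><t1. if \<kappa> = h i then ?t i j else 0)"
      by (intro sum.cong) auto
    then show "(\<Sum>\<kappa><t1. ?u \<kappa> i j)
        = ?t i j" using \<open>h i < t1\<close> by simp
  qed
  also have "\<dots> = (\<Sum>(i, j)\<in>{..<n} \<times> {..<n}. ?t i j)"
    by (rule sum.cartesian_product)
  also have "\<dots> = (\<Sum>(i, j)\<in>(\<lambda>i. (i, i)) ` {..<n} \<union> off_diagonal. ?t i j)"
    by (intro sum.cong) (auto simp: off_diagonal_def)
  also have "\<dots> = (\<Sum>(i, j)\<in>(\<lambda>i. (i, i)) ` {..<n}. ?t i j)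
      + (\<Sum>(i, j)\<in>off_diagonal. ?t i j)"
    using finite_off_diagonal by (intro sum.union_disjoint) (auto simp: off_diagonal_def)
  also have "(\<Sum>(i, j)\<in>(\<lambda>i. (i, i)) ` {..<n}. ?t i j) = (\<Sum>i<n. (z i)\<^sup>2)"
  proof (subst sum.reindex)
    show "sum ((\<lambda>(i, j). ?t i j) \<circ> (\<lambda>i. (i, i))) {..<n} = (\<Sum>i<n. (z i)\<^sup>2)"
    proof (rule sum.cong[OF refl])
      fix i assume "i \<in> {..<n}"
      then have "y i * y i = 1" using y[of i] by auto
      then show "((\<lambda>(i, j). ?t i j) \<circ> (\<lambda>i. (i, i))) i = (z i)\<^sup>2"
        by (simp add: power2_eq_square)
    qed
  qed (auto intro: inj_onI)
  finally show ?thesis by (simp add: chaos_def)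
qed

text \<open>The Gram matrix of the hashed basis is close to the identity in Frobenius norm. Signs
  and hashes are separate factors of the sample space, so Markov's inequality is applied twice, the
  hash event depending on the signs.\<close>

lemma sparse_embedding_events:
  assumes q: "orthonormal_family n r q" and r: "r \<le> d" and d: "1 \<le> d" and K: "80000 * (real d)\<^sup>2 \<le> real t1"
  shows "\<exists>Ey\<in>sets signs. measure signs Ey \<ge> 99 / 100 \<and> (\<forall>y\<in>Ey.
    \<exists>Eh\<in>sets hashes. measure hashes Eh \<ge> 99 / 100 \<and> (\<forall>h\<in>Eh. sandwiched (1 / 2) 2 (\<lambda>c. L2_set c {..<r})
      (\<lambda>c. L2_set (hash_sum y h (lincomb r c q)) {..<t1})))"
proof -
  let ?c = "\<lambda>a b p. (case p of (i, j) \<Rightarrow> q a i * q b j)\<^sup>2"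
  interpret Y: prob_space signs
    by (intro prob_space_PiM prob_space_uniform_count_measure) auto
  interpret H: prob_space hashes
    by (intro prob_space_PiM prob_space_uniform_count_measure) (use t1 in auto)
  define Z where "Z = (\<lambda>a b. chaos (\<lambda>(i, j). q a i * q b j))"
  \<comment> \<open>\<open>Z a b\<close> is an entry of the Gram matrix minus the identity, and
    \<open>F\<close> the squared Frobenius norm of that difference; its mean is at most 2 r^2 /
    t1.\<close>
  define F where "F = (\<lambda>y h. \<Sum>(a, b)\<in>{..<r} \<times> {..<r}. (Z a b y h)\<^sup>2)"
  define \<phi> where "\<phi> = (\<lambda>y. \<integral>h. F y h \<partial>hashes)"
  have F0: "0 \<le> F y h" for y h unfolding F_def by (rule sum_nonneg) auto
  have \<phi>0: "0 \<le> \<phi> y" for y unfolding \<phi>_def by (rule Bochner_Integration.integral_nonneg) (rule F0)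
  have unit: "(\<Sum>i<n. (q a i)\<^sup>2) = 1" if "a < r" for a
    using q that by (simp add: orthonormal_family_def power2_eq_square)
  have c: "(\<Sum>p\<in>off_diagonal. ?c a b p) \<le> 1" if ab: "a < r" "b < r" for a b
  proof -
    have "(\<Sum>p\<in>off_diagonal. ?c a b p)
        \<le> (\<Sum>p\<in>{..<n} \<times> {..<n}. ?c a b p)"
      by (rule sum_mono2) (auto simp: off_diagonal_def)
    also have "\<dots> = (\<Sum>(i, j)\<in>{..<n} \<times> {..<n}. (q a i)\<^sup>2 * (q b j)\<^sup>2)"
      by (intro sum.cong) (auto simp: power_mult_distrib)
    also have "\<dots> = (\<Sum>i<n. (q a i)\<^sup>2) * (\<Sum>j<n. (q b j)\<^sup>2)"
      by (simp add: sum_product sum.cartesian_product)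
    finally show ?thesis using ab by (simp add: unit)
  qed
  have "(\<integral>y. \<phi> y \<partial>signs) = (\<Sum>(a, b)\<in>{..<r} \<times> {..<r}. \<integral>y. (\<integral>h. (Z a b y h)\<^sup>2 \<partial>hashes) \<partial>signs)"
    unfolding \<phi>_def F_def
    by (simp add: Bochner_Integration.integral_sum integrable_hashes integrable_signs case_prod_unfold)
  also have "\<dots> \<le> (\<Sum>(a, b)\<in>{..<r} \<times> {..<r}. 2 / real t1)"
  proof (rule sum_mono)
    fix p assume "p \<in> {..<r} \<times> {..<r}"
    then obtain a b where p: "p = (a, b)" and "a < r" "b < r" by auto
    then have "2 / real t1 * (\<Sum>p\<in>off_diagonal. ?c a b p) \<le> 2 / real t1 * 1"
      by (intro mult_left_mono c) auto
    then have "(\<integral>y. (\<integral>h. (Z a b y h)\<^sup>2 \<partial>hashes) \<partial>signs) \<le> 2 / real t1"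
      unfolding Z_def using chaos_second_moment[of "\<lambda>(i, j). q a i * q b j"] by linarith
    then show "(case p of (a, b) \<Rightarrow> \<integral>y. (\<integral>h. (Z a b y h)\<^sup>2 \<partial>hashes) \<partial>signs)
        \<le> (case p of (a, b) \<Rightarrow> 2 / real t1)"
      by (simp add: p)
  qed
  also have "\<dots> = 2 * (real r)\<^sup>2 / real t1" by (simp add: power2_eq_square)
  also have "\<dots> \<le> 1 / 40000"
  proof -
    have "(real r)\<^sup>2 \<le> (real d)\<^sup>2" using r by (intro power_mono) auto
    then have "80000 * (real r)\<^sup>2 \<le> real t1" using K by linarith
    then show ?thesis using t1 by (simp add: divide_simps)
  qed
  finally have E\<phi>: "(\<integral>y. \<phi> y \<partial>signs) \<le> 1 / 40000" .
  \<comment> \<open>Thresholds for failure probability 1/100 at each step: the mean 1/40000 against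
    1/400 over the signs, then 1/400 against 1/4 over the hashes. Hence the 80000 in the bound on
    \<open>t1\<close>.\<close>
  define Ey where "Ey = {y \<in> space signs. \<not> 1 / 400 \<le> \<phi> y}"
  have all_sets_y: "{y \<in> space signs. P y} \<in> sets signs" for P
    by (subst sets_PiM_uniform_count_measure) (auto simp: space_PiM space_uniform_count_measure)
  have all_sets_h: "{h \<in> space hashes. P h} \<in> sets hashes" for P
    by (subst sets_PiM_uniform_count_measure) (auto simp: space_PiM space_uniform_count_measure)
  have "measure signs {y \<in> space signs. 1 / 400 \<le> \<phi> y} \<le> (\<integral>y. \<phi> y \<partial>signs) / (1 / 400)"
    by (rule integral_Markov_inequality_measure[where A = "{}"]) (auto simp: integrable_signs \<phi>0)
  then have "measure signs Ey \<ge> 99 / 100"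
    unfolding Ey_def using E\<phi> by (subst Y.prob_neg) (auto simp: all_sets_y)
  moreover have "\<exists>Eh\<in>sets hashes. measure hashes Eh \<ge> 99 / 100 \<and> (\<forall>h\<in>Eh. sandwiched (1 / 2) 2 (\<lambda>c. L2_set c {..<r})
      (\<lambda>c. L2_set (hash_sum y h (lincomb r c q)) {..<t1}))" if y: "y \<in> Ey" for y
  proof -
    define Eh where "Eh = {h \<in> space hashes. \<not> 1 / 4 \<le> F y h}"
    have "measure hashes {h \<in> space hashes. 1 / 4 \<le> F y h} \<le> (\<integral>h. F y h \<partial>hashes) / (1 / 4)"
      by (rule integral_Markov_inequality_measure[where A = "{}"]) (auto simp: integrable_hashes F0)
    moreover have "(\<integral>h. F y h \<partial>hashes) \<le> 1 / 400" using y by (simp add: Ey_def \<phi>_def)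
    ultimately have "measure hashes Eh \<ge> 99 / 100"
      unfolding Eh_def by (subst H.prob_neg) (auto simp: all_sets_h)
    moreover have "1 / 2 * L2_set c {..<r} \<le> L2_set (hash_sum y h (lincomb r c q)) {..<t1}
    \<and> L2_set (hash_sum y h (lincomb r c q)) {..<t1} \<le> 2 * L2_set c {..<r}" if h: "h \<in> Eh" for h c
    proof -
      define z where "z = (lincomb r c q)"
      define N where "N = L2_set c {..<r}"
      have N: "0 \<le> N" "N\<^sup>2 = (\<Sum>a<r. (c a)\<^sup>2)" by (auto simp: N_def L2_set_def sum_nonneg)
      have zN: "(\<Sum>i<n. (z i)\<^sup>2) = N\<^sup>2"
        using orthonormal_L2_lincomb[OF q, of c] N by (simp add: L2_set_def z_def N_def)
      have "chaos (\<lambda>(i, j). z i * z j) y h = (\<Sum>(a, b)\<in>{..<r} \<times> {..<r}. (c a * c b) * Z a b y h)"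
      proof -
        have zz: "z i * z j = (\<Sum>(a, b)\<in>{..<r} \<times> {..<r}. (c a * c b) * (q a i * q b j))" for i j
          unfolding z_def sum_product sum.cartesian_product by (intro sum.cong refl) auto
        have "chaos (\<lambda>(i, j). z i * z j) y h
            = (\<Sum>(i, j)\<in>off_diagonal. \<Sum>(a, b)\<in>{..<r} \<times> {..<r}. (c a * c b) * (of_bool (h i = h j) * (y i * y j) * (q a i * q b j)))"
          unfolding chaos_def
          by (intro sum.cong refl) (auto simp: zz sum_distrib_left case_prod_unfold intro!: sum.cong)
        also have "\<dots> = (\<Sum>(a, b)\<in>{..<r} \<times> {..<r}. \<Sum>(i, j)\<in>off_diagonal. (c a * c b) * (of_bool (h i = h j) * (y i * y j) * (q a i * q b j)))"
          unfolding case_prod_unfold by (rule sum.swap)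
        finally show ?thesis by (simp add: Z_def chaos_def sum_distrib_left case_prod_unfold)
      qed
      \<comment> \<open>Cauchy-Schwarz bounds the quadratic form by N^2 times the Frobenius norm,
        here at most 1/2.\<close>
      also have "\<bar>\<dots>\<bar> \<le> (\<Sum>p\<in>{..<r} \<times> {..<r}. \<bar>c (fst p) * c (snd p)\<bar> * \<bar>Z (fst p) (snd p) y h\<bar>)"
        unfolding case_prod_unfold abs_mult[symmetric] by (rule sum_abs)
      also have "\<dots> \<le> L2_set (\<lambda>p. c (fst p) * c (snd p)) ({..<r} \<times> {..<r}) * L2_set (\<lambda>p. Z (fst p) (snd p) y h) ({..<r} \<times> {..<r})"
        by (rule L2_set_mult_ineq)
      also have "L2_set (\<lambda>p. c (fst p) * c (snd p)) ({..<r} \<times> {..<r}) = N\<^sup>2"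
      proof -
        have "(\<Sum>p\<in>{..<r} \<times> {..<r}. (c (fst p) * c (snd p))\<^sup>2) = (N\<^sup>2)\<^sup>2"
          unfolding N(2) power2_eq_square[of "sum _ _"] sum_product sum.cartesian_product
          by (intro sum.cong) (auto simp: power_mult_distrib)
        then show ?thesis by (simp only: L2_set_def real_sqrt_abs abs_of_nonneg[OF zero_le_power2])
      qed
      also have "L2_set (\<lambda>p. Z (fst p) (snd p) y h) ({..<r} \<times> {..<r}) = sqrt (F y h)"
        by (simp add: L2_set_def F_def case_prod_unfold)
      also have "N\<^sup>2 * sqrt (F y h) \<le> N\<^sup>2 * (1 / 2)"
      proof (rule mult_left_mono)
        have "sqrt (F y h) \<le> sqrt (1 / 4)" using h by (intro real_sqrt_le_mono) (simp add: Eh_def)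
        then show "sqrt (F y h) \<le> 1 / 2" by (simp add: real_sqrt_divide)
      qed simp
      finally have ch: "\<bar>chaos (\<lambda>(i, j). z i * z j) y h\<bar> \<le> N\<^sup>2 * (1 / 2)" .
      have yh: "\<And>i. i < n \<Longrightarrow> y i \<in> {- 1, 1}" "\<And>i. i < n \<Longrightarrow> h i < t1"
        using y h by (auto simp: Ey_def Eh_def space_PiM space_uniform_count_measure)
      have "L2_set (hash_sum y h z) {..<t1} = sqrt (N\<^sup>2 + chaos (\<lambda>(i, j). z i * z j) y h)"
        by (simp add: L2_set_def hash_sum_norm[OF yh] zN)
      moreover have "sqrt ((1 / 2 * N)\<^sup>2) \<le> sqrt (N\<^sup>2 + chaos (\<lambda>(i, j). z i * z j) y h)"
      proof (rule real_sqrt_le_mono)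
        have "(1 / 2 * N)\<^sup>2 = 1 / 4 * N\<^sup>2" by (simp add: power2_eq_square)
        then show "(1 / 2 * N)\<^sup>2 \<le> N\<^sup>2 + chaos (\<lambda>(i, j). z i * z j) y h"
          using ch zero_le_power2[of N] by linarith
      qed
      moreover have "sqrt (N\<^sup>2 + chaos (\<lambda>(i, j). z i * z j) y h) \<le> sqrt ((2 * N)\<^sup>2)"
      proof (rule real_sqrt_le_mono)
        have "(2 * N)\<^sup>2 = 4 * N\<^sup>2" by (simp add: power2_eq_square)
        then show "N\<^sup>2 + chaos (\<lambda>(i, j). z i * z j) y h \<le> (2 * N)\<^sup>2"
          using ch zero_le_power2[of N] by linarith
      qed
      ultimately show ?thesis
        using N(1) unfolding z_def[symmetric] N_def[symmetric] real_sqrt_abs by simp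
    qed
    moreover have "Eh \<in> sets hashes" unfolding Eh_def by (rule all_sets_h)
    ultimately show ?thesis by blast
  qed
  moreover have "Ey \<in> sets signs" unfolding Ey_def by (rule all_sets_y)
  ultimately show ?thesis by blast
qed

end

end

section \<open>The random diagonal\<close>

context orlicz_function
begin

text \<open>A dyadic majorant of \<open>1 / G\<close> on \<open>[2 ^ - L, \<infinity>)\<close>: each of its levels has bounded mean, since
  \<open>x \<le> 2 ^ - k\<close> has probability at most \<open>G (2 ^ - k) \<le> 4 * C * G (2 ^ - (k + 1))\<close>.\<close>

definition dyadic :: "nat \<Rightarrow> real \<Rightarrow> real" where
  "dyadic L x = 1 + (\<Sum>k<L. 1 / G ((1 / 2) ^ Suc k) * indicator {..(1 / 2) ^ k} x)"

abbreviation dyadic_weight :: "nat \<Rightarrow> nat \<Rightarrow> (nat \<Rightarrow> nat \<Rightarrow> real) \<Rightarrow> nat \<Rightarrow> (nat \<Rightarrow> real) \<Rightarrow> real" where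
  "dyadic_weight n r U L \<delta> \<equiv> \<Sum>j<r. \<Sum>i<n. G \<bar>U j i\<bar> * dyadic L (\<delta> i)"

text \<open>The first clause makes the truncated majorant valid and limits the effect of rounding to
  the net; the second yields the upper bound; the third yields the lower bound at the net points
  \<open>Z\<close>.\<close>

abbreviation good_diagonal ::
  "nat \<Rightarrow> nat \<Rightarrow> nat \<Rightarrow> (nat \<Rightarrow> nat \<Rightarrow> real) \<Rightarrow> nat \<Rightarrow> real \<Rightarrow> (nat \<Rightarrow> real) set \<Rightarrow> (nat \<Rightarrow> real) \<Rightarrow> bool" where
  "good_diagonal n d r U L T Z \<delta> \<equiv> (\<forall>i<n. 1 / (100 * real n) \<le> \<delta> i)
     \<and> dyadic_weight n r U L \<delta> \<le> 100 * real d * (1 + 4 * C * real L)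
     \<and> (\<forall>z\<in>Z. 0 < orlicz G n z \<longrightarrow> (\<exists>i<n. orlicz G n z / (2 * T) \<le> \<bar>z i\<bar> / \<delta> i))"

lemma dyadic_ge_1: "1 \<le> dyadic L x"
  unfolding dyadic_def using nonneg by (simp add: sum_nonneg)

text \<open>For the least k with \<open>(1 / 2) ^ k \<le> x\<close>, if k is positive, level k - 1
  is active at x and dominates by monotonicity. The summand 1 covers x >= 1.\<close>

lemma inverse_le_dyadic:
  assumes x: "(1 / 2) ^ L \<le> x"
  shows "1 / G x \<le> dyadic L x"
proof (cases "1 < x")
  case True
  then have "1 / G x \<le> 1" using gt1[OF True] by simp
  then show ?thesis using dyadic_ge_1[of L x] by linarith
next
  case False
  define P where "P = (\<lambda>k. (1 / 2 :: real) ^ k \<le> x)"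
  define k where "k = (LEAST k. P k)"
  have PL: "P L" using x by (simp add: P_def)
  have Pk: "P k" unfolding k_def using PL by (rule LeastI)
  have kL: "k \<le> L" unfolding k_def using PL by (rule Least_le)
  show ?thesis
  proof (cases k)
    case 0
    then have "x = 1" using Pk False by (simp add: P_def)
    then show ?thesis using dyadic_ge_1[of L x] by (simp add: one)
  next
    case (Suc j)
    have "\<not> P j" using not_less_Least[of j P] Suc by (simp add: k_def)
    then have xj: "x \<le> (1 / 2) ^ j" by (simp add: P_def)
    have "1 / G x \<le> 1 / G ((1 / 2) ^ Suc j)"
      using Pk Suc pos[of "(1 / 2) ^ Suc j"] mono[of "(1 / 2) ^ Suc j" x]
      by (intro divide_left_mono mult_pos_pos) (auto simp: P_def intro!: pos less_le_trans[OF _ Pk[unfolded P_def]])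
    also have "\<dots> = 1 / G ((1 / 2) ^ Suc j) * indicator {..(1 / 2) ^ j} x" using xj by simp
    also have "\<dots> \<le> (\<Sum>k<L. 1 / G ((1 / 2) ^ Suc k) * indicator {..(1 / 2) ^ k} x)"
    proof (rule member_le_sum)
      show "j \<in> {..<L}" using kL Suc by simp
      show "0 \<le> 1 / G ((1 / 2) ^ Suc k) * indicator {..(1 / 2) ^ k} x" for k
        using nonneg by (intro mult_nonneg_nonneg) auto
    qed simp
    finally show ?thesis by (simp add: dyadic_def)
  qed
qed

context
  fixes \<mu> :: "real measure" and n :: nat
  assumes \<mu>: "real_distribution \<mu>" and cdf: "\<And>t. 0 \<le> t \<Longrightarrow> cdf \<mu> t = 1 - exp (- G t)"
    and n: "2 \<le> n"
begin

interpretation \<mu>: real_distribution \<mu> by (rule \<mu>)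

abbreviation "diagonals \<equiv> \<Pi>\<^sub>M i\<in>{..<n}. \<mu>"

interpretation P: prob_space diagonals by (rule prob_space_PiM) unfold_locales

lemma prob_le: "0 \<le> t \<Longrightarrow> measure \<mu> {..t} \<le> G t"
  using cdf[of t] exp_ge_add_one_self[of "- G t"] by (simp add: cdf_def)

lemma prob_gt: "0 \<le> t \<Longrightarrow> measure \<mu> {t<..} = exp (- G t)"
proof -
  assume t: "0 \<le> t"
  have "measure \<mu> {t<..} = measure \<mu> (space \<mu> - {..t})" by (intro arg_cong[where f = "measure \<mu>"]) auto
  also have "\<dots> = 1 - measure \<mu> {..t}" by (rule \<mu>.prob_compl) simp
  finally show ?thesis using cdf[OF t] by (simp add: cdf_def)
qed

lemma coordinate_distr: "i < n \<Longrightarrow> distr diagonals \<mu> (\<lambda>\<delta>. \<delta> i) = \<mu>"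
  by (rule distr_PiM_component) (auto intro: \<mu>.prob_space_axioms)

lemma prob_coordinate_le:
  assumes "i < n" "0 \<le> t"
  shows "measure diagonals {\<delta> \<in> space diagonals. \<delta> i \<le> t} \<le> G t"
proof -
  have "measure \<mu> {..t} = measure (distr diagonals \<mu> (\<lambda>\<delta>. \<delta> i)) {..t}"
    by (simp add: coordinate_distr assms)
  also have "\<dots> = measure diagonals ((\<lambda>\<delta>. \<delta> i) -` {..t} \<inter> space diagonals)"
    using assms by (intro measure_distr) auto
  also have "(\<lambda>\<delta>. \<delta> i) -` {..t} \<inter> space diagonals = {\<delta> \<in> space diagonals. \<delta> i \<le> t}" by auto
  finally show ?thesis using prob_le[OF assms(2)] by simp
qed

lemma dyadic_measurable: "dyadic L \<in> borel_measurable borel"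
  unfolding dyadic_def by measurable

lemma dyadic_integrable: "integrable \<mu> (dyadic L)"
  unfolding dyadic_def
  by (intro Bochner_Integration.integrable_add Bochner_Integration.integrable_sum integrable_mult_right
      \<mu>.integrable_const integrable_real_indicator) (auto simp: \<mu>.emeasure_eq_measure)

lemma dyadic_mean: "(\<integral>x. dyadic L x \<partial>\<mu>) \<le> 1 + 4 * C * real L"
proof -
  have int: "integrable \<mu> (indicator {..t} :: real \<Rightarrow> real)" for t
    by (rule integrable_real_indicator) (auto simp: \<mu>.emeasure_eq_measure)
  have "(\<integral>x. dyadic L x \<partial>\<mu>) = 1 + (\<Sum>k<L. 1 / G ((1 / 2) ^ Suc k) * measure \<mu> {..(1 / 2) ^ k})"
    unfolding dyadic_def using int \<mu>.prob_space[unfolded \<mu>.space_eq_univ]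
    by (subst Bochner_Integration.integral_add) auto
  also have "\<dots> \<le> 1 + (\<Sum>k<L. 4 * C)"
  proof (intro add_left_mono sum_mono)
    fix k
    let ?a = "(1 / 2 :: real) ^ Suc k"
    have p: "0 < G ?a" by (rule pos) simp
    have "measure \<mu> {..(1 / 2) ^ k} \<le> G ((1 / 2) ^ k)" by (rule prob_le) simp
    also have "\<dots> \<le> C * ((1 / 2) ^ k / ?a)\<^sup>2 * G ?a" by (rule growth) auto
    also have "(1 / 2) ^ k / ?a = (2 :: real)" by simp
    finally show "1 / G ?a * measure \<mu> {..(1 / 2) ^ k} \<le> 4 * C"
      using p by (simp add: pos_divide_le_eq mult_ac)
  qed
  finally show ?thesis by (simp add: mult_ac)
qed

text \<open>Each basis vector has values of G summing to at most 1 and so contributes at most one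
  \<open>dyadic_mean\<close>; Markov's inequality with factor 100.\<close>

lemma weighted_dyadic_markov:
  assumes U: "\<And>j. j < r \<Longrightarrow> (\<Sum>i<n. G \<bar>U j i\<bar>) \<le> 1" and r: "r \<le> d" and d: "1 \<le> d"
  shows "measure diagonals {\<delta> \<in> space diagonals.
      100 * real d * (1 + 4 * C * real L) \<le> dyadic_weight n r U L \<delta>} \<le> 1 / 100"
proof -
  have C0: "0 \<le> C" using C_ge_1 by simp
  have int: "integrable diagonals (\<lambda>\<delta>. dyadic L (\<delta> i))"
    and mean: "(\<integral>\<delta>. dyadic L (\<delta> i) \<partial>diagonals) \<le> 1 + 4 * C * real L" if i: "i < n" for i
  proof -
    have m: "(\<lambda>\<delta>. \<delta> i) \<in> diagonals \<rightarrow>\<^sub>M \<mu>" using i by auto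
    have H: "dyadic L \<in> borel_measurable \<mu>" using dyadic_measurable by simp
    show "integrable diagonals (\<lambda>\<delta>. dyadic L (\<delta> i))"
      using integrable_distr[OF m, of "dyadic L"] dyadic_integrable by (simp add: coordinate_distr i)
    have "(\<integral>\<delta>. dyadic L (\<delta> i) \<partial>diagonals) = (\<integral>x. dyadic L x \<partial>distr diagonals \<mu> (\<lambda>\<delta>. \<delta> i))"
      by (rule integral_distr[OF m H, symmetric])
    then show "(\<integral>\<delta>. dyadic L (\<delta> i) \<partial>diagonals) \<le> 1 + 4 * C * real L"
      using dyadic_mean by (simp add: coordinate_distr i)
  qed
  define K where "K = 100 * real d * (1 + 4 * C * real L)"
  have K: "0 < K" unfolding K_def using d C0 by (intro mult_pos_pos) (auto intro: add_pos_nonneg)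
  let ?W = "\<lambda>\<delta>. \<Sum>j<r. \<Sum>i<n. G \<bar>U j i\<bar> * dyadic L (\<delta> i)"
  have "(\<integral>\<delta>. ?W \<delta> \<partial>diagonals) = (\<Sum>j<r. \<integral>\<delta>. (\<Sum>i<n. G \<bar>U j i\<bar> * dyadic L (\<delta> i)) \<partial>diagonals)"
    by (intro Bochner_Integration.integral_sum Bochner_Integration.integrable_sum integrable_mult_right int) simp
  also have "\<dots> = (\<Sum>j<r. \<Sum>i<n. G \<bar>U j i\<bar> * (\<integral>\<delta>. dyadic L (\<delta> i) \<partial>diagonals))"
  proof (rule sum.cong[OF refl])
    fix j
    have "(\<integral>\<delta>. (\<Sum>i<n. G \<bar>U j i\<bar> * dyadic L (\<delta> i)) \<partial>diagonals)
        = (\<Sum>i<n. \<integral>\<delta>. G \<bar>U j i\<bar> * dyadic L (\<delta> i) \<partial>diagonals)"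
      by (intro Bochner_Integration.integral_sum integrable_mult_right int) simp
    then show "(\<integral>\<delta>. (\<Sum>i<n. G \<bar>U j i\<bar> * dyadic L (\<delta> i)) \<partial>diagonals)
        = (\<Sum>i<n. G \<bar>U j i\<bar> * (\<integral>\<delta>. dyadic L (\<delta> i) \<partial>diagonals))" by simp
  qed
  also have "\<dots> \<le> (\<Sum>j<r. \<Sum>i<n. G \<bar>U j i\<bar> * (1 + 4 * C * real L))"
    by (intro sum_mono mult_left_mono mean nonneg) auto
  also have "\<dots> = (\<Sum>j<r. (\<Sum>i<n. G \<bar>U j i\<bar>) * (1 + 4 * C * real L))"
    by (simp add: sum_distrib_right)
  also have "\<dots> \<le> (\<Sum>j<r. 1 * (1 + 4 * C * real L))"
    by (intro sum_mono mult_right_mono U) (use C0 in auto)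
  also have "\<dots> = real r * (1 + 4 * C * real L)" by simp
  also have "\<dots> \<le> real d * (1 + 4 * C * real L)"
    using r C0 by (intro mult_right_mono) auto
  also have "\<dots> = K / 100" by (simp add: K_def)
  finally have W: "(\<integral>\<delta>. ?W \<delta> \<partial>diagonals) \<le> K / 100" .
  have "measure diagonals {\<delta> \<in> space diagonals. K \<le> ?W \<delta>} \<le> (\<integral>\<delta>. ?W \<delta> \<partial>diagonals) / K"
  proof (rule integral_Markov_inequality_measure[where A = "{}"])
    show "integrable diagonals ?W"
      by (intro Bochner_Integration.integrable_sum integrable_mult_right) (simp add: int)
    have "0 \<le> G \<bar>U j i\<bar> * dyadic L (\<delta> i)" for i j and \<delta> :: "nat \<Rightarrow> real"
      using nonneg[of "\<bar>U j i\<bar>"] dyadic_ge_1[of L "\<delta> i"] by (intro mult_nonneg_nonneg) auto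
    then show "AE \<delta> in diagonals. 0 \<le> ?W \<delta>" by (intro AE_I2 sum_nonneg)
  qed (use K in auto)
  also have "\<dots> \<le> K / 100 / K" using W K by (intro divide_right_mono) auto
  also have "\<dots> = 1 / 100" using K by simp
  finally show ?thesis by (simp add: K_def)
qed

text \<open>The events \<open>b i < \<delta> i\<close> are independent with probabilities \<open>exp (- G (b i))\<close>, and
  \<open>G (T * x) \<ge> T * G x\<close> by convexity.\<close>

lemma no_large_coordinate_prob:
  assumes T: "1 \<le> T" and N: "0 < orlicz G n z"
  shows "measure diagonals {\<delta> \<in> space diagonals. \<forall>i<n. \<bar>z i\<bar> / (orlicz G n z / (2 * T)) < \<delta> i} \<le> exp (- T)"
proof -
  let ?N = "orlicz G n z"
  define b where "b = (\<lambda>i. \<bar>z i\<bar> / (?N / (2 * T)))"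
  have b: "0 \<le> b i" for i using T N by (simp add: b_def)
  interpret fp: finite_product_prob_space "\<lambda>_. \<mu>" "{..<n}"
    by unfold_locales auto
  have "{\<delta> \<in> space diagonals. \<forall>i<n. b i < \<delta> i} = PiE {..<n} (\<lambda>i. {b i<..})"
    by (auto simp: space_PiM PiE_def Pi_def)
  then have "measure diagonals {\<delta> \<in> space diagonals. \<forall>i<n. b i < \<delta> i} = (\<Prod>i<n. measure \<mu> {b i<..})"
    using fp.finite_measure_PiM_emb[of "\<lambda>i. {b i<..}"] by simp
  also have "\<dots> = (\<Prod>i<n. exp (- G (b i)))" by (simp add: prob_gt b)
  also have "\<dots> = exp (- (\<Sum>i<n. G (b i)))" by (simp add: exp_sum[symmetric] sum_negf)
  also have "\<dots> \<le> exp (- T)"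
  proof -
    \<comment> \<open>Half the norm lies below the infimum, hence is infeasible: this is the 2 in
      \<open>2 * T\<close>.\<close>
    have "\<not> feasible n z (?N / 2)" using orlicz_le[of n z "?N / 2"] N by auto
    then have "1 \<le> (\<Sum>i<n. G (\<bar>z i\<bar> / (?N / 2)))" using N by (simp add: feasible_def)
    then have "T * 1 \<le> T * (\<Sum>i<n. G (\<bar>z i\<bar> / (?N / 2)))" using T by (intro mult_left_mono) auto
    also have "\<dots> = (\<Sum>i<n. T * G (\<bar>z i\<bar> / (?N / 2)))" by (rule sum_distrib_left)
    also have "\<dots> \<le> (\<Sum>i<n. G (T * (\<bar>z i\<bar> / (?N / 2))))"
      using T N by (intro sum_mono scale_ge) auto
    also have "\<dots> = (\<Sum>i<n. G (b i))"
      by (intro sum.cong refl arg_cong[where f = G]) (simp add: b_def)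
    finally show ?thesis by simp
  qed
  finally show ?thesis by (simp only: b_def)
qed

lemma diagonal_event:
  fixes U :: "nat \<Rightarrow> nat \<Rightarrow> real" and Z :: "(nat \<Rightarrow> real) set"
  assumes U: "\<And>j. j < r \<Longrightarrow> (\<Sum>i<n. G \<bar>U j i\<bar>) \<le> 1" and r: "r \<le> d" and d: "1 \<le> d"
    and T: "1 \<le> T" and Z: "finite Z" "real (card Z) * exp (- T) \<le> 1 / 100"
  shows "\<exists>E\<in>sets diagonals. measure diagonals E \<ge> 97 / 100 \<and> (\<forall>\<delta>\<in>E. good_diagonal n d r U L T Z \<delta>)"
proof -
  \<comment> \<open>An entry is at most t with probability at most G t <= t, so the n entries
    together fail with probability at most 1/100.\<close>
  define t where "t = 1 / (100 * real n)"
  have t: "0 < t" "t \<le> 1" using n by (auto simp: t_def)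
  define B1 where "B1 = (\<lambda>i. {\<delta> \<in> space diagonals. \<delta> i \<le> t})"
  define B2 where "B2 = {\<delta> \<in> space diagonals.
      100 * real d * (1 + 4 * C * real L) \<le> dyadic_weight n r U L \<delta>}"
  \<comment> \<open>Points of norm 0 carry no requirement and get the empty bad event.\<close>
  define B3 where "B3 = (\<lambda>z. if 0 < orlicz G n z
     then {\<delta> \<in> space diagonals. \<forall>i<n. \<bar>z i\<bar> / (orlicz G n z / (2 * T)) < \<delta> i} else {})"
  have s1: "B1 i \<in> sets diagonals" if "i < n" for i
  proof -
    have "{x \<in> space \<mu>. x \<le> t} \<in> sets \<mu>" by auto
    then show ?thesis unfolding B1_def using that by (intro sets_Collect_single') auto
  qed
  have dm [measurable]: "(\<lambda>\<delta>. dyadic L (\<delta> i)) \<in> borel_measurable diagonals" if "i < n" for i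
  proof -
    have "(\<lambda>\<delta>. \<delta> i) \<in> diagonals \<rightarrow>\<^sub>M \<mu>" using that by auto
    moreover have "dyadic L \<in> borel_measurable \<mu>" using dyadic_measurable by simp
    ultimately show ?thesis by (rule measurable_compose)
  qed
  have s2: "B2 \<in> sets diagonals" unfolding B2_def by measurable
  have s3: "B3 z \<in> sets diagonals" for z
  proof -
    have "{\<delta> \<in> space diagonals. \<forall>i\<in>{..<n}. c i < \<delta> i} \<in> sets diagonals" for c
      by measurable
    then show ?thesis by (auto simp: B3_def)
  qed
  have "measure diagonals (\<Union>i<n. B1 i) \<le> (\<Sum>i<n. measure diagonals (B1 i))"
    by (rule P.finite_measure_subadditive_finite) (use s1 in auto)
  also have "\<dots> \<le> (\<Sum>i<n. t)"
  proof (rule sum_mono)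
    fix i assume "i \<in> {..<n}"
    then have "measure diagonals (B1 i) \<le> G t" unfolding B1_def using t by (intro prob_coordinate_le) auto
    also have "\<dots> \<le> t" using t by (intro le_id) auto
    finally show "measure diagonals (B1 i) \<le> t" .
  qed
  also have "\<dots> = 1 / 100" using n by (simp add: t_def)
  finally have p1: "measure diagonals (\<Union>i<n. B1 i) \<le> 1 / 100" .
  have p2: "measure diagonals B2 \<le> 1 / 100" unfolding B2_def by (rule weighted_dyadic_markov[OF U r d])
  have "measure diagonals (\<Union>z\<in>Z. B3 z) \<le> (\<Sum>z\<in>Z. measure diagonals (B3 z))"
    by (rule P.finite_measure_subadditive_finite) (use s3 Z in auto)
  also have "\<dots> \<le> (\<Sum>z\<in>Z. exp (- T))"
  proof (rule sum_mono)
    fix z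
    show "measure diagonals (B3 z) \<le> exp (- T)"
      using no_large_coordinate_prob[OF T, of z] unfolding B3_def
      by (cases "0 < orlicz G n z") (simp_all only: if_True if_False measure_empty exp_ge_zero)
  qed
  also have "\<dots> \<le> 1 / 100" using Z by simp
  finally have p3: "measure diagonals (\<Union>z\<in>Z. B3 z) \<le> 1 / 100" .
  define B where "B = (\<Union>i<n. B1 i) \<union> (B2 \<union> (\<Union>z\<in>Z. B3 z))"
  have sU: "(\<Union>i<n. B1 i) \<in> sets diagonals" "(\<Union>z\<in>Z. B3 z) \<in> sets diagonals"
    using s1 s3 Z by auto
  have sB: "B \<in> sets diagonals" unfolding B_def using sU s2 by auto
  have "measure diagonals B \<le> measure diagonals (\<Union>i<n. B1 i) + (measure diagonals B2 + measure diagonals (\<Union>z\<in>Z. B3 z))"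
    unfolding B_def using sU s2
    by (intro order_trans[OF measure_Un_le] add_left_mono) (auto intro: measure_Un_le)
  then have "measure diagonals (space diagonals - B) \<ge> 97 / 100"
    using p1 p2 p3 P.prob_compl[OF sB] by linarith
  moreover have "good_diagonal n d r U L T Z \<delta>"
    if \<delta>: "\<delta> \<in> space diagonals - B" for \<delta>
  proof (intro conjI ballI impI)
    have lower: "t < \<delta> i" if "i < n" for i using \<delta> that by (auto simp: B_def B1_def not_le)
    then show "\<forall>i<n. 1 / (100 * real n) \<le> \<delta> i" by (auto simp: t_def less_imp_le)
    show "dyadic_weight n r U L \<delta> \<le> 100 * real d * (1 + 4 * C * real L)"
      using \<delta> by (auto simp: B_def B2_def)
    fix z assume z: "z \<in> Z" "0 < orlicz G n z"
    then have "\<not> (\<forall>i<n. \<bar>z i\<bar> / (orlicz G n z / (2 * T)) < \<delta> i)"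
      using \<delta> by (auto simp: B_def B3_def)
    then obtain i where i: "i < n" "\<delta> i \<le> \<bar>z i\<bar> / (orlicz G n z / (2 * T))" by (auto simp: not_less)
    have "0 < \<delta> i" using lower[OF i(1)] t by linarith
    moreover have "0 < orlicz G n z / (2 * T)" using z T by simp
    ultimately have "orlicz G n z / (2 * T) \<le> \<bar>z i\<bar> / \<delta> i"
      using i(2) by (simp only: pos_le_divide_eq mult.commute)
    then show "\<exists>i<n. orlicz G n z / (2 * T) \<le> \<bar>z i\<bar> / \<delta> i" using i by blast
  qed
  ultimately show ?thesis using sB by (intro bexI[of _ "space diagonals - B"]) auto
qed

end

end

section \<open>The sketch in coordinates\<close>

lemma sparse_embedding_eq:
  "sparse_embedding n t1 h y = mat t1 n (\<lambda>(r, i). if h i = r then y i else 0)"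
  unfolding sparse_embedding_def
  by (subst mat_diag_mult_right[of _ t1]) (auto intro!: eq_matI)

lemma sketched_carrier:
  assumes "A \<in> carrier_mat n d"
  shows "sketched A n t1 t2 \<omega> \<in> carrier_mat t2 d"
  using assms by (cases \<omega>) (auto simp: sketched_def gaussian_mat_def)

lemma sketched_index:
  assumes A: "A \<in> carrier_mat n d" and r: "r < t2" and j: "j < d"
  shows "sketched A n t1 t2 (\<delta>, y, h, g) $$ (r, j) =
    (\<Sum>k<t1. g (r, k) / sqrt t2 * (\<Sum>i<n. if h i = k then y i * A $$ (i, j) / \<delta> i else 0))"
proof -
  let ?\<Gamma> = "gaussian_mat t1 t2 g" and ?S = "sparse_embedding n t1 h y"
  let ?D = "mat_diag n (\<lambda>i. 1 / \<delta> i)"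
  have c: "?\<Gamma> \<in> carrier_mat t2 t1" "?S \<in> carrier_mat t1 n" "?D \<in> carrier_mat n n"
    by (auto simp: gaussian_mat_def sparse_embedding_eq)
  have DA: "?D * A = mat n d (\<lambda>(i, j). A $$ (i, j) / \<delta> i)"
    by (subst mat_diag_mult_left[OF A]) auto
  have SDA: "(?S * (?D * A)) $$ (k, j) = (\<Sum>i<n. if h i = k then y i * A $$ (i, j) / \<delta> i else 0)"
    if "k < t1" for k
    using that j by (simp add: DA sparse_embedding_eq scalar_prod_def lessThan_atLeast0)
      (intro sum.cong, auto)
  define X where "X = ?S * (?D * A)"
  have X: "X \<in> carrier_mat t1 d"
    unfolding X_def by (rule mult_carrier_mat[OF c(2) mult_carrier_mat[OF c(3) A]])
  have "sketched A n t1 t2 (\<delta>, y, h, g) = ?\<Gamma> * X"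
    unfolding X_def
    using c A by (simp add: sketched_def assoc_mult_mat[OF c(1,2,3)] assoc_mult_mat[OF c(2,3) A]
      assoc_mult_mat[OF c(1) mult_carrier_mat[OF c(2,3)] A])
  also have "\<dots> $$ (r, j) = (\<Sum>k<t1. ?\<Gamma> $$ (r, k) * X $$ (k, j))"
    using r j c X by (simp add: scalar_prod_def lessThan_atLeast0)
  also have "\<dots> = (\<Sum>k<t1. g (r, k) / sqrt t2 * (\<Sum>i<n. if h i = k then y i * A $$ (i, j) / \<delta> i else 0))"
    using r by (intro sum.cong refl) (simp add: gaussian_mat_def X_def SDA)
  finally show ?thesis .
qed

text \<open>Origin of the 40: with T <= 40 n^2 a net coordinate takes at most 200000 n^5 values,
  while exp (-T) is n to the power -40 d. Per dimension the product is 200000 / n^35, tiny already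
  for n = 2.\<close>

lemma net_parameters:
  fixes n d r :: nat and T :: real and m :: nat
  assumes n: "2 \<le> n" and d: "1 \<le> d" "d \<le> n" and r: "r \<le> d"
  defines "T \<equiv> 40 * real d * ln (real n)"
  assumes m: "real m \<le> 2400 * real n ^ 3 * T + 2"
  shows "1 \<le> T" and "(2 * real m + 1) ^ r * exp (- T) \<le> 1 / 100"
proof -
  have ln2: "2 / 3 \<le> ln (real n)"
  proof -
    have "ln 2 \<le> ln (real n)" using n by simp
    then show ?thesis using ln2_ge_two_thirds by linarith
  qed
  have "40 * 1 * (2 / 3) \<le> T" unfolding T_def using d ln2 by (intro mult_mono) auto
  then show T: "1 \<le> T" by simp
  have lnn: "ln (real n) \<le> real n" using ln_le_minus_one[of "real n"] n by simp
  have "T \<le> 40 * real n * real n"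
    unfolding T_def using d lnn ln2 by (intro mult_mono) auto
  then have "2400 * real n ^ 3 * T \<le> 2400 * real n ^ 3 * (40 * real n * real n)"
    by (intro mult_left_mono) auto
  also have "\<dots> = 96000 * real n ^ 5" by (simp add: power_numeral_reduce)
  finally have "real m \<le> 96000 * real n ^ 5 + 2" using m by linarith
  moreover have "1 \<le> real n ^ 5" using n by simp
  ultimately have B: "2 * real m + 1 \<le> 200000 * real n ^ 5" by linarith
  have e: "exp (- T) = (1 / real n ^ 40) ^ d"
  proof -
    have "exp (- T) = exp (- (40 * ln (real n))) ^ d"
      by (simp add: T_def exp_of_nat_mult[symmetric] mult_ac)
    also have "exp (- (40 * ln (real n))) = 1 / exp (real 40 * ln (real n))"
      by (simp add: exp_minus inverse_eq_divide)
    also have "exp (real 40 * ln (real n)) = real n ^ 40"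
      using n by (simp add: exp_of_nat_mult del: of_nat_numeral)
    finally show ?thesis .
  qed
  have "(2 * real m + 1) ^ r \<le> (200000 * real n ^ 5) ^ r" by (intro power_mono B) auto
  also have "\<dots> \<le> (200000 * real n ^ 5) ^ d"
    using r \<open>1 \<le> real n ^ 5\<close> by (intro power_increasing) auto
  finally have "(2 * real m + 1) ^ r * exp (- T) \<le> (200000 * real n ^ 5) ^ d * (1 / real n ^ 40) ^ d"
    unfolding e by (intro mult_right_mono) auto
  also have "\<dots> = (200000 * (1 / real n) ^ 35) ^ d"
  proof -
    have n35: "real n ^ 35 = real n ^ 40 / real n ^ 5" using power_diff[of "real n" 5 40] n by simp
    have "200000 * real n ^ 5 * (1 / real n ^ 40) = 200000 * (1 / real n) ^ 35"
      unfolding power_one_over n35 by simp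
    then show ?thesis by (simp only: power_mult_distrib[symmetric])
  qed
  also have "\<dots> \<le> (200000 * (1 / 2) ^ 35) ^ d"
    using n by (intro power_mono mult_left_mono) (auto simp: field_simps)
  also have "\<dots> \<le> (200000 * (1 / 2) ^ 35) ^ 1"
    using d by (intro power_decreasing) (auto simp: power_one_over)
  also have "\<dots> \<le> 1 / 100" by (simp add: power_one_over)
  finally show "(2 * real m + 1) ^ r * exp (- T) \<le> 1 / 100" .
qed

text \<open>L is log2 (100 n) rounded up, at most 8 + 3/2 ln n; since ln n is at least 2/3, the
  additive 8 is absorbed into 14 ln n.\<close>

lemma dyadic_levels:
  assumes n: "2 \<le> (n :: nat)"
  shows "\<exists>L :: nat. (1 / 2) ^ L \<le> 1 / (100 * real n) \<and> real L \<le> 14 * ln (real n)"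
proof -
  define L where "L = nat \<lceil>log 2 (100 * real n)\<rceil>"
  have ln2: "2 / 3 \<le> ln (2 :: real)" by (rule ln2_ge_two_thirds)
  have lnn: "ln 2 \<le> ln (real n)" using n by simp
  have "log 2 (100 * real n) \<le> real L" unfolding L_def by linarith
  then have "2 powr (log 2 (100 * real n)) \<le> 2 powr real L" by simp
  then have "100 * real n \<le> 2 ^ L" using n by (simp add: powr_realpow)
  then have "1 / 2 ^ L \<le> 1 / (100 * real n)" using n by (intro divide_left_mono) auto
  then have 1: "(1 / 2) ^ L \<le> 1 / (100 * real n)" by (simp add: power_one_over)
  have "ln (100 :: real) \<le> ln (2 ^ 7)" by simp
  also have "\<dots> = 7 * ln 2" by (simp only: ln_realpow)
  finally have "ln (100 * real n) \<le> 7 * ln 2 + ln (real n)" using n by (simp add: ln_mult)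
  then have "log 2 (100 * real n) \<le> 7 + ln (real n) / ln 2"
    unfolding log_def using ln2 by (simp add: divide_simps algebra_simps)
  also have "ln (real n) / ln 2 \<le> ln (real n) / (2 / 3)"
    using lnn ln2 by (intro divide_left_mono) auto
  finally have "log 2 (100 * real n) \<le> 7 + 3 / 2 * ln (real n)" by simp
  moreover have "0 \<le> log 2 (100 * real n)" using n by simp
  ultimately have "real L \<le> 8 + 3 / 2 * ln (real n)" unfolding L_def by linarith
  then have "real L \<le> 14 * ln (real n)" using lnn ln2 by linarith
  then show ?thesis using 1 by blast
qed

context orlicz_function
begin

text \<open>The lower bound is a net argument. On the event that every entry of the diagonal is at least
  \<open>1 / (100 * n)\<close>, the mesh \<open>\<epsilon>\<close> is fine enough for rounding to cost at most \<open>1 / (8 * T)\<close>, half of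
  what the net points guarantee; the net still has at most \<open>exp T / 100\<close> points.\<close>

lemma diagonal_embedding_event:
  fixes n d r :: nat and q :: "nat \<Rightarrow> nat \<Rightarrow> real"
  assumes \<mu>: "real_distribution \<mu>" and cdf: "\<forall>t\<ge>0. cdf \<mu> t = 1 - exp (- G t)"
    and n: "2 \<le> n" and d: "1 \<le> d" "d \<le> n" and r: "r \<le> d" and q: "orthonormal_family n r q"
  shows "\<exists>E\<in>sets (diagonals \<mu> n). measure (diagonals \<mu> n) E \<ge> 97 / 100 \<and> (\<forall>\<delta>\<in>E. sandwiched (1 / (320 * real d * ln (real n))) (17500 * C * real d * ln (real n))
      (\<lambda>c. orlicz G n (lincomb r c q)) (\<lambda>c. L2_set (\<lambda>i. lincomb r c q i / \<delta> i) {..<n}))"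
proof -
  obtain U where U: "\<And>j. j < r \<Longrightarrow> (\<Sum>i<n. G \<bar>U j i\<bar>) \<le> 1"
    and coords: "\<And>c. \<exists>y. (\<forall>j<r. \<bar>y j\<bar> \<le> 3 * orlicz G n (lincomb r c q)) \<and>
         (\<forall>i<n. (lincomb r c q i) = lincomb r y U i)"
    using orlicz_auerbach_basis[OF q] by blast
  define N where "N = orlicz G n"
  have N: "seminorm N" unfolding N_def by (rule seminorm_orlicz)
  have NU: "N (U j) \<le> 1" if "j < r" for j
    unfolding N_def by (rule orlicz_le) (simp add: feasible_def U that)
  define T where "T = 40 * real d * ln (real n)"
  \<comment> \<open>Chosen so that 100 n^2 times n \<epsilon> equals 1 / (8 T): n \<epsilon> bounds
    the Orlicz norm of the rounding error, and dividing n coordinates by entries that are at least 1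
    / (100 n) costs the factor 100 n^2.\<close>
  define \<epsilon> where "\<epsilon> = 1 / (800 * real n ^ 3 * T)"
  \<comment> \<open>A vector of norm 1 has coordinates at most 3, that is 3 / \<epsilon> mesh units;
    the added 1 is slack.\<close>
  define m where "m = nat (\<lceil>3 / \<epsilon>\<rceil> + 1)"
  have T: "1 \<le> T" unfolding T_def by (rule net_parameters(1)[OF n d r, of 0]) (use n d in auto)
  have \<epsilon>: "0 < \<epsilon>" using n T by (simp add: \<epsilon>_def)
  have e3: "3 / \<epsilon> = 2400 * real n ^ 3 * T" by (simp add: \<epsilon>_def)
  have "0 < 3 / \<epsilon>" using \<epsilon> by simp
  then have "0 \<le> \<lceil>3 / \<epsilon>\<rceil>" by linarith
  then have "real m = real_of_int \<lceil>3 / \<epsilon>\<rceil> + 1" by (simp add: m_def)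
  then have m: "real m \<le> 2400 * real n ^ 3 * T + 2"
    using of_int_ceiling_le_add_one[of "3 / \<epsilon>"] unfolding e3 by linarith
  define Z where "Z = (\<lambda>k :: nat \<Rightarrow> int. \<lambda>i. \<Sum>j<r. (\<epsilon> * of_int (k j)) * U j i) ` PiE {..<r} (\<lambda>_. {- int m..int m})"
  have finZ: "finite Z" unfolding Z_def by (intro finite_imageI finite_PiE) auto
  have "card Z \<le> card (PiE {..<r} (\<lambda>_. {- int m..int m}))"
    unfolding Z_def by (intro card_image_le finite_PiE) auto
  also have "\<dots> = (2 * m + 1) ^ r" by (simp add: card_PiE nat_add_distrib nat_mult_distrib)
  finally have "real (card Z) \<le> real ((2 * m + 1) ^ r)" by (rule of_nat_mono)
  also have "\<dots> = (2 * real m + 1) ^ r" by (simp add: add.commute)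
  finally have "real (card Z) * exp (- T) \<le> (2 * real m + 1) ^ r * exp (- T)"
    by (intro mult_right_mono) auto
  also have "\<dots> \<le> 1 / 100"
    using net_parameters(2)[OF n d r, of m] m unfolding T_def by simp
  finally have cardZ: "real (card Z) * exp (- T) \<le> 1 / 100" .
  obtain L :: nat where L: "(1 / 2) ^ L \<le> 1 / (100 * real n)" "real L \<le> 14 * ln (real n)"
    using dyadic_levels[OF n] by blast
  have "\<exists>E\<in>sets (diagonals \<mu> n). measure (diagonals \<mu> n) E \<ge> 97 / 100 \<and> (\<forall>\<delta>\<in>E. good_diagonal n d r U L T Z \<delta>)"
    by (rule diagonal_event[OF \<mu> cdf[rule_format] n U r d(1) T finZ cardZ])
  then obtain E where E: "E \<in> sets (diagonals \<mu> n)" "measure (diagonals \<mu> n) E \<ge> 97 / 100"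
    and good: "\<forall>\<delta>\<in>E. good_diagonal n d r U L T Z \<delta>"
    by (elim bexE conjE) (rule that)
  have large: "1 / (100 * real n) \<le> \<delta> i" if "\<delta> \<in> E" "i < n" for \<delta> i
    using good that by simp
  have weights: "dyadic_weight n r U L \<delta> \<le> 100 * real d * (1 + 4 * C * real L)"
    if "\<delta> \<in> E" for \<delta>
    using good that by simp
  have net: "\<exists>i<n. N z / (2 * T) \<le> \<bar>z i\<bar> / \<delta> i" if "\<delta> \<in> E" "z \<in> Z" "0 < N z" for \<delta> z
    using good[rule_format, OF that(1)] that by (simp add: N_def)
  have "1 / (320 * real d * ln (real n)) * N (lincomb r c q)
        \<le> L2_set (\<lambda>i. lincomb r c q i / \<delta> i) {..<n}
     \<and> L2_set (\<lambda>i. lincomb r c q i / \<delta> i) {..<n}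
        \<le> 17500 * C * real d * ln (real n) * N (lincomb r c q)"
    if \<delta>: "\<delta> \<in> E" for \<delta> c
  proof -
    have \<delta>0: "0 < \<delta> i" if "i < n" for i
    proof -
      have "0 < 1 / (100 * real n)" using n by simp
      then show ?thesis using large[OF \<delta> that] by linarith
    qed
    define S where "S = (\<lambda>z. L2_set (\<lambda>i. z i / \<delta> i) {..<n})"
    have S: "seminorm S"
      unfolding S_def by (rule seminorm_comp[OF seminorm_L2]) (auto simp: add_divide_distrib)
    obtain y where y: "\<And>j. j < r \<Longrightarrow> \<bar>y j\<bar> \<le> 3 * N (lincomb r c q)"
      and yU: "\<And>i. i < n \<Longrightarrow> (lincomb r c q i) = lincomb r y U i"
      using coords[of c] unfolding N_def by blast
    define z where "z = (lincomb r y U)"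
    have Nz: "N (lincomb r c q) = N z"
      unfolding N_def by (rule orlicz_cong) (simp add: yU z_def)
    have Sz: "L2_set (\<lambda>i. lincomb r c q i / \<delta> i) {..<n} = S z"
      unfolding S_def by (rule L2_set_cong) (auto simp: yU z_def)
    have y': "\<bar>y j\<bar> \<le> 3 * N z" if "j < r" for j using y[OF that] by (simp add: Nz)
    have lnn: "2 / 3 \<le> ln (real n)"
    proof -
      have "ln 2 \<le> ln (real n)" using n by simp
      then show ?thesis using ln2_ge_two_thirds by linarith
    qed
    have C0: "0 \<le> C" using C_ge_1 by simp
    have Nz0: "0 \<le> N z" by (rule seminorm_nonneg[OF N])
    have lower: "1 / (8 * T) * N z \<le> S z"
    proof (cases "N z = 0")
      case True
      then show ?thesis using seminorm_nonneg[OF S, of z] by simp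
    next
      case False
      then have Np: "0 < N z" using Nz0 by simp
      define k where "k = (\<lambda>j\<in>{..<r}. \<lfloor>y j / N z / \<epsilon>\<rfloor>)"
      have k: "\<bar>y j / N z - \<epsilon> * of_int (k j)\<bar> \<le> \<epsilon>" "k j \<in> {- int m..int m}" if j: "j < r" for j
      proof -
        let ?x = "y j / N z / \<epsilon>"
        have kj: "k j = \<lfloor>?x\<rfloor>" using j by (simp add: k_def)
        have e: "y j / N z = \<epsilon> * ?x" using \<epsilon> by simp
        have "0 \<le> ?x - of_int (k j)" "?x - of_int (k j) \<le> 1" unfolding kj by linarith+
        then have "\<bar>\<epsilon> * (?x - of_int (k j))\<bar> \<le> \<epsilon> * 1"
          using \<epsilon> unfolding abs_mult by (intro mult_mono) auto
        then show "\<bar>y j / N z - \<epsilon> * of_int (k j)\<bar> \<le> \<epsilon>" unfolding right_diff_distrib e[symmetric] by simp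
        have "\<bar>?x\<bar> \<le> 3 / \<epsilon>"
          using y'[OF j] Np \<epsilon> by (simp add: abs_divide divide_right_mono pos_divide_le_eq)
        then have "- (3 / \<epsilon>) \<le> ?x" "?x \<le> 3 / \<epsilon>" by linarith+
        then show "k j \<in> {- int m..int m}" unfolding kj m_def by simp linarith
      qed
      define w where "w = (\<lambda>i. \<Sum>j<r. (\<epsilon> * of_int (k j)) * U j i)"
      define u where "u = (\<lambda>i. 1 / N z * z i)"
      have wZ: "w \<in> Z" unfolding w_def Z_def using k(2) by (intro imageI PiE_I) (auto simp: k_def)
      have uw: "u i - w i = (\<Sum>j<r. (y j / N z - \<epsilon> * of_int (k j)) * U j i)" for i
        by (simp add: u_def w_def z_def left_diff_distrib sum_subtractf sum_distrib_left)
      have "N (\<lambda>i. u i - w i) \<le> (\<Sum>j<r. \<bar>y j / N z - \<epsilon> * of_int (k j)\<bar> * N (U j))"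
        unfolding uw by (rule seminorm_sum[OF N])
      also have "\<dots> \<le> (\<Sum>j<r. \<epsilon> * 1)"
        by (intro sum_mono mult_mono k NU seminorm_nonneg[OF N]) (use \<epsilon> in auto)
      also have "\<dots> = real r * \<epsilon>" by simp
      also have "\<dots> \<le> real n * \<epsilon>" using r d \<epsilon> by (intro mult_right_mono) auto
      finally have Nuw: "N (\<lambda>i. u i - w i) \<le> real n * \<epsilon>" .
      have n\<epsilon>: "100 * real n ^ 2 * (real n * \<epsilon>) = 1 / (8 * T)"
        using n T by (simp add: \<epsilon>_def power_numeral_reduce field_simps)
      have "real n * \<epsilon> \<le> 1 / 2"
      proof -
        have "1 * (real n * \<epsilon>) \<le> 100 * real n ^ 2 * (real n * \<epsilon>)"
        proof (rule mult_right_mono)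
          have "1 \<le> real n ^ 2" using n by simp
          then show "1 \<le> 100 * real n ^ 2" by linarith
        qed (use \<epsilon> in simp)
        also have "\<dots> \<le> 1 / 8" unfolding n\<epsilon> using T by (intro divide_left_mono) auto
        finally show ?thesis by simp
      qed
      moreover have "N u = 1" unfolding u_def using Np by (subst seminorm_scale[OF N]) simp
      moreover have "N u \<le> N w + N (\<lambda>i. u i - w i)" by (rule seminorm_triangle[OF N])
      ultimately have Nw: "1 / 2 \<le> N w" using Nuw by linarith
      then obtain i where i: "i < n" "N w / (2 * T) \<le> \<bar>w i\<bar> / \<delta> i" using net[OF \<delta> wZ] by auto
      have "1 / (4 * T) = (1 / 2) / (2 * T)" by simp
      also have "\<dots> \<le> N w / (2 * T)" using Nw T by (intro divide_right_mono) auto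
      also have "\<dots> \<le> \<bar>w i / \<delta> i\<bar>" using i \<delta>0[of i] by (simp add: abs_divide)
      also have "\<dots> \<le> S w"
        unfolding S_def using i by (intro abs_le_L2_set) auto
      finally have Sw: "1 / (4 * T) \<le> S w" .
      \<comment> \<open>Only crude bounds are used: each coordinate is at most the Orlicz norm, and
        the Euclidean norm at most the absolute sum. The fine mesh pays for this.\<close>
      have "S (\<lambda>i. u i - w i) \<le> (\<Sum>i<n. \<bar>(u i - w i) / \<delta> i\<bar>)"
        unfolding S_def by (rule L2_set_le_sum_abs)
      also have "\<dots> \<le> (\<Sum>i<n. (real n * \<epsilon>) * (100 * real n))"
      proof (rule sum_mono)
        fix i assume i: "i \<in> {..<n}"
        have "\<bar>u i - w i\<bar> \<le> real n * \<epsilon>"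
          using abs_le_orlicz[of i n "\<lambda>i. u i - w i"] Nuw i unfolding N_def by simp
        moreover have "1 / \<delta> i \<le> 100 * real n"
          using large[OF \<delta>, of i] \<delta>0[of i] i n by (simp add: field_simps)
        moreover have "\<bar>(u i - w i) / \<delta> i\<bar> = \<bar>u i - w i\<bar> * (1 / \<delta> i)"
          using \<delta>0[of i] i by (simp add: abs_divide)
        ultimately show "\<bar>(u i - w i) / \<delta> i\<bar> \<le> (real n * \<epsilon>) * (100 * real n)"
          using \<delta>0[of i] i \<epsilon> by (simp only:) (intro mult_mono, auto)
      qed
      also have "\<dots> = 100 * real n ^ 2 * (real n * \<epsilon>)" by (simp add: power2_eq_square)
      finally have Suw: "S (\<lambda>i. u i - w i) \<le> 1 / (8 * T)" unfolding n\<epsilon> .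
      have "S w - S (\<lambda>i. u i - w i) \<le> S u"
        using seminorm_triangle[OF S, of w u] seminorm_minus[OF S, of w u] by linarith
      moreover have "1 / (4 * T) - 1 / (8 * T) = 1 / (8 * T)" by (simp add: field_simps)
      ultimately have "1 / (8 * T) \<le> S u" using Sw Suw by linarith
      also have "S u = S z / N z" unfolding u_def using Np by (subst seminorm_scale[OF S]) simp
      finally show ?thesis using Np by (simp add: pos_le_divide_eq)
    qed
    have SU: "S (U j) \<le> (\<Sum>i<n. G \<bar>U j i\<bar> * dyadic L (\<delta> i)) + C" if "j < r" for j
    proof -
      have "S (U j) \<le> (\<Sum>i<n. G \<bar>U j i\<bar> / G (\<delta> i)) + C"
        unfolding S_def by (rule L2_ratio_le) (rule \<delta>0)
      also have "(\<Sum>i<n. G \<bar>U j i\<bar> / G (\<delta> i)) \<le> (\<Sum>i<n. G \<bar>U j i\<bar> * dyadic L (\<delta> i))"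
      proof (rule sum_mono)
        fix i assume "i \<in> {..<n}"
        then have "1 / G (\<delta> i) \<le> dyadic L (\<delta> i)"
          using L(1) large[OF \<delta>, of i] by (intro inverse_le_dyadic) auto
        from mult_left_mono[OF this nonneg[of "\<bar>U j i\<bar>"]]
        show "G \<bar>U j i\<bar> / G (\<delta> i) \<le> G \<bar>U j i\<bar> * dyadic L (\<delta> i)" by simp
      qed
      finally show ?thesis by simp
    qed
    have "S z \<le> (\<Sum>j<r. \<bar>y j\<bar> * S (U j))" unfolding z_def by (rule seminorm_sum[OF S])
    also have "\<dots> \<le> (\<Sum>j<r. 3 * N z * S (U j))"
      by (intro sum_mono mult_right_mono seminorm_nonneg[OF S]) (use y' in auto)
    also have "\<dots> = 3 * N z * (\<Sum>j<r. S (U j))" by (simp add: sum_distrib_left)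
    also have "\<dots> \<le> 3 * N z * (5805 * C * real d * ln (real n))"
    proof (rule mult_left_mono)
      have "(\<Sum>j<r. S (U j)) \<le> (\<Sum>j<r. (\<Sum>i<n. G \<bar>U j i\<bar> * dyadic L (\<delta> i)) + C)"
        by (intro sum_mono SU) simp
      also have "\<dots> = dyadic_weight n r U L \<delta> + real r * C"
        by (simp add: sum.distrib)
      also have "\<dots> \<le> 100 * real d * (1 + 4 * C * real L) + real d * C"
        using weights[OF \<delta>] r C0 by (intro add_mono mult_right_mono) auto
      also have "\<dots> = real d * (100 * (1 + 4 * C * real L) + C)" by (simp add: algebra_simps)
      \<comment> \<open>Using C >= 1 and ln n >= 2/3, the terms 100, 400 C L and C are at most 150,
        5600 and 3/2 times C ln n.\<close>
      also have "\<dots> \<le> real d * (5805 * C * ln (real n))"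
      proof (rule mult_left_mono)
        have "C * real L \<le> 14 * (C * ln (real n))"
          using mult_left_mono[OF L(2) C0] by (simp only: mult.left_commute)
        moreover have "2 / 3 * C \<le> C * ln (real n)"
          using mult_left_mono[OF lnn C0] by (simp only: mult.commute)
        ultimately have "100 + 400 * (C * real L) + C \<le> 5805 * (C * ln (real n))"
          using C_ge_1 by linarith
        then show "100 * (1 + 4 * C * real L) + C \<le> 5805 * C * ln (real n)"
          by (simp add: algebra_simps)
      qed simp
      finally show "(\<Sum>j<r. S (U j)) \<le> 5805 * C * real d * ln (real n)" by (simp add: mult_ac)
    qed (use Nz0 in simp)
    also have "\<dots> = 17415 * (C * real d * ln (real n) * N z)" by (simp add: mult_ac)
    also have "\<dots> \<le> 17500 * (C * real d * ln (real n) * N z)"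
      using C0 lnn Nz0 by (intro mult_right_mono) auto
    finally have upper: "S z \<le> 17500 * C * real d * ln (real n) * N z" by (simp add: mult_ac)
    have "8 * T = 320 * real d * ln (real n)" by (simp add: T_def)
    then show ?thesis using lower upper unfolding Nz Sz by simp
  qed
  then show ?thesis using E unfolding N_def by blast
qed

end

section \<open>Combining the three embeddings\<close>

text \<open>Fubini: the good set of the second factor may be chosen anew for each x in
  \<open>E\<close>, with no measurable dependence on x; just \<open>S\<close> has to be
  measurable.\<close>

lemma measure_pair_ge:
  assumes M: "prob_space M" and N: "prob_space N" and S: "S \<in> sets (M \<Otimes>\<^sub>M N)"
    and E: "E \<in> sets M" "p \<le> measure M E" and sec: "\<And>x. x \<in> E \<Longrightarrow> e \<le> measure N (Pair x -` S)"
    and e: "0 \<le> e"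
  shows "p * e \<le> measure (M \<Otimes>\<^sub>M N) S"
proof -
  interpret M: prob_space M by fact
  interpret N: prob_space N by fact
  interpret P: prob_space "M \<Otimes>\<^sub>M N" by (rule prob_space_pair[OF M N])
  have "ennreal e * emeasure M E = (\<integral>\<^sup>+x. ennreal e * indicator E x \<partial>M)"
    by (rule nn_integral_cmult_indicator[symmetric]) (rule E)
  also have "\<dots> \<le> (\<integral>\<^sup>+x. emeasure N (Pair x -` S) \<partial>M)"
  proof (rule nn_integral_mono)
    fix x
    show "ennreal e * indicator E x \<le> emeasure N (Pair x -` S)"
      using sec[of x] by (cases "x \<in> E") (auto simp: N.emeasure_eq_measure)
  qed
  also have "\<dots> = emeasure (M \<Otimes>\<^sub>M N) S" by (rule N.emeasure_pair_measure_alt[OF S, symmetric])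
  finally have "e * measure M E \<le> measure (M \<Otimes>\<^sub>M N) S"
    using e by (simp add: M.emeasure_eq_measure P.emeasure_eq_measure ennreal_mult[symmetric])
  moreover have "e * p \<le> e * measure M E" using E e by (intro mult_left_mono) auto
  ultimately show ?thesis by (simp add: mult.commute)
qed

text \<open>Written with projections and a separate 0/1 factor, so that measurability in \<omega>
  follows factor by factor.\<close>

definition sketch_entry :: "real mat \<Rightarrow> nat \<Rightarrow> nat \<Rightarrow> nat \<Rightarrow> sample \<Rightarrow> nat \<Rightarrow> nat \<Rightarrow> real" where
  "sketch_entry A n t1 t2 \<omega> \<rho> j = (\<Sum>k<t1. snd (snd (snd \<omega>)) (\<rho>, k) / sqrt t2 *
     (\<Sum>i<n. (if fst (snd (snd \<omega>)) i = k then 1 else 0) * (fst (snd \<omega>) i * A $$ (i, j) / fst \<omega> i)))"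

lemma sketched_eq_entry:
  assumes "A \<in> carrier_mat n d" "\<rho> < t2" "j < d"
  shows "sketched A n t1 t2 \<omega> $$ (\<rho>, j) = sketch_entry A n t1 t2 \<omega> \<rho> j"
proof -
  obtain \<delta> y h g where \<omega>: "\<omega> = (\<delta>, y, h, g)" by (cases \<omega>) auto
  show ?thesis unfolding \<omega> sketched_index[OF assms] sketch_entry_def
    by (intro sum.cong refl arg_cong2[where f = "(*)"]) auto
qed

lemma l2_norm_sketched:
  assumes A: "A \<in> carrier_mat n d" and x: "x \<in> carrier_vec d"
  shows "l2_norm (sketched A n t1 t2 \<omega> *\<^sub>v x) = L2_set (\<lambda>\<rho>. \<Sum>j<d. x $ j * sketch_entry A n t1 t2 \<omega> \<rho> j) {..<t2}"
proof -
  have B: "sketched A n t1 t2 \<omega> \<in> carrier_mat t2 d" by (rule sketched_carrier[OF A])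
  have *: "(sketched A n t1 t2 \<omega> *\<^sub>v x) $ \<rho> = (\<Sum>j<d. x $ j * sketch_entry A n t1 t2 \<omega> \<rho> j)" if "\<rho> < t2" for \<rho>
    using that B x by (simp add: scalar_prod_def lessThan_atLeast0 sketched_eq_entry[OF A] mult.commute)
  have dim: "dim_vec (sketched A n t1 t2 \<omega> *\<^sub>v x) = t2" using B by simp
  show ?thesis unfolding l2_norm_def dim by (rule L2_set_cong[OF refl]) (rule *, simp)
qed

lemma orlicz_norm_mult_mat_vec:
  assumes A: "A \<in> carrier_mat n d" and x: "x \<in> carrier_vec d"
  shows "orlicz_norm G (A *\<^sub>v x) = orlicz G n (\<lambda>i. \<Sum>j<d. x $ j * A $$ (i, j))"
proof -
  have "(A *\<^sub>v x) $ i = (\<Sum>j<d. x $ j * A $$ (i, j))" if "i < n" for i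
    using that A x by (simp add: scalar_prod_def lessThan_atLeast0 mult.commute)
  then show ?thesis using A by (simp add: orlicz_norm_eq orlicz_def)
qed

lemma measurable_sketch_entry:
  assumes \<mu>: "sets \<mu> = sets borel" and \<rho>: "\<rho> < t2"
  shows "(\<lambda>\<omega>. sketch_entry A n t1 t2 \<omega> \<rho> j) \<in> borel_measurable (sample_measure \<mu> n t1 t2)"
proof -
  let ?M = "sample_measure \<mu> n t1 t2"
  let ?Y = "uniform_count_measure {- 1, 1 :: real}" and ?H = "uniform_count_measure {..<t1}"
  have \<delta>: "(\<lambda>\<omega>. fst \<omega> i) \<in> borel_measurable ?M" if "i < n" for i
  proof -
    have "(\<lambda>\<omega>. fst \<omega> i) \<in> ?M \<rightarrow>\<^sub>M \<mu>"
      unfolding sample_measure_def using that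
      by (intro measurable_compose[OF measurable_fst] measurable_component_singleton) simp
    then show ?thesis by (simp add: measurable_cong_sets[OF refl \<mu>])
  qed
  have y: "(\<lambda>\<omega>. fst (snd \<omega>) i) \<in> borel_measurable ?M" if "i < n" for i
  proof -
    have "(\<lambda>\<omega>. fst (snd \<omega>) i) \<in> ?M \<rightarrow>\<^sub>M ?Y"
      unfolding sample_measure_def using that
      by (intro measurable_compose[OF measurable_snd] measurable_compose[OF measurable_fst] measurable_component_singleton) simp
    moreover have "(\<lambda>x. x) \<in> ?Y \<rightarrow>\<^sub>M borel"
      by (auto simp: measurable_def sets_uniform_count_measure space_uniform_count_measure)
    ultimately show ?thesis by (rule measurable_compose)
  qed
  have h: "(\<lambda>\<omega>. if fst (snd (snd \<omega>)) i = k then 1 else 0 :: real) \<in> borel_measurable ?M" if "i < n" for i k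
  proof -
    have "(\<lambda>\<omega>. fst (snd (snd \<omega>)) i) \<in> ?M \<rightarrow>\<^sub>M ?H"
      unfolding sample_measure_def using that
      by (intro measurable_compose[OF measurable_snd] measurable_compose[OF measurable_fst] measurable_component_singleton) simp
    moreover have "(\<lambda>x. if x = k then 1 else 0 :: real) \<in> ?H \<rightarrow>\<^sub>M borel"
      by (auto simp: measurable_def sets_uniform_count_measure space_uniform_count_measure)
    ultimately show ?thesis by (rule measurable_compose)
  qed
  have g: "(\<lambda>\<omega>. snd (snd (snd \<omega>)) (\<rho>, k)) \<in> borel_measurable ?M" if "k < t1" for k
  proof -
    have "(\<lambda>\<omega>. snd (snd (snd \<omega>)) (\<rho>, k)) \<in> ?M \<rightarrow>\<^sub>M std_normal_measure"
      unfolding sample_measure_def using that \<rho>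
      by (intro measurable_compose[OF measurable_snd] measurable_component_singleton) simp
    then show ?thesis by simp
  qed
  show ?thesis
    unfolding sketch_entry_def
    by (intro borel_measurable_sum borel_measurable_times borel_measurable_divide borel_measurable_const \<delta> y h g) auto
qed

context orlicz_function
begin

text \<open>The event is an uncountable intersection over x; as both sides are seminorms in the d
  coordinates of x, rational vectors suffice and the intersection becomes countable.\<close>

lemma sketch_event_measurable:
  assumes \<mu>: "sets \<mu> = sets borel" and A: "A \<in> carrier_mat n d" and b: "0 \<le> b" "0 \<le> b'"
  shows "{\<omega> \<in> space (sample_measure \<mu> n t1 t2). \<forall>x \<in> carrier_vec d.
     b * orlicz_norm G (A *\<^sub>v x) \<le> l2_norm (sketched A n t1 t2 \<omega> *\<^sub>v x) \<and>
     l2_norm (sketched A n t1 t2 \<omega> *\<^sub>v x) \<le> b' * orlicz_norm G (A *\<^sub>v x)} \<in> sets (sample_measure \<mu> n t1 t2)"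
proof -
  let ?b = "\<lambda>x \<omega>. b * orlicz_norm G (A *\<^sub>v x) \<le> l2_norm (sketched A n t1 t2 \<omega> *\<^sub>v x) \<and>
     l2_norm (sketched A n t1 t2 \<omega> *\<^sub>v x) \<le> b' * orlicz_norm G (A *\<^sub>v x)"
  let ?M = "sample_measure \<mu> n t1 t2"
  define N where "N = (\<lambda>x. orlicz G n (\<lambda>i. \<Sum>j<d. x j * A $$ (i, j)))"
  define F where "F = (\<lambda>\<omega> x. L2_set (\<lambda>\<rho>. \<Sum>j<d. x j * sketch_entry A n t1 t2 \<omega> \<rho> j) {..<t2})"
  have N: "seminorm N"
    unfolding N_def by (rule seminorm_linear_comb[OF seminorm_orlicz])
  have F: "seminorm (F \<omega>)" for \<omega>
    unfolding F_def by (rule seminorm_linear_comb[OF seminorm_L2])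
  have scaled: "seminorm (\<lambda>x. s * N x)" if "0 \<le> s" for s
    using N that unfolding seminorm_def
    by (auto simp: distrib_left[symmetric] intro: mult_left_mono)
  have localN: "N u = N v" if "\<And>i. i < d \<Longrightarrow> u i = v i" for u v using that by (simp add: N_def)
  have localF: "F \<omega> u = F \<omega> v" if "\<And>i. i < d \<Longrightarrow> u i = v i" for u v \<omega> using that by (simp add: F_def)
  \<comment> \<open>Extensionality outside \<open>{..<d}\<close> matters: the rational functions on
    all of \<open>nat\<close> are uncountable.\<close>
  define R where "R = PiE {..<d} (\<lambda>_. \<rat> :: real set)"
  have R: "countable R" unfolding R_def by (intro countable_PiE) (auto simp: countable_rat)
  have iff: "(\<forall>x \<in> carrier_vec d. ?b x \<omega>)
     \<longleftrightarrow> (\<forall>x\<in>R. b * N x \<le> F \<omega> x \<and> F \<omega> x \<le> b' * N x)" for \<omega>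
  proof -
    have vec: "orlicz_norm G (A *\<^sub>v x) = N (\<lambda>j. x $ j)" "l2_norm (sketched A n t1 t2 \<omega> *\<^sub>v x) = F \<omega> (\<lambda>j. x $ j)"
      if "x \<in> carrier_vec d" for x
      using that by (simp_all add: N_def F_def orlicz_norm_mult_mat_vec[OF A] l2_norm_sketched[OF A])
    have "(\<forall>x \<in> carrier_vec d. ?b x \<omega>)
       \<longleftrightarrow> (\<forall>x. b * N x \<le> F \<omega> x \<and> F \<omega> x \<le> b' * N x)"
    proof safe
      fix x :: "nat \<Rightarrow> real"
      assume H: "\<forall>x \<in> carrier_vec d. ?b x \<omega>"
      have c: "vec d x \<in> carrier_vec d" by simp
      have e: "N (\<lambda>j. vec d x $ j) = N x" "F \<omega> (\<lambda>j. vec d x $ j) = F \<omega> x"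
        by (auto intro!: localN localF)
      show "b * N x \<le> F \<omega> x" "F \<omega> x \<le> b' * N x"
        using H[rule_format, OF c] unfolding vec[OF c] e by auto
    qed (auto simp: vec)
    also have "\<dots> \<longleftrightarrow> (\<forall>x\<in>R. b * N x \<le> F \<omega> x \<and> F \<omega> x \<le> b' * N x)"
    proof safe
      fix x :: "nat \<Rightarrow> real" assume H: "\<forall>x\<in>R. b * N x \<le> F \<omega> x \<and> F \<omega> x \<le> b' * N x"
      have rat: "b * N x \<le> F \<omega> x \<and> F \<omega> x \<le> b' * N x" if "\<And>i. x i \<in> \<rat>" for x
      proof -
        have "restrict x {..<d} \<in> R" using that by (simp add: R_def)
        moreover have "N (restrict x {..<d}) = N x" "F \<omega> (restrict x {..<d}) = F \<omega> x"
          by (auto intro!: localN localF)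
        ultimately show ?thesis using H by auto
      qed
      have lb: "b * N u = b * N v" if "\<And>i. i < d \<Longrightarrow> u i = v i" for u v using localN[of u v] that by simp
      have lb': "b' * N u = b' * N v" if "\<And>i. i < d \<Longrightarrow> u i = v i" for u v using localN[of u v] that by simp
      show "b * N x \<le> F \<omega> x"
        by (rule seminorm_le_of_rational[OF scaled[OF b(1)] F, of d, OF lb localF]) (use rat in auto)
      show "F \<omega> x \<le> b' * N x"
        by (rule seminorm_le_of_rational[OF F scaled[OF b(2)], of d, OF localF lb']) (use rat in auto)
    qed auto
    finally show ?thesis .
  qed
  have mF: "(\<lambda>\<omega>. F \<omega> x) \<in> borel_measurable ?M" for x
  proof -
    note [measurable] = measurable_sketch_entry[OF \<mu>]
    show ?thesis unfolding F_def L2_set_def by measurable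
  qed
  have "{\<omega> \<in> space ?M. \<forall>x\<in>R. b * N x \<le> F \<omega> x \<and> F \<omega> x \<le> b' * N x} \<in> sets ?M"
    unfolding pred_def[symmetric]
  proof (rule measurable_pred_countable(1)[OF R])
    fix x
    note [measurable] = mF[of x]
    show "Measurable.pred ?M (\<lambda>\<omega>. b * N x \<le> F \<omega> x \<and> F \<omega> x \<le> b' * N x)" by measurable
  qed
  then show ?thesis unfolding iff .
qed

end

lemma hash_sum_cong:
  "(\<And>i. i < n \<Longrightarrow> u i = v i) \<Longrightarrow> hash_sum n y h u \<kappa> = hash_sum n y h v \<kappa>"
  unfolding hash_sum_def by (intro sum.cong) auto

lemma hash_sum_lincomb:
  "hash_sum n y h (lincomb d x b) \<kappa> = (\<Sum>j<d. x j * hash_sum n y h (b j) \<kappa>)"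
proof -
  have "hash_sum n y h (lincomb d x b) \<kappa>
      = (\<Sum>i<n. \<Sum>j<d. x j * (if h i = \<kappa> then y i * b j i else 0))"
    unfolding hash_sum_def by (intro sum.cong refl) (auto simp: sum_distrib_left mult_ac)
  also have "\<dots> = (\<Sum>j<d. \<Sum>i<n. x j * (if h i = \<kappa> then y i * b j i else 0))" by (rule sum.swap)
  finally show ?thesis by (simp add: hash_sum_def sum_distrib_left)
qed

text \<open>By linearity of each stage, the norm of the sketch becomes diagonal, hashing and
  Gaussian rows applied in turn, the form to which the three embeddings apply.\<close>

lemma sketch_entry_lincomb:
  "L2_set (\<lambda>\<rho>. \<Sum>j<d. x j * sketch_entry A n t1 t2 (\<delta>, y, h, g) \<rho> j) {..<t2}
     = 1 / sqrt (real t2) * L2_set (row_sum t1 (hash_sum n y h (\<lambda>i. \<Sum>j<d. x j * (A $$ (i, j) / \<delta> i))) g) {..<t2}"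
proof -
  have *: "(\<Sum>j<d. x j * sketch_entry A n t1 t2 (\<delta>, y, h, g) \<rho> j)
      = 1 / sqrt (real t2) * row_sum t1 (hash_sum n y h (\<lambda>i. \<Sum>j<d. x j * (A $$ (i, j) / \<delta> i))) g \<rho>" for \<rho>
  proof -
    have e: "sketch_entry A n t1 t2 (\<delta>, y, h, g) \<rho> j
        = (\<Sum>k<t1. g (\<rho>, k) / sqrt (real t2) * hash_sum n y h (\<lambda>i. A $$ (i, j) / \<delta> i) k)" for j
      unfolding sketch_entry_def hash_sum_def fst_conv snd_conv
      by (intro sum.cong refl arg_cong2[where f = "(*)"]) (auto intro!: sum.cong)
    have "(\<Sum>j<d. x j * sketch_entry A n t1 t2 (\<delta>, y, h, g) \<rho> j)
        = (\<Sum>j<d. \<Sum>k<t1. 1 / sqrt (real t2) * (g (\<rho>, k) * (x j * hash_sum n y h (\<lambda>i. A $$ (i, j) / \<delta> i) k)))"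
      unfolding e by (simp add: sum_distrib_left mult_ac)
    also have "\<dots> = (\<Sum>k<t1. \<Sum>j<d. 1 / sqrt (real t2) * (g (\<rho>, k) * (x j * hash_sum n y h (\<lambda>i. A $$ (i, j) / \<delta> i) k)))"
      by (rule sum.swap)
    finally show ?thesis by (simp only: row_sum_def hash_sum_lincomb sum_distrib_left)
  qed
  show ?thesis
    unfolding * by (subst seminorm_scale[OF seminorm_L2]) simp
qed

lemma composed_embedding_bounds:
  fixes a b w v :: real
  assumes "1 / 8 * s * w \<le> a" "a \<le> 5 * s * w" "1 / 2 * v \<le> w" "w \<le> 2 * v" "0 < s"
  shows "1 / 16 * v \<le> 1 / s * a" "1 / s * a \<le> 10 * v"
proof -
  have "1 / 8 * w \<le> a / s" "a / s \<le> 5 * w" using assms by (simp_all add: field_simps)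
  then have "1 / 16 * v \<le> a / s" "a / s \<le> 10 * v" using assms(3,4) by linarith+
  then show "1 / 16 * v \<le> 1 / s * a" "1 / s * a \<le> 10 * v" by simp_all
qed

context orlicz_function
begin

text \<open>Hashing and Gaussian stage together distort by 1/16 = 1/8 * 1/2 and 10 = 5 * 2; with the
  diagonal stage this gives 5120 = 16 * 320 and 175000 = 10 * 17500.\<close>

lemma sketch_probability:
  assumes \<mu>: "real_distribution \<mu>" and cdf: "\<forall>t\<ge>0. cdf \<mu> t = 1 - exp (- G t)"
    and n: "2 \<le> n" and d: "1 \<le> d" "d \<le> n" and A: "A \<in> carrier_mat n d"
    and t1: "80000 * (real d)\<^sup>2 \<le> real t1" and t2: "100 * real d \<le> real t2"
  defines "M \<equiv> sample_measure \<mu> n t1 t2"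
  shows "0.9 \<le> measure M {\<omega> \<in> space M. \<forall>x \<in> carrier_vec d.
     1 / 5120 * (1 / (1 * real d * ln (real n))) * orlicz_norm G (A *\<^sub>v x) \<le> l2_norm (sketched A n t1 t2 \<omega> *\<^sub>v x) \<and>
     l2_norm (sketched A n t1 t2 \<omega> *\<^sub>v x) \<le> 175000 * (C * (real d)\<^sup>2 * ln (real n)) * orlicz_norm G (A *\<^sub>v x)}"
    (is "_ \<le> measure M ?S")
proof -
  interpret \<mu>: real_distribution \<mu> by (rule \<mu>)
  let ?D = "\<Pi>\<^sub>M i\<in>{..<n}. \<mu>" and ?Y = "signs n" and ?H = "hashes n t1"
  let ?Gs = "\<Pi>\<^sub>M e\<in>{..<t2} \<times> {..<t1}. std_normal_measure"
  have t1pos: "0 < t1"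
  proof -
    have "1 \<le> (real d)\<^sup>2" using d by simp
    then have "0 < real t1" using t1 by linarith
    then show ?thesis by simp
  qed
  have pD: "prob_space ?D" by (rule prob_space_PiM) (rule \<mu>.prob_space_axioms)
  have pY: "prob_space ?Y" by (intro prob_space_PiM prob_space_uniform_count_measure) auto
  have pH: "prob_space ?H" by (intro prob_space_PiM prob_space_uniform_count_measure) (use t1pos in auto)
  have pG: "prob_space ?Gs" by (rule prob_space_gaussian)
  have M: "M = ?D \<Otimes>\<^sub>M (?Y \<Otimes>\<^sub>M (?H \<Otimes>\<^sub>M ?Gs))" by (simp add: M_def sample_measure_def)
  have ln0: "0 < ln (real n)" using n by simp
  define S0 where "S0 = ?S"
  have S: "S0 \<in> sets M"
    unfolding S0_def M_def by (rule sketch_event_measurable[OF \<mu>.events_eq_borel A]) (use d ln0 C_ge_1 in auto)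
  define a where "a = (\<lambda>j i. A $$ (i, j))"
  define N where "N = (\<lambda>x. orlicz G n (lincomb d x a))"
  define F where "F = (\<lambda>\<omega> x. L2_set (\<lambda>\<rho>. \<Sum>j<d. x j * sketch_entry A n t1 t2 \<omega> \<rho> j) {..<t2})"
  have inS: "\<omega> \<in> S0" if "\<omega> \<in> space M" and
    "\<And>x. 1 / 5120 * (1 / (1 * real d * ln (real n))) * N x \<le> F \<omega> x \<and> F \<omega> x \<le> 175000 * (C * (real d)\<^sup>2 * ln (real n)) * N x" for \<omega>
    using that by (simp add: S0_def N_def F_def a_def orlicz_norm_mult_mat_vec[OF A] l2_norm_sketched[OF A])
  obtain r q where r: "r \<le> d" and q: "orthonormal_family n r q"
    and span: "\<forall>j<d. \<exists>c. \<forall>i<n. a j i = lincomb r c q i"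
    using orthonormal_span_exists[of d n a] by blast
  obtain ED where ED: "ED \<in> sets ?D" "97 / 100 \<le> measure ?D ED"
    and ED': "\<forall>\<delta>\<in>ED. sandwiched (1 / (320 * real d * ln (real n))) (17500 * C * real d * ln (real n))
      (\<lambda>c. orlicz G n (lincomb r c q)) (\<lambda>c. L2_set (\<lambda>i. lincomb r c q i / \<delta> i) {..<n})"
    using diagonal_embedding_event[OF \<mu> cdf n d r q] by (elim bexE conjE) (rule that)
  have "97 / 100 * (99 / 100 * (99 / 100 * (99 / 100))) \<le> measure (?D \<Otimes>\<^sub>M (?Y \<Otimes>\<^sub>M (?H \<Otimes>\<^sub>M ?Gs))) S0"
  proof (rule measure_pair_ge[OF pD prob_space_pair[OF pY prob_space_pair[OF pH pG]] S[unfolded M] ED])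
    fix \<delta> assume \<delta>: "\<delta> \<in> ED"
    define b where "b = (\<lambda>j i. a j i / \<delta> i)"
    define V where "V = (\<lambda>x. L2_set (lincomb d x b) {..<n})"
    have V: "1 / (320 * real d * ln (real n)) * N x \<le> V x \<and> V x \<le> 17500 * C * real d * ln (real n) * N x" for x
    proof -
      obtain c where c: "\<forall>i<n. (lincomb d x a i) = lincomb r c q i"
        using orthonormal_span_lincomb[OF span, of x] by blast
      have "N x = orlicz G n (lincomb r c q)"
        unfolding N_def by (rule orlicz_cong) (use c in auto)
      moreover have "V x = L2_set (\<lambda>i. lincomb r c q i / \<delta> i) {..<n}"
        unfolding V_def b_def by (rule L2_set_cong) (use c in \<open>auto simp: sum_divide_distrib[symmetric]\<close>)
      ultimately show ?thesis using ED' \<delta> by simp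
    qed
    \<comment> \<open>This basis of the rescaled column space depends on \<delta>, which is fixed
      here; likewise the Gaussian stage chooses a basis after \<delta>, the signs and the
      hashes.\<close>
    obtain r' q' where r': "r' \<le> d" and q': "orthonormal_family n r' q'"
      and span': "\<forall>j<d. \<exists>c. \<forall>i<n. b j i = lincomb r' c q' i"
      using orthonormal_span_exists[of d n b] by blast
    obtain Ey where Ey: "Ey \<in> sets ?Y" "99 / 100 \<le> measure ?Y Ey"
      and Ey': "\<forall>y\<in>Ey. \<exists>Eh\<in>sets ?H. measure ?H Eh \<ge> 99 / 100 \<and> (\<forall>h\<in>Eh. sandwiched (1 / 2) 2 (\<lambda>c. L2_set c {..<r'})
      (\<lambda>c. L2_set (hash_sum n y h (lincomb r' c q')) {..<t1}))"
      using sparse_embedding_events[OF t1pos q' r' d(1) t1] by (elim bexE conjE) (rule that)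
    have S\<delta>: "Pair \<delta> -` S0 \<in> sets (?Y \<Otimes>\<^sub>M (?H \<Otimes>\<^sub>M ?Gs))" using S[unfolded M] by (rule sets_Pair1)
    show "99 / 100 * (99 / 100 * (99 / 100)) \<le> measure (?Y \<Otimes>\<^sub>M (?H \<Otimes>\<^sub>M ?Gs)) (Pair \<delta> -` S0)"
    proof (rule measure_pair_ge[OF pY prob_space_pair[OF pH pG] S\<delta> Ey])
      fix y assume y: "y \<in> Ey"
      obtain Eh where Eh: "Eh \<in> sets ?H" "99 / 100 \<le> measure ?H Eh"
        and Eh': "\<forall>h\<in>Eh. sandwiched (1 / 2) 2 (\<lambda>c. L2_set c {..<r'})
      (\<lambda>c. L2_set (hash_sum n y h (lincomb r' c q')) {..<t1})"
        using bspec[OF Ey' y] by (elim bexE conjE) (rule that)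
      have Sy: "Pair y -` (Pair \<delta> -` S0) \<in> sets (?H \<Otimes>\<^sub>M ?Gs)" using S\<delta> by (rule sets_Pair1)
      show "99 / 100 * (99 / 100) \<le> measure (?H \<Otimes>\<^sub>M ?Gs) (Pair y -` (Pair \<delta> -` S0))"
      proof (rule measure_pair_ge[OF pH pG Sy Eh])
        fix h assume h: "h \<in> Eh"
        interpret Gs: prob_space ?Gs by (rule pG)
        define W where "W = (\<lambda>x. L2_set (hash_sum n y h (lincomb d x b)) {..<t1})"
        have W: "1 / 2 * V x \<le> W x \<and> W x \<le> 2 * V x" for x
        proof -
          obtain c where c: "\<forall>i<n. (lincomb d x b i) = lincomb r' c q' i"
            using orthonormal_span_lincomb[OF span', of x] by blast
          have "V x = L2_set (lincomb r' c q') {..<n}"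
            unfolding V_def by (rule L2_set_cong) (use c in auto)
          also have "\<dots> = L2_set c {..<r'}" by (rule orthonormal_L2_lincomb[OF q'])
          finally have "V x = L2_set c {..<r'}" .
          moreover have "W x = L2_set (hash_sum n y h (lincomb r' c q')) {..<t1}"
            unfolding W_def by (intro L2_set_cong refl hash_sum_cong) (use c in auto)
          ultimately show ?thesis using Eh' h by simp
        qed
        define s where "s = (\<lambda>j \<kappa>. hash_sum n y h (b j) \<kappa>)"
        obtain r'' q'' where r'': "r'' \<le> d" and q'': "orthonormal_family t1 r'' q''"
          and span'': "\<forall>j<d. \<exists>c. \<forall>i<t1. s j i = lincomb r'' c q'' i"
          using orthonormal_span_exists[of d t1 s] by blast
        have t2': "100 * d \<le> t2" using t2 by linarith
        obtain Eg where Eg: "Eg \<in> sets ?Gs" "99 / 100 \<le> measure ?Gs Eg"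
          and Eg': "\<forall>g\<in>Eg. sandwiched (1 / 8 * sqrt (real t2)) (5 * sqrt (real t2)) (\<lambda>c. L2_set c {..<r''})
      (\<lambda>c. L2_set (row_sum t1 (lincomb r'' c q'') g) {..<t2})"
          using gaussian_embedding_event[OF q'' r'' d(1) t2'] by (elim bexE conjE) (rule that)
        have Sh: "Pair h -` (Pair y -` (Pair \<delta> -` S0)) \<in> sets ?Gs" using Sy by (rule sets_Pair1)
        have "Eg \<subseteq> Pair h -` (Pair y -` (Pair \<delta> -` S0))"
        proof
          fix g assume g: "g \<in> Eg"
          have sp: "(\<delta>, y, h, g) \<in> space M"
            using sets.sets_into_space[OF ED(1)] sets.sets_into_space[OF Ey(1)]
              sets.sets_into_space[OF Eh(1)] sets.sets_into_space[OF Eg(1)] \<delta> y h g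
            unfolding M space_pair_measure by auto
          have "1 / 5120 * (1 / (1 * real d * ln (real n))) * N x \<le> F (\<delta>, y, h, g) x
              \<and> F (\<delta>, y, h, g) x \<le> 175000 * (C * (real d)\<^sup>2 * ln (real n)) * N x" for x
          proof -
            define R where "R = L2_set (row_sum t1 (hash_sum n y h (lincomb d x b)) g) {..<t2}"
            obtain c where c: "\<forall>\<kappa><t1. (lincomb d x s \<kappa>) = lincomb r'' c q'' \<kappa>"
              using orthonormal_span_lincomb[OF span'', of x] by blast
            have hs: "hash_sum n y h (lincomb d x b) \<kappa> = lincomb r'' c q'' \<kappa>" if "\<kappa> < t1" for \<kappa>
              using c that by (simp add: hash_sum_lincomb s_def)
            have "W x = L2_set (lincomb r'' c q'') {..<t1}"
              unfolding W_def by (rule L2_set_cong) (auto simp: hs)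
            also have "\<dots> = L2_set c {..<r''}" by (rule orthonormal_L2_lincomb[OF q''])
            finally have Wc: "W x = L2_set c {..<r''}" .
            have "R = L2_set (row_sum t1 (lincomb r'' c q'') g) {..<t2}"
              unfolding R_def row_sum_def by (intro L2_set_cong refl sum.cong) (auto simp: hs)
            then have R: "1 / 8 * sqrt (real t2) * W x \<le> R" "R \<le> 5 * sqrt (real t2) * W x"
              using Eg' g unfolding Wc by auto
            have FR: "F (\<delta>, y, h, g) x = 1 / sqrt (real t2) * R"
              unfolding F_def R_def b_def a_def by (rule sketch_entry_lincomb)
            have st: "0 < sqrt (real t2)" using t2 d by simp
            have FV: "1 / 16 * V x \<le> F (\<delta>, y, h, g) x" "F (\<delta>, y, h, g) x \<le> 10 * V x"
              unfolding FR using composed_embedding_bounds[OF R _ _ st] W[of x] by auto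
            have "1 / 5120 * (1 / (1 * real d * ln (real n))) * N x = 1 / 16 * (1 / (320 * real d * ln (real n)) * N x)"
              by simp
            also have "\<dots> \<le> 1 / 16 * V x" using V[of x] by (intro mult_left_mono) auto
            finally have 1: "1 / 5120 * (1 / (1 * real d * ln (real n))) * N x \<le> F (\<delta>, y, h, g) x" using FV by linarith
            have "10 * V x \<le> 10 * (17500 * C * real d * ln (real n) * N x)"
              using V[of x] by (intro mult_left_mono) auto
            also have "\<dots> = 175000 * C * ln (real n) * N x * real d" by simp
            \<comment> \<open>Here the linear dependence on d is weakened to the stated quadratic
              one.\<close>
            also have "\<dots> \<le> 175000 * C * ln (real n) * N x * (real d)\<^sup>2"
            proof (rule mult_left_mono)
              show "real d \<le> (real d)\<^sup>2" using d by (simp add: power2_eq_square)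
              show "0 \<le> 175000 * C * ln (real n) * N x"
                unfolding N_def using C_ge_1 ln0 orlicz_nonneg by simp
            qed
            finally have "F (\<delta>, y, h, g) x \<le> 175000 * (C * (real d)\<^sup>2 * ln (real n)) * N x"
              using FV by (simp add: mult_ac)
            with 1 show ?thesis by simp
          qed
          from inS[OF sp this] show "g \<in> Pair h -` (Pair y -` (Pair \<delta> -` S0))" by simp
        qed
        then have "measure ?Gs Eg \<le> measure ?Gs (Pair h -` (Pair y -` (Pair \<delta> -` S0)))"
          using Sh by (rule Gs.finite_measure_mono)
        then show "99 / 100 \<le> measure ?Gs (Pair h -` (Pair y -` (Pair \<delta> -` S0)))" using Eg by linarith
      qed simp
    qed simp
  qed simp
  then have "97 / 100 * (99 / 100 * (99 / 100 * (99 / 100))) \<le> measure M S0" unfolding M .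
  then show ?thesis unfolding S0_def by simp
qed

end

section \<open>The running time\<close>

text \<open>A total-correctness triple with a time bound: \<open>exec\<close> counts steps exactly,
  \<open>K\<close> only bounds them.\<close>

definition runs :: "prog \<Rightarrow> ram_state \<Rightarrow> nat \<Rightarrow> (ram_state \<Rightarrow> bool) \<Rightarrow> bool" where
  "runs P s K Q \<longleftrightarrow> (\<exists>k s'. exec P s k s' \<and> k \<le> K \<and> Q s')"

lemma runs_mono: "runs P s K Q \<Longrightarrow> K \<le> K' \<Longrightarrow> (\<And>s'. Q s' \<Longrightarrow> Q' s') \<Longrightarrow> runs P s K' Q'"
  unfolding runs_def by (meson le_trans)

lemma runs_Seq:
  assumes "runs P s K R" "\<And>s'. R s' \<Longrightarrow> runs Q s' L T"
  shows "runs (Seq P Q) s (K + L) T"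
  using assms unfolding runs_def by (meson Seq add_mono)

text \<open>Rule for counted loops: each round costs its body and one test, and the last, failing
  test adds 1.\<close>

lemma runs_Loop:
  assumes step: "\<And>i s. i < N \<Longrightarrow> I i s \<Longrightarrow> holds b s \<and> runs P s c (I (Suc i))"
    and stop: "\<And>s. I N s \<Longrightarrow> \<not> holds b s"
    and init: "I 0 s"
  shows "runs (Loop b P) s (N * (c + 1) + 1) (I N)"
proof -
  have "runs (Loop b P) s ((N - i) * (c + 1) + 1) (I N)" if "i \<le> N" "I i s" for i s
    using that
  proof (induction "N - i" arbitrary: i s)
    case 0
    then have "I N s" by simp
    then show ?case using exec.LoopFalse[OF stop] unfolding runs_def
      by (intro exI[of _ 1] exI[of _ s]) simp
  next
    case (Suc m)
    then have i: "i < N" by simp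
    then obtain k s' where P: "holds b s" "exec P s k s'" "k \<le> c" "I (Suc i) s'"
      using step[OF i Suc.prems(2)] unfolding runs_def by blast
    have "runs (Loop b P) s' ((N - Suc i) * (c + 1) + 1) (I N)"
      using Suc i P by simp
    then obtain l s'' where L: "exec (Loop b P) s' l s''" "l \<le> (N - Suc i) * (c + 1) + 1" "I N s''"
      by (auto simp: runs_def)
    have "N - i = Suc (N - Suc i)" using i by simp
    then have "1 + k + l \<le> (N - i) * (c + 1) + 1" using P L by simp
    then show ?case
      using exec.LoopTrue[OF P(1,2) L(1)] L(3) unfolding runs_def by blast
  qed
  from this[of 0 s] init show ?thesis by simp
qed

text \<open>The language has no empty program; the clause for \<open>[]\<close> is a placeholder (it
  doubles register 0), and the rules for blocks demand nonempty lists.\<close>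

fun block :: "instr list \<Rightarrow> prog" where
  "block [] = Instr (IAdd 0 0 0)"
| "block [c] = Instr c"
| "block (c # cs) = Seq (Instr c) (block cs)"

lemma runs_block_length:
  "cs \<noteq> [] \<Longrightarrow> Q (fold instr_effect cs s) \<Longrightarrow> runs (block cs) s (length cs) Q"
proof (induction cs arbitrary: s rule: block.induct)
  case (2 c)
  then show ?case using exec.Instr[of c s] by (auto simp: runs_def)
next
  case (3 c c' cs)
  have "runs (Instr c) s 1 (\<lambda>s'. s' = instr_effect c s)"
    using exec.Instr[of c s] by (auto simp: runs_def)
  from runs_Seq[OF this, of "block (c' # cs)" "length (c' # cs)" Q] 3 show ?case by simp
qed simp

lemma runs_block:
  "cs \<noteq> [] \<Longrightarrow> length cs \<le> K \<Longrightarrow> Q (fold instr_effect cs s) \<Longrightarrow> runs (block cs) s K Q"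
  by (rule runs_mono[OF runs_block_length])

text \<open>Register 5 holds the constant 1, integer array 3 the table of the multiples of d, and real array 5
  the intermediate product, in row-major order. There is no multiplication of naturals, so row
  offsets are kept up to date by addition.\<close>

definition init_prog :: prog where
  "init_prog =
     Seq (block [IConst 5 1, IConst 6 0, IConst 7 0, RConst 0 0])
       (Loop (ILess 6 2)
         (Seq (block [IStore 3 6 7, IConst 8 0])
           (Seq (Loop (ILess 8 1) (block [RStore 5 7 0, IAdd 7 7 5, IAdd 8 8 5]))
             (block [IAdd 6 6 5]))))"

text \<open>Each listed nonzero looks up the hash, sign and diagonal value of its own row, so the
  work is constant per nonzero and no loop over the n rows occurs.\<close>

definition scatter_prog :: prog where
  "scatter_prog =
     Seq (block [IConst 6 0])
       (Loop (ILess 6 4)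
         (block [ILoad 7 0 6, ILoad 8 1 6, ILoad 9 2 7, ILoad 10 3 9, IAdd 10 10 8,
                 RLoad 1 0 6, RLoad 2 1 7, RLoad 3 2 7, RMul 1 3 1, RDiv 1 1 2,
                 RLoad 4 5 10, RAdd 4 4 1, RStore 5 10 4, IAdd 6 6 5]))"

text \<open>Register 12 holds 0, so adding it copies a register. Register 11 walks along a Gaussian
  row in steps of 1, register 13 down a column of the intermediate product in steps of d.\<close>

definition multiply_prog :: prog where
  "multiply_prog =
     Seq (block [IConst 6 0, IConst 7 0, IConst 8 0, IConst 12 0])
       (Loop (ILess 6 3)
         (Seq (block [IConst 9 0])
           (Seq (Loop (ILess 9 1)
                 (Seq (block [RConst 1 0, IConst 10 0, IAdd 11 8 12, IAdd 13 9 12])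
                   (Seq (Loop (ILess 10 2)
                          (block [RLoad 2 3 11, RLoad 3 5 13, RMul 2 2 3, RAdd 1 1 2,
                                  IAdd 10 10 5, IAdd 11 11 5, IAdd 13 13 1]))
                     (block [RStore 4 7 1, IAdd 7 7 5, IAdd 9 9 5]))))
             (block [IAdd 8 8 2, IAdd 6 6 5]))))"

definition inputs_kept :: "ram_state \<Rightarrow> ram_state \<Rightarrow> bool" where
  "inputs_kept s s' \<longleftrightarrow> (\<forall>i<5. ireg s' i = ireg s i) \<and> ireg s' 5 = 1 \<and>
     (\<forall>a<3. iarr s' a = iarr s a) \<and> (\<forall>a<4. rarr s' a = rarr s a)"

lemma row_major_eq_iff:
  fixes j j' :: nat
  assumes "j < d" "j' < d"
  shows "k * d + j = k' * d + j' \<longleftrightarrow> k = k' \<and> j = j'"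
  using assms by (metis add.commute div_mult_self3 div_less add_cancel_right_left add_left_imp_eq
    div_mult_self1 gr_implies_not0)

lemma runs_init:
  assumes "ireg s 1 = d" "ireg s 2 = t1"
  shows "runs init_prog s (t1 * (4 * d + 5) + 5)
    (\<lambda>s'. inputs_kept s s' \<and> (\<forall>k<t1. iarr s' 3 k = k * d) \<and> (\<forall>p<t1 * d. rarr s' 5 p = 0))"
proof -
  let ?fill = "block [RStore 5 7 0, IAdd 7 7 5, IAdd 8 8 5]"
  let ?row = "Seq (block [IStore 3 6 7, IConst 8 0]) (Seq (Loop (ILess 8 1) ?fill) (block [IAdd 6 6 5]))"
  \<comment> \<open>Register 7 counts the cleared cells; at the start of row k it therefore equals k
    d, the table entry obtained without a multiplication.\<close>
  define I where "I = (\<lambda>k s'. inputs_kept s s' \<and> rreg s' 0 = 0 \<and> ireg s' 6 = k \<and> ireg s' 7 = k * d \<and>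
     (\<forall>k'<k. iarr s' 3 k' = k' * d) \<and> (\<forall>p<k * d. rarr s' 5 p = 0))"
  define J where "J = (\<lambda>k j s'. inputs_kept s s' \<and> rreg s' 0 = 0 \<and> ireg s' 6 = k \<and> ireg s' 7 = k * d + j \<and>
     ireg s' 8 = j \<and> (\<forall>k'<Suc k. iarr s' 3 k' = k' * d) \<and> (\<forall>p<k * d + j. rarr s' 5 p = 0))"
  have inner: "runs (Loop (ILess 8 1) ?fill) s'
      (d * (3 + 1) + 1) (J k d)" if "J k 0 s'" for k s'
  proof (rule runs_Loop[where I = "J k", OF _ _ that])
    fix j s' assume j: "j < d" "J k j s'"
    have "runs ?fill s' 3 (J k (Suc j))"
      using j by (intro runs_block) (auto simp: J_def inputs_kept_def less_Suc_eq)
    moreover have "holds (ILess 8 1) s'"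
      using j assms by (auto simp: J_def inputs_kept_def)
    ultimately show "holds (ILess 8 1) s' \<and> runs ?fill s' 3 (J k (Suc j))"
      by simp
  qed (use assms in \<open>auto simp: J_def inputs_kept_def\<close>)
  have body: "runs ?row s' (2 + ((d * (3 + 1) + 1) + 1)) (I (Suc k))"
    if "I k s'" for k s'
  proof (rule runs_Seq[where R = "J k 0"])
    show "runs (block [IStore 3 6 7, IConst 8 0]) s' 2 (J k 0)"
      using that
      by (intro runs_block) (auto simp: I_def J_def inputs_kept_def less_Suc_eq)
    fix s' assume "J k 0 s'"
    then show "runs (Seq (Loop (ILess 8 1) ?fill)
             (block [IAdd 6 6 5])) s' ((d * (3 + 1) + 1) + 1) (I (Suc k))"
    proof (rule runs_Seq[OF inner])
      fix s' assume "J k d s'"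
      then show "runs (block [IAdd 6 6 5]) s' 1 (I (Suc k))"
        by (intro runs_block) (auto simp: I_def J_def inputs_kept_def add.commute)
    qed
  qed
  have "runs init_prog s (4 + (t1 * ((2 + ((d * (3 + 1) + 1) + 1)) + 1) + 1)) (I t1)"
    unfolding init_prog_def
  proof (rule runs_Seq[where R = "I 0"])
    show "runs (block [IConst 5 1, IConst 6 0, IConst 7 0, RConst 0 0]) s 4 (I 0)"
      by (intro runs_block) (auto simp: I_def inputs_kept_def)
    fix s' assume I0: "I 0 s'"
    show "runs (Loop (ILess 6 2)
         ?row) s' (t1 * ((2 + ((d * (3 + 1) + 1) + 1)) + 1) + 1) (I t1)"
    proof (rule runs_Loop[where I = I, OF _ _ I0], intro conjI)
      fix k s' assume k: "k < t1" "I k s'"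
      show "holds (ILess 6 2) s'" using k assms by (auto simp: I_def inputs_kept_def)
      show "runs ?row s' (2 + ((d * (3 + 1) + 1) + 1)) (I (Suc k))"
        by (rule body[OF k(2)])
    qed (use assms in \<open>auto simp: I_def inputs_kept_def\<close>)
  qed
  then show ?thesis by (rule runs_mono) (auto simp: I_def algebra_simps)
qed

lemma runs_scatter:
  assumes "ireg s 1 = d" "ireg s 2 = t1" "ireg s 4 = N" "ireg s 5 = 1"
    and tab: "\<And>k. k < t1 \<Longrightarrow> iarr s 3 k = k * d" and B0: "\<And>p. p < t1 * d \<Longrightarrow> rarr s 5 p = 0"
    and idx: "\<And>l. l < N \<Longrightarrow> iarr s 1 l < d \<and> iarr s 2 (iarr s 0 l) < t1"
  shows "runs scatter_prog s (15 * N + 2)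
    (\<lambda>s'. inputs_kept s s' \<and> (\<forall>k<t1. \<forall>j<d. rarr s' 5 (k * d + j) =
       (\<Sum>l<N. if iarr s 2 (iarr s 0 l) = k \<and> iarr s 1 l = j
          then rarr s 2 (iarr s 0 l) * rarr s 0 l / rarr s 1 (iarr s 0 l) else 0)))"
proof -
  define e where "e = (\<lambda>l k j. if iarr s 2 (iarr s 0 l) = k \<and> iarr s 1 l = j
          then rarr s 2 (iarr s 0 l) * rarr s 0 l / rarr s 1 (iarr s 0 l) else 0)"
  define I where "I = (\<lambda>l s'. inputs_kept s s' \<and> ireg s' 6 = l \<and> (\<forall>k<t1. iarr s' 3 k = k * d) \<and>
     (\<forall>k<t1. \<forall>j<d. rarr s' 5 (k * d + j) = (\<Sum>l'<l. e l' k j)))"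
  define cs where "cs = [ILoad 7 0 6, ILoad 8 1 6, ILoad 9 2 7, ILoad 10 3 9, IAdd 10 10 8,
                 RLoad 1 0 6, RLoad 2 1 7, RLoad 3 2 7, RMul 1 3 1, RDiv 1 1 2,
                 RLoad 4 5 10, RAdd 4 4 1, RStore 5 10 4, IAdd 6 6 5]"
  have c14: "cs \<noteq> []" "length cs = 14" by (simp_all add: cs_def)
  have "runs scatter_prog s (1 + (N * (14 + 1) + 1)) (I N)"
    unfolding scatter_prog_def cs_def[symmetric]
  proof (rule runs_Seq[where R = "I 0"])
    have z: "k * d + j < t1 * d" if "k < t1" "j < d" for k j
    proof -
      have "k * d + j < Suc k * d" using that by simp
      also have "\<dots> \<le> t1 * d" using that by (intro mult_le_mono1) simp
      finally show ?thesis .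
    qed
    show "runs (block [IConst 6 0]) s 1 (I 0)"
      using assms z
      by (intro runs_block) (auto simp: I_def inputs_kept_def)
    fix s' assume I0: "I 0 s'"
    show "runs (Loop (ILess 6 4) (block cs)) s' (N * (14 + 1) + 1) (I N)"
    proof (rule runs_Loop[where I = I, OF _ _ I0], intro conjI)
      fix l s' assume l: "l < N" "I l s'"
      show "holds (ILess 6 4) s'" using l assms by (auto simp: I_def inputs_kept_def)
      let ?k0 = "iarr s 2 (iarr s 0 l)" and ?j0 = "iarr s 1 l"
      let ?v = "rarr s' 5 (?k0 * d + ?j0) + rarr s 2 (iarr s 0 l) * rarr s 0 l / rarr s 1 (iarr s 0 l)"
      have kept: "inputs_kept s s'" and i6: "ireg s' 6 = l"
        and tab': "\<And>k. k < t1 \<Longrightarrow> iarr s' 3 k = k * d"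
        and B: "\<And>k j. k < t1 \<Longrightarrow> j < d \<Longrightarrow> rarr s' 5 (k * d + j) = (\<Sum>l'<l. e l' k j)"
        using l(2) by (auto simp: I_def)
      let ?f = "fold instr_effect cs s'"
      have arr: "rarr ?f 5 = (rarr s' 5)(?k0 * d + ?j0 := ?v)"
        using kept idx[OF l(1)] tab' by (simp add: cs_def i6 inputs_kept_def)
      have "inputs_kept s ?f" "ireg ?f 6 = Suc l" "iarr ?f 3 = iarr s' 3"
        using kept i6 by (auto simp: cs_def inputs_kept_def)
      \<comment> \<open>Distinct index pairs occupy distinct cells in row-major order, so only the
        addressed sum changes.\<close>
      moreover have "rarr ?f 5 (k * d + j) = (\<Sum>l'<Suc l. e l' k j)" if "k < t1" "j < d" for k j
        using idx[OF l(1)] B that by (auto simp: arr row_major_eq_iff e_def)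
      ultimately have "I (Suc l) ?f" by (simp add: I_def tab')
      then show "runs (block cs) s' 14 (I (Suc l))"
        using c14 by (intro runs_block) auto
    qed (use assms in \<open>auto simp: I_def inputs_kept_def\<close>)
  qed
  then show ?thesis by (rule runs_mono) (auto simp: I_def e_def)
qed

lemma runs_multiply:
  assumes "ireg s 1 = d" "ireg s 2 = t1" "ireg s 3 = t2" "ireg s 5 = 1"
  shows "runs multiply_prog s (t2 * (d * (8 * t1 + 9) + 5) + 5)
    (\<lambda>s'. \<forall>r<t2. \<forall>j<d. rarr s' 4 (r * d + j) =
       (\<Sum>k<t1. rarr s 3 (r * t1 + k) * rarr s 5 (k * d + j)))"
proof -
  define e where "e = (\<lambda>r j k. rarr s 3 (r * t1 + k) * rarr s 5 (k * d + j))"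
  \<comment> \<open>Nested invariants: \<open>F r j\<close> says that j entries of row r are
    finished, \<open>J\<close> adds the column counter and \<open>K\<close> the partial inner
    product. A complete row \<open>F r d\<close> is re-read as \<open>F (Suc r) 0\<close> after the
    counters move.\<close>
  define F where "F = (\<lambda>r j s'. inputs_kept s s' \<and> rarr s' 5 = rarr s 5 \<and> ireg s' 12 = 0 \<and>
     ireg s' 6 = r \<and> ireg s' 7 = r * d + j \<and> ireg s' 8 = r * t1 \<and>
     (\<forall>r'<r. \<forall>j'<d. rarr s' 4 (r' * d + j') = (\<Sum>k<t1. e r' j' k)) \<and>
     (\<forall>j'<j. rarr s' 4 (r * d + j') = (\<Sum>k<t1. e r j' k)))"
  define J where "J = (\<lambda>r j s'. F r j s' \<and> ireg s' 9 = j)"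
  define K where "K = (\<lambda>r j k s'. J r j s' \<and> ireg s' 10 = k \<and> ireg s' 11 = r * t1 + k \<and>
     ireg s' 13 = k * d + j \<and> rreg s' 1 = (\<Sum>k'<k. e r j k'))"
  define cs where "cs = [RLoad 2 3 11, RLoad 3 5 13, RMul 2 2 3, RAdd 1 1 2,
                                  IAdd 10 10 5, IAdd 11 11 5, IAdd 13 13 1]"
  define L where "L = Loop (ILess 10 2) (block cs)"
  have inner: "runs L s' (t1 * (7 + 1) + 1) (K r j t1)" if "K r j 0 s'" for r j s'
    unfolding L_def
  proof (rule runs_Loop[where I = "K r j", OF _ _ that])
    fix k s' assume k: "k < t1" "K r j k s'"
    then have "runs (block cs) s' 7 (K r j (Suc k))"
      using assms unfolding cs_def
      by (intro runs_block) (auto simp: K_def J_def F_def inputs_kept_def e_def)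
    moreover have "holds (ILess 10 2) s'"
      using assms k by (auto simp: K_def J_def F_def inputs_kept_def)
    ultimately show "holds (ILess 10 2) s' \<and> runs (block cs) s' 7 (K r j (Suc k))" by simp
  qed (use assms in \<open>auto simp: K_def J_def F_def inputs_kept_def\<close>)
  define M where "M = Seq (block [RConst 1 0, IConst 10 0, IAdd 11 8 12, IAdd 13 9 12])
                   (Seq L (block [RStore 4 7 1, IAdd 7 7 5, IAdd 9 9 5]))"
  have Mrun: "runs M s' (4 + ((t1 * (7 + 1) + 1) + 3)) (J r (Suc j))"
    if J: "J r j s'" and j: "j < d" for r j s'
    unfolding M_def
  proof (rule runs_Seq[where R = "K r j 0"])
    show "runs (block [RConst 1 0, IConst 10 0, IAdd 11 8 12, IAdd 13 9 12]) s' 4 (K r j 0)"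
      using J
      by (intro runs_block) (auto simp: K_def J_def F_def inputs_kept_def)
    fix s' assume "K r j 0 s'"
    then show "runs (Seq L (block [RStore 4 7 1, IAdd 7 7 5, IAdd 9 9 5])) s'
      ((t1 * (7 + 1) + 1) + 3) (J r (Suc j))"
    proof (rule runs_Seq[OF inner])
      fix s' assume K: "K r j t1 s'"
      have ne: "r' * d + j' \<noteq> r * d + j" if "r' < r" "j' < d" for r' j'
        using row_major_eq_iff[OF that(2) j, of r' r] that(1) by simp
      show "runs (block [RStore 4 7 1, IAdd 7 7 5, IAdd 9 9 5]) s' 3 (J r (Suc j))"
        using K ne
        by (intro runs_block) (auto simp: K_def J_def F_def inputs_kept_def less_Suc_eq)
    qed
  qed
  have middle: "runs (Loop (ILess 9 1) M) s' (d * ((4 + ((t1 * (7 + 1) + 1) + 3)) + 1) + 1) (J r d)"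
    if "J r 0 s'" for r s'
  proof (rule runs_Loop[where I = "J r", OF _ _ that], intro conjI)
    fix j s' assume j: "j < d" "J r j s'"
    show "holds (ILess 9 1) s'" using j assms by (auto simp: J_def F_def inputs_kept_def)
    show "runs M s' (4 + ((t1 * (7 + 1) + 1) + 3)) (J r (Suc j))" by (rule Mrun[OF j(2,1)])
  qed (use assms in \<open>auto simp: J_def F_def inputs_kept_def\<close>)
  define O' where "O' = Seq (block [IConst 9 0]) (Seq (Loop (ILess 9 1) M) (block [IAdd 8 8 2, IAdd 6 6 5]))"
  have outer: "runs O' s' (1 + ((d * ((4 + ((t1 * (7 + 1) + 1) + 3)) + 1) + 1) + 2)) (F (Suc r) 0)"
    if F: "F r 0 s'" for r s'
    unfolding O'_def
  proof (rule runs_Seq[where R = "J r 0"])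
    show "runs (block [IConst 9 0]) s' 1 (J r 0)"
      using F
      by (intro runs_block) (auto simp: J_def F_def inputs_kept_def)
    fix s' assume "J r 0 s'"
    then show "runs (Seq (Loop (ILess 9 1) M) (block [IAdd 8 8 2, IAdd 6 6 5])) s'
       ((d * ((4 + ((t1 * (7 + 1) + 1) + 3)) + 1) + 1) + 2) (F (Suc r) 0)"
    proof (rule runs_Seq[OF middle])
      fix s' assume "J r d s'"
      then show "runs (block [IAdd 8 8 2, IAdd 6 6 5]) s' 2 (F (Suc r) 0)"
        using assms
        by (intro runs_block) (auto simp: J_def F_def inputs_kept_def less_Suc_eq algebra_simps)
    qed
  qed
  have "runs multiply_prog s
     (4 + (t2 * ((1 + ((d * ((4 + ((t1 * (7 + 1) + 1) + 3)) + 1) + 1) + 2)) + 1) + 1)) (F t2 0)"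
    unfolding multiply_prog_def cs_def[symmetric] L_def[symmetric] M_def[symmetric] O'_def[symmetric]
  proof (rule runs_Seq[where R = "F 0 0"])
    show "runs (block [IConst 6 0, IConst 7 0, IConst 8 0, IConst 12 0]) s 4 (F 0 0)"
      using assms
      by (intro runs_block) (auto simp: F_def inputs_kept_def)
    fix s' assume F0: "F 0 0 s'"
    show "runs (Loop (ILess 6 3) O') s'
       (t2 * ((1 + ((d * ((4 + ((t1 * (7 + 1) + 1) + 3)) + 1) + 1) + 2)) + 1) + 1) (F t2 0)"
    proof (rule runs_Loop[where I = "\<lambda>r. F r 0", OF _ _ F0], intro conjI)
      fix r s' assume r: "r < t2" "F r 0 s'"
      show "holds (ILess 6 3) s'" using r assms by (auto simp: F_def inputs_kept_def)
      show "runs O' s' (1 + ((d * ((4 + ((t1 * (7 + 1) + 1) + 3)) + 1) + 1) + 2)) (F (Suc r) 0)"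
        by (rule outer[OF r(2)])
    qed (use assms in \<open>auto simp: F_def inputs_kept_def\<close>)
  qed
  then show ?thesis by (rule runs_mono) (auto simp: F_def e_def algebra_simps)
qed

section \<open>The complete program, its cost, and the final assembly\<close>

definition sketch_prog :: prog where
  "sketch_prog = Seq init_prog (Seq scatter_prog multiply_prog)"

text \<open>The three step counts with \<open>q\<close> in place of \<open>t1\<close> and
  \<open>t2\<close> and \<open>[:0, 1:]\<close> for d; 12 = 5 + 2 + 5 collects the
  constants.\<close>

definition sketch_cost :: "nat poly \<Rightarrow> nat poly" where
  "sketch_cost q = q * (4 * [:0, 1:] + 5) + q * ([:0, 1:] * (8 * q + 9) + 5) + 12"

lemma poly_sketch_cost:
  "poly (sketch_cost q) d = poly q d * (4 * d + 5) + poly q d * (d * (8 * poly q d + 9) + 5) + 12"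
  by (simp add: sketch_cost_def)

text \<open>The list of nonzeros has arbitrary order; the bijection with \<open>nonzeros A\<close>
  turns the accumulated sums into sums over all rows, zero entries contributing 0.\<close>

lemma sketch_running_time:
  fixes A :: "real mat"
  assumes A: "A \<in> carrier_mat n d" and t: "t1 \<le> poly q d" "t2 \<le> poly q d"
    and hash: "\<forall>i<n. \<delta> i \<noteq> 0 \<and> y i \<in> {-1, 1} \<and> h i < t1"
    and inp: "sketch_input A n d t1 t2 (\<delta>, y, h, g) s"
  shows "\<exists>k s'. exec sketch_prog s k s' \<and> k \<le> 15 * nnz A + poly (sketch_cost q) d \<and>
    sketch_output (sketched A n t1 t2 (\<delta>, y, h, g)) s'"
proof -
  have h: "h i < t1" if "i < n" for i using hash that by simp
  have reg: "ireg s 1 = d" "ireg s 2 = t1" "ireg s 3 = t2" "ireg s 4 = nnz A"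
    and bij: "bij_betw (\<lambda>l. (iarr s 0 l, iarr s 1 l)) {..<nnz A} (nonzeros A)"
    and val: "\<And>l. l < nnz A \<Longrightarrow> rarr s 0 l = A $$ (iarr s 0 l, iarr s 1 l)"
    and inpi: "\<And>i. i < n \<Longrightarrow> iarr s 2 i = h i \<and> rarr s 1 i = \<delta> i \<and> rarr s 2 i = y i"
    and gau: "\<And>r k. r < t2 \<Longrightarrow> k < t1 \<Longrightarrow> rarr s 3 (r * t1 + k) = g (r, k) / sqrt t2"
    using inp by (auto simp: sketch_input_def gaussian_mat_def)
  have nz: "iarr s 0 l < n \<and> iarr s 1 l < d" if "l < nnz A" for l
    using bij_betwE[OF bij] that A by (auto simp: nonzeros_def)
  define B where "B = (\<lambda>k j. \<Sum>i<n. if h i = k then y i * A $$ (i, j) / \<delta> i else 0)"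
  have scatter: "(\<Sum>l<nnz A. if iarr s 2 (iarr s 0 l) = k \<and> iarr s 1 l = j
        then rarr s 2 (iarr s 0 l) * rarr s 0 l / rarr s 1 (iarr s 0 l) else 0) = B k j"
    if j: "j < d" for k j
  proof -
    define f where "f = (\<lambda>(i, j'). if h i = k \<and> j' = j then y i * A $$ (i, j') / \<delta> i else 0)"
    have "(\<Sum>l<nnz A. if iarr s 2 (iarr s 0 l) = k \<and> iarr s 1 l = j
        then rarr s 2 (iarr s 0 l) * rarr s 0 l / rarr s 1 (iarr s 0 l) else 0)
        = (\<Sum>l<nnz A. f (iarr s 0 l, iarr s 1 l))"
      by (intro sum.cong refl) (auto simp: f_def val inpi nz simp del: One_nat_def)
    also have "\<dots> = (\<Sum>e\<in>nonzeros A. f e)"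
      by (rule sum.reindex_bij_betw[OF bij])
    also have "\<dots> = (\<Sum>e\<in>{..<n} \<times> {..<d}. f e)"
      using A by (intro sum.mono_neutral_left) (auto simp: nonzeros_def f_def split: if_splits)
    also have "\<dots> = (\<Sum>i<n. \<Sum>j'<d. f (i, j'))"
      by (simp add: sum.cartesian_product)
    also have "\<dots> = B k j"
      unfolding B_def
    proof (rule sum.cong[OF refl])
      fix i
      have "(\<Sum>j'<d. f (i, j')) = (\<Sum>j'<d. if j' = j then (if h i = k then y i * A $$ (i, j) / \<delta> i else 0) else 0)"
        by (intro sum.cong refl) (auto simp: f_def)
      then show "(\<Sum>j'<d. f (i, j')) = (if h i = k then y i * A $$ (i, j) / \<delta> i else 0)"
        using j by simp
    qed
    finally show ?thesis .
  qed
  have "runs sketch_prog s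
     ((t1 * (4 * d + 5) + 5) + ((15 * nnz A + 2) + (t2 * (d * (8 * t1 + 9) + 5) + 5)))
     (\<lambda>s'. \<forall>r<t2. \<forall>j<d. rarr s' 4 (r * d + j) = (\<Sum>k<t1. g (r, k) / sqrt t2 * B k j))"
    unfolding sketch_prog_def
  proof (rule runs_Seq[OF runs_init[OF reg(1,2)]])
    fix s1 assume s1: "inputs_kept s s1 \<and> (\<forall>k<t1. iarr s1 3 k = k * d) \<and> (\<forall>p<t1 * d. rarr s1 5 p = 0)"
    then have eq1: "iarr s1 0 = iarr s 0" "iarr s1 1 = iarr s 1" "iarr s1 2 = iarr s 2"
      "rarr s1 0 = rarr s 0" "rarr s1 1 = rarr s 1" "rarr s1 2 = rarr s 2" "rarr s1 3 = rarr s 3"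
      "ireg s1 1 = d" "ireg s1 2 = t1" "ireg s1 3 = t2" "ireg s1 4 = nnz A" "ireg s1 5 = 1"
      using reg by (auto simp: inputs_kept_def)
    show "runs (Seq scatter_prog multiply_prog) s1
       ((15 * nnz A + 2) + (t2 * (d * (8 * t1 + 9) + 5) + 5))
       (\<lambda>s'. \<forall>r<t2. \<forall>j<d. rarr s' 4 (r * d + j) = (\<Sum>k<t1. g (r, k) / sqrt t2 * B k j))"
    proof (rule runs_Seq[OF runs_scatter[OF eq1(8,9,11,12)]])
      fix s2 assume s2: "inputs_kept s1 s2 \<and> (\<forall>k<t1. \<forall>j<d. rarr s2 5 (k * d + j) =
        (\<Sum>l<nnz A. if iarr s1 2 (iarr s1 0 l) = k \<and> iarr s1 1 l = j
           then rarr s1 2 (iarr s1 0 l) * rarr s1 0 l / rarr s1 1 (iarr s1 0 l) else 0))"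
      then have B: "rarr s2 5 (k * d + j) = B k j" if "k < t1" "j < d" for k j
        using s2 that scatter[OF that(2), of k] unfolding eq1 by (auto simp del: One_nat_def)
      have eq2: "ireg s2 1 = d" "ireg s2 2 = t1" "ireg s2 3 = t2" "ireg s2 5 = 1" "rarr s2 3 = rarr s 3"
        using s2 eq1 by (auto simp: inputs_kept_def)
      show "runs multiply_prog s2 (t2 * (d * (8 * t1 + 9) + 5) + 5)
       (\<lambda>s'. \<forall>r<t2. \<forall>j<d. rarr s' 4 (r * d + j) = (\<Sum>k<t1. g (r, k) / sqrt t2 * B k j))"
        by (rule runs_mono[OF runs_multiply[OF eq2(1-4)]]) (auto simp: eq2(5) gau B)
    qed (use s1 h inpi nz in \<open>auto simp: eq1 simp del: One_nat_def\<close>)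
  qed
  then obtain k s' where e: "exec sketch_prog s k s'"
    and k: "k \<le> (t1 * (4 * d + 5) + 5) + ((15 * nnz A + 2) + (t2 * (d * (8 * t1 + 9) + 5) + 5))"
    and o: "\<forall>r<t2. \<forall>j<d. rarr s' 4 (r * d + j) = (\<Sum>k<t1. g (r, k) / sqrt t2 * B k j)"
    unfolding runs_def by blast
  have "t1 * (4 * d + 5) \<le> poly q d * (4 * d + 5)" using t by simp
  moreover have "t2 * (d * (8 * t1 + 9) + 5) \<le> poly q d * (d * (8 * poly q d + 9) + 5)"
    using t by (intro mult_le_mono add_le_mono) auto
  ultimately have "k \<le> 15 * nnz A + poly (sketch_cost q) d" using k unfolding poly_sketch_cost by linarith
  moreover have "sketch_output (sketched A n t1 t2 (\<delta>, y, h, g)) s'"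
    using sketched_carrier[OF A, of t1 t2 "(\<delta>, y, h, g)"] o
    by (auto simp: sketch_output_def sketched_index[OF A] B_def)
  ultimately show ?thesis using e by blast
qed

text \<open>\<alpha>' can be 1, since the lower bound sees G through its norm alone; \<alpha>'' is
  the growth constant C.\<close>

lemma sketch_guarantee:
  assumes "property_P G"
  shows "\<exists>\<alpha>'\<ge>1. \<exists>\<alpha>''\<ge>1. \<forall>\<mu> (n::nat) (d::nat) (t1::nat) (t2::nat) (A::real mat).
    real_distribution \<mu> \<and> (\<forall>t\<ge>0. cdf \<mu> t = 1 - exp (- G t)) \<and>
    2 \<le> n \<and> 1 \<le> d \<and> d \<le> n \<and> A \<in> carrier_mat n d \<and>
    80000 * (real d)\<^sup>2 \<le> real t1 \<and> 100 * real d \<le> real t2 \<longrightarrow>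
    measure (sample_measure \<mu> n t1 t2)
      {\<omega> \<in> space (sample_measure \<mu> n t1 t2). \<forall>x \<in> carrier_vec d.
       1 / 5120 * (1 / (\<alpha>' * real d * ln (real n))) * orlicz_norm G (A *\<^sub>v x)
         \<le> l2_norm (sketched A n t1 t2 \<omega> *\<^sub>v x) \<and>
       l2_norm (sketched A n t1 t2 \<omega> *\<^sub>v x)
         \<le> 175000 * (\<alpha>'' * (real d)\<^sup>2 * ln (real n)) * orlicz_norm G (A *\<^sub>v x)} \<ge> (0.9::real)"
proof -
  obtain C where "orlicz_function G C" using property_P_orlicz_function[OF assms] by blast
  then interpret orlicz_function G C .
  show ?thesis
    by (rule exI[of _ 1], rule conjI[OF order.refl], rule exI[of _ C], rule conjI[OF C_ge_1],
        intro allI impI, elim conjE, rule sketch_probability)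
qed

text \<open>The four numerical constants are fixed before G and are thus absolute.
  \<open>2 \<le> n\<close> is required because ln 1 = 0 would make the upper bound 0. The time bound
  holds for every admissible sample, with one program and one factor of \<open>nnz A\<close> for all
  inputs; its polynomial depends only on the polynomial bounding \<open>t1\<close> and
  \<open>t2\<close>.\<close>

theorem theorem16:
  shows "(\<exists>c1>0. \<exists>c2>0. \<exists>K1>0. \<exists>K2>0. \<forall>G. property_P G \<longrightarrow>
      (\<exists>\<alpha>'\<ge>1. \<exists>\<alpha>''\<ge>1. \<forall>\<mu> (n::nat) (d::nat) (t1::nat) (t2::nat) (A::real mat).
        real_distribution \<mu> \<and> (\<forall>t\<ge>0. cdf \<mu> t = 1 - exp (- G t)) \<and>
        2 \<le> n \<and> 1 \<le> d \<and> d \<le> n \<and> A \<in> carrier_mat n d \<and>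
        K1 * (real d)\<^sup>2 \<le> real t1 \<and> K2 * real d \<le> real t2 \<longrightarrow>
        measure (sample_measure \<mu> n t1 t2)
          {\<omega> \<in> space (sample_measure \<mu> n t1 t2). \<forall>x \<in> carrier_vec d.
             c1 * (1 / (\<alpha>' * real d * ln (real n))) * orlicz_norm G (A *\<^sub>v x)
               \<le> l2_norm (sketched A n t1 t2 \<omega> *\<^sub>v x) \<and>
             l2_norm (sketched A n t1 t2 \<omega> *\<^sub>v x)
               \<le> c2 * (\<alpha>'' * (real d)\<^sup>2 * ln (real n)) * orlicz_norm G (A *\<^sub>v x)}
          \<ge> (0.9::real)))
    \<and> (\<exists>(P::prog) (C::nat). \<forall>q::nat poly. \<exists>p::nat poly.
        \<forall>(n::nat) (d::nat) (t1::nat) (t2::nat) (A::real mat) \<delta> y h g (s::ram_state).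
        1 \<le> d \<and> d \<le> n \<and> A \<in> carrier_mat n d \<and> t1 \<le> poly q d \<and> t2 \<le> poly q d \<and>
        (\<forall>i<n. \<delta> i \<noteq> 0 \<and> y i \<in> {-1, 1} \<and> h i < t1) \<and>
        sketch_input A n d t1 t2 (\<delta>, y, h, g) s \<longrightarrow>
        (\<exists>k s'. exec P s k s' \<and> k \<le> C * nnz A + poly p d \<and>
           sketch_output (sketched A n t1 t2 (\<delta>, y, h, g)) s'))"
  by (rule conjI, rule exI[of _ "1 / 5120"], rule conjI, simp, rule exI[of _ 175000], rule conjI, simp,
      rule exI[of _ 80000], rule conjI, simp, rule exI[of _ 100], rule conjI, simp,
      intro allI impI, erule sketch_guarantee,
      rule exI[of _ sketch_prog], rule exI[of _ 15], rule allI, rule exI, intro allI impI, elim conjE,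
      rule sketch_running_time)

end
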